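(* Let $n>1$ and let $Z$ be a set of $n$ general points in $\mathbb{P}^2$, with homogeneous ideal $I$. Let the integers $d$ and $r$ be specified by $\binom{d+1}{2}\le n=\binom{d+2}{2}-r$ with $r>0$ (so that $d$ is the lowest degree of a curve passing through $Z$, and $r$ is the number of linearly independent curves of degree $d$ passing through $Z$). Then: (1) If $r=1$, the set of geometric generating degrees of $I$ is $\{d,d+1\}$ and the $d$-envelope $Z_d$ is a smooth curve of degree $d$. (2) If $r=2$ and $d>2$, the set of geometric generating degrees of $I$ is $\{d,d+1\}$, and $Z_d$ is a set of $d^2$ distinct, reduced points in $\mathbb{P}^2$, a complete intersection of type $(d,d)$, containing $Z$ together with $d^2-n=\binom{d-1}{2}$ extra points. (3) If $r=2$ and $d=2$ (so $n=4$), then $2$ is the only geometric generating degree of $I$. (4) If $r\ge 3$, then $d$ is the only geometric generating degree of $I$.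
   Context: Work over $\mathbb{C}$. "A set of $n$ general points" means: the statement holds for all sets of $n$ distinct points corresponding to points in some fixed dense Zariski-open subset of $(\mathbb{P}^2)^n$. Degree envelopes: for a nonempty closed subscheme $Z\subset\mathbb{P}^2$ with (saturated) homogeneous ideal $I$ and $m\ge 0$, the $m$-envelope $Z_m$ is the closed subscheme of $\mathbb{P}^2$ cut out by the degree $m$ piece $I_m$ of $I$, i.e. the scheme-theoretic intersection of all degree $m$ curves containing $Z$ (with $Z_m=\mathbb{P}^2$ if $I_m=0$). An integer $m$ is a geometric generating degree of $I$ if $Z_m\neq Z_{m-1}$. *)

theory Defs
  imports "HOL-Analysis.Analysis" "HOL-Library.Poly_Mapping"
begin

section \<open>Polynomials over the complex numbers\<close>

text \<open>A polynomial with variables indexed by the type 'x is a finitely supported map from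
  monomials (finitely supported exponent functions) to coefficients. The ring structure is the
  convolution product of HOL-Library.Poly_Mapping. The homogeneous coordinate ring of the plane has
  its three variables indexed by the three-element numeral type.\<close>

type_synonym 'x cpoly = "('x \<Rightarrow>\<^sub>0 nat) \<Rightarrow>\<^sub>0 complex"

definition poly_eval :: "'x cpoly \<Rightarrow> ('x \<Rightarrow> complex) \<Rightarrow> complex" where
  "poly_eval f a =
     (\<Sum>m\<in>Poly_Mapping.keys f. Poly_Mapping.lookup f m *
        (\<Prod>x\<in>Poly_Mapping.keys m. a x ^ Poly_Mapping.lookup m x))"

text \<open>The truncated subtraction of exponents only occurs with coefficient zero.\<close>

definition partial_deriv :: "'x \<Rightarrow> 'x cpoly \<Rightarrow> 'x cpoly" where
  "partial_deriv x f =
     (\<Sum>m\<in>Poly_Mapping.keys f.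
        Poly_Mapping.single (m - Poly_Mapping.single x 1)
          (of_nat (Poly_Mapping.lookup m x) * Poly_Mapping.lookup f m))"

definition poly_scale :: "complex \<Rightarrow> 'x cpoly \<Rightarrow> 'x cpoly" where
  "poly_scale c f = Poly_Mapping.single 0 c * f"

lemma vector_space_poly_scale: "vector_space (poly_scale :: complex \<Rightarrow> 'x cpoly \<Rightarrow> 'x cpoly)"
  by unfold_locales
    (simp_all add: poly_scale_def distrib_left distrib_right single_add mult_single
      flip: mult.assoc)

text \<open>The zero polynomial is homogeneous of every degree.\<close>

definition homogeneous :: "nat \<Rightarrow> 3 cpoly \<Rightarrow> bool" where
  "homogeneous k f \<longleftrightarrow>
     (\<forall>m\<in>Poly_Mapping.keys f. (\<Sum>i\<in>UNIV. Poly_Mapping.lookup m i) = k)"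


section \<open>Ideals\<close>

lemma module_times: "module ((*) :: 'a::comm_ring_1 \<Rightarrow> 'a \<Rightarrow> 'a)"
  by unfold_locales (simp_all add: algebra_simps)

text \<open>A commutative ring is a module over itself, and its ideals are the submodules.\<close>

definition ideal_gen :: "'a::comm_ring_1 set \<Rightarrow> 'a set" where
  "ideal_gen S = module.span (*) S"

definition graded_piece :: "3 cpoly set \<Rightarrow> nat \<Rightarrow> 3 cpoly set" where
  "graded_piece J k = {f \<in> J. homogeneous k f}"

text \<open>The saturation with respect to the irrelevant ideal: the forms of degree k generate its
  k-th power.\<close>

definition saturation :: "3 cpoly set \<Rightarrow> 3 cpoly set" where
  "saturation J = {f. \<exists>k. \<forall>g. homogeneous k g \<longrightarrow> f * g \<in> J}"


section \<open>Points of the projective plane\<close>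

text \<open>A point is the set of all its homogeneous coordinate vectors.\<close>

typedef proj_plane = "{{c *s v | c. c \<noteq> 0} | v. v \<noteq> (0 :: complex ^ 3)}"
  morphisms coords Abs_proj_plane
  by (intro exI[of _ "{c *s (1 :: complex ^ 3) | c. c \<noteq> 0}"]) (auto intro!: exI[of _ 1])

text \<open>Whether a form vanishes at a point does not depend on the coordinate vector; the definition
  is only used for homogeneous f.\<close>

definition vanishes_at :: "3 cpoly \<Rightarrow> proj_plane \<Rightarrow> bool" where
  "vanishes_at f P \<longleftrightarrow> (\<forall>v\<in>coords P. poly_eval f (($) v) = 0)"

definition homogeneous_ideal :: "proj_plane set \<Rightarrow> 3 cpoly set" where
  "homogeneous_ideal W = ideal_gen {f. (\<exists>k. homogeneous k f) \<and> (\<forall>P\<in>W. vanishes_at f P)}"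


section \<open>Closed subschemes of the projective plane and degree envelopes\<close>

text \<open>Closed subschemes correspond bijectively to saturated homogeneous ideals and are represented
  by them; equality of subschemes is equality of saturated ideals. The subscheme cut out by a set S
  of forms has ideal \<open>saturation (ideal_gen S)\<close>, the whole plane has ideal \<open>{0}\<close>, and the
  reduced subscheme supported on a finite set W of points has ideal \<open>homogeneous_ideal W\<close>.\<close>

definition envelope :: "3 cpoly set \<Rightarrow> nat \<Rightarrow> 3 cpoly set" where
  "envelope J m = saturation (ideal_gen (graded_piece J m))"

text \<open>The degree 0 is excluded because it has no preceding envelope. For a nonempty subscheme the
  envelope in degree 0 is the whole plane, so a convention for negative degrees would not add it.\<close>

definition geometric_generating_degrees :: "3 cpoly set \<Rightarrow> nat set" where
  "geometric_generating_degrees J = {m. m > 0 \<and> envelope J m \<noteq> envelope J (m - 1)}"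

text \<open>Nonsingularity is the Jacobian criterion for an equation of the curve.\<close>

definition smooth_plane_curve :: "nat \<Rightarrow> 3 cpoly set \<Rightarrow> bool" where
  "smooth_plane_curve k J \<longleftrightarrow>
     k > 0 \<and>
     (\<exists>F. F \<noteq> 0 \<and> homogeneous k F \<and> J = ideal_gen {F} \<and>
        (\<forall>P. vanishes_at F P \<longrightarrow> (\<exists>i. \<not> vanishes_at (partial_deriv i F) P)))"

text \<open>The three conditions after the degrees say that F, G is a regular sequence.\<close>

definition complete_intersection :: "nat \<Rightarrow> nat \<Rightarrow> 3 cpoly set \<Rightarrow> bool" where
  "complete_intersection a b J \<longleftrightarrow>
     (\<exists>F G. homogeneous a F \<and> homogeneous b G \<and>
        (\<forall>h. F * h = 0 \<longrightarrow> h = 0) \<and>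
        (\<forall>h. G * h \<in> ideal_gen {F} \<longrightarrow> h \<in> ideal_gen {F}) \<and>
        1 \<notin> ideal_gen {F, G} \<and>
        J = ideal_gen {F, G})"


section \<open>General sets of points\<close>

text \<open>Polynomials on a product of n planes have variables \<open>(i, j)\<close>, the j-th coordinate of the
  i-th point.\<close>

definition multihomogeneous :: "nat \<Rightarrow> (nat \<times> 3) cpoly \<Rightarrow> bool" where
  "multihomogeneous n g \<longleftrightarrow>
     (\<exists>e. \<forall>m\<in>Poly_Mapping.keys g.
        Poly_Mapping.keys m \<subseteq> {..<n} \<times> UNIV \<and>
        (\<forall>i<n. (\<Sum>j\<in>UNIV. Poly_Mapping.lookup m (i, j)) = e i))"

definition nonvanishing_locus :: "nat \<Rightarrow> (nat \<times> 3) cpoly \<Rightarrow> (nat \<Rightarrow> proj_plane) set" where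
  "nonvanishing_locus n g =
     {z \<in> {..<n} \<rightarrow>\<^sub>E UNIV.
        \<exists>v. (\<forall>i<n. v i \<in> coords (z i)) \<and> poly_eval g (\<lambda>(i, j). v i $ j) \<noteq> 0}"

text \<open>The Zariski topology on the product variety, which is finer than the product of the Zariski
  topologies.\<close>

definition zariski :: "nat \<Rightarrow> (nat \<Rightarrow> proj_plane) topology" where
  "zariski n = topology_generated_by {nonvanishing_locus n g | g. multihomogeneous n g}"

lemma topspace_zariski: "topspace (zariski n) = ({..<n} \<rightarrow>\<^sub>E UNIV)"
proof
  show "topspace (zariski n) \<subseteq> ({..<n} \<rightarrow>\<^sub>E UNIV)"
    by (auto simp: zariski_def nonvanishing_locus_def)
  have "\<exists>v. v \<in> coords P" for P
    using coords[of P] by (auto intro: exI[of _ "1 :: complex"])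
  then obtain u where u: "u P \<in> coords P" for P
    by metis
  have "multihomogeneous n 1"
    unfolding multihomogeneous_def by (rule exI[of _ "\<lambda>_. 0"]) simp
  moreover have "({..<n} \<rightarrow>\<^sub>E UNIV) \<subseteq> nonvanishing_locus n 1"
  proof
    fix z :: "nat \<Rightarrow> proj_plane"
    assume "z \<in> {..<n} \<rightarrow>\<^sub>E UNIV"
    then show "z \<in> nonvanishing_locus n 1"
      unfolding nonvanishing_locus_def
      using u by (intro CollectI conjI exI[of _ "\<lambda>i. u (z i)"]) (simp_all add: poly_eval_def)
  qed
  ultimately show "({..<n} \<rightarrow>\<^sub>E UNIV) \<subseteq> topspace (zariski n)"
    by (auto simp: zariski_def)
qed

definition general_points :: "nat \<Rightarrow> (proj_plane set \<Rightarrow> bool) \<Rightarrow> bool" where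
  "general_points n Q \<longleftrightarrow>
     (\<exists>U. openin (zariski n) U \<and> zariski n closure_of U = topspace (zariski n) \<and>
        (\<forall>z\<in>U. inj_on z {..<n} \<longrightarrow> Q (z ` {..<n})))"

end

theory Submission
imports
  Defs
  "HOL-Computational_Algebra.Field_as_Ring"
  "Jordan_Normal_Form.Char_Poly"
  "Subresultants.Subresultant_Gcd"
begin

text \<open>
  A property of n points is general as soon as it is implied by the nonvanishing of one polynomial
  function of the coordinate vectors and this function is nonzero somewhere: its multihomogeneous
  components define the open set. So every clause needs an open condition and one example.

  The forms of degree d through points imposing independent conditions have a basis given by
  Cramer's rule, hence depending polynomially on the points. The example is the triangle of lattice
  points (i, j) with i + j at most d, which imposes independent conditions with an explicit
  dual basis of products of lines, with r points removed. Removing the corners (d, 0) and (0, d)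
  leaves a subset of the square grid of d^2 points, a complete intersection; removing also (0, 0)
  adds a form vanishing at no other grid point than the ones that remain, so that for r at least 3
  the ideal is cut out in degree d. For r = 1 the example lies on a Fermat curve.

  Mumford's regularity argument shows that the ideal is generated in degrees at most d + 1. For
  r = 2 the open condition says that an eliminant of the two curves has d^2 distinct roots: each of them gives a
  common zero, and counting dimensions in high degree identifies the ideal of these zeros with the
  ideal of the two forms.
\<close>

text \<open>Write X and Y for \<open>var 1\<close> and \<open>var 2\<close>. Density is available
  only for the nonvanishing of polynomial functions, so smoothness, the absence of common components
  and generation in degree d have to be recast: a square family of forms, depending polynomially on
  the points, is a basis of the forms of one fixed degree, and its coefficient determinant is the
  required function. Smoothness and generation are tested in degree 3 * d, where at the example
  every form can be written in the required way. For r = 2 the test degree is 2 * d - 1: the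
  coordinate ring of a complete intersection of type (d, d) has dimension d^2 in the degrees 2 * d -
  2 and 2 * d - 1, and the determinant says that multiplication by a linear form l identifies the
  two pieces. The choice l = X replaces Bezout's theorem and unmixedness: X becomes a nonzerodivisor
  modulo the two curves, and d^2 forms span the quotient in every high degree. The choice l = Y - s
  * X gives, as a polynomial in s, the eliminant.\<close>

definition mono_eval :: "('x \<Rightarrow>\<^sub>0 nat) \<Rightarrow> ('x \<Rightarrow> complex) \<Rightarrow> complex" where
  "mono_eval m a = (\<Prod>x\<in>Poly_Mapping.keys m. a x ^ Poly_Mapping.lookup m x)"

definition const :: "complex \<Rightarrow> 'x cpoly" where
  "const c = Poly_Mapping.single 0 c"

definition var :: "'x \<Rightarrow> 'x cpoly" where
  "var x = Poly_Mapping.single (Poly_Mapping.single x 1) 1"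

lemma mono_eval_superset:
  assumes "finite K" "Poly_Mapping.keys m \<subseteq> K"
  shows "mono_eval m a = (\<Prod>x\<in>K. a x ^ Poly_Mapping.lookup m x)"
  unfolding mono_eval_def
  by (rule prod.mono_neutral_left) (use assms in \<open>auto simp: in_keys_iff\<close>)

lemma mono_eval_0 [simp]: "mono_eval 0 a = 1"
  by (simp add: mono_eval_def)

lemma mono_eval_add: "mono_eval (m + m') a = mono_eval m a * mono_eval m' a"
proof -
  let ?K = "Poly_Mapping.keys m \<union> Poly_Mapping.keys m'"
  have "mono_eval (m + m') a = (\<Prod>x\<in>?K. a x ^ Poly_Mapping.lookup (m + m') x)"
    by (rule mono_eval_superset) (use keys_add[of m m'] in auto)
  also have "\<dots> = mono_eval m a * mono_eval m' a"
    by (subst (1 2) mono_eval_superset[of ?K]) (auto simp: lookup_add power_add prod.distrib)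
  finally show ?thesis .
qed

lemma mono_eval_single [simp]: "mono_eval (Poly_Mapping.single x k) a = a x ^ k"
  by (cases "k = 0") (auto simp: mono_eval_def)

lemma poly_eval_superset:
  assumes "finite K" "Poly_Mapping.keys f \<subseteq> K"
  shows "poly_eval f a = (\<Sum>m\<in>K. Poly_Mapping.lookup f m * mono_eval m a)"
  unfolding poly_eval_def mono_eval_def
  by (rule sum.mono_neutral_left) (use assms in \<open>auto simp: in_keys_iff\<close>)

lemma poly_eval_0 [simp]: "poly_eval 0 a = 0"
  by (simp add: poly_eval_def)

lemma poly_eval_single [simp]: "poly_eval (Poly_Mapping.single m c) a = c * mono_eval m a"
  by (subst poly_eval_superset[of "{m}"]) auto

lemma poly_eval_add [simp]: "poly_eval (f + g) a = poly_eval f a + poly_eval g a"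
proof -
  let ?K = "Poly_Mapping.keys f \<union> Poly_Mapping.keys g"
  have "poly_eval (f + g) a = (\<Sum>m\<in>?K. Poly_Mapping.lookup (f + g) m * mono_eval m a)"
    by (rule poly_eval_superset) (use keys_add[of f g] in auto)
  also have "\<dots> = poly_eval f a + poly_eval g a"
    by (subst (1 2) poly_eval_superset[of ?K])
      (auto simp: lookup_add distrib_right sum.distrib)
  finally show ?thesis .
qed

lemma poly_eval_sum [simp]: "poly_eval (sum f A) a = (\<Sum>i\<in>A. poly_eval (f i) a)"
  by (induction A rule: infinite_finite_induct) auto

lemma sum_single_lookup:
  assumes "finite K" "Poly_Mapping.keys f \<subseteq> K"
  shows "(\<Sum>m\<in>K. Poly_Mapping.single m (Poly_Mapping.lookup f m)) = f"
proof (rule poly_mapping_eqI)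
  fix k
  have "Poly_Mapping.lookup (\<Sum>m\<in>K. Poly_Mapping.single m (Poly_Mapping.lookup f m)) k =
      (\<Sum>m\<in>K. if m = k then Poly_Mapping.lookup f k else 0)"
    unfolding lookup_sum by (rule sum.cong) (auto simp: lookup_single when_def)
  also have "\<dots> = Poly_Mapping.lookup f k"
    using assms by (auto simp: in_keys_iff)
  finally show "Poly_Mapping.lookup (\<Sum>m\<in>K. Poly_Mapping.single m (Poly_Mapping.lookup f m)) k =
      Poly_Mapping.lookup f k" .
qed

lemma poly_eval_mult [simp]: "poly_eval (f * g) a = poly_eval f a * poly_eval g a"
proof -
  let ?s = "\<lambda>h m. Poly_Mapping.single m (Poly_Mapping.lookup h m)"
  have "f * g = (\<Sum>m\<in>Poly_Mapping.keys f. ?s f m) * (\<Sum>m\<in>Poly_Mapping.keys g. ?s g m)"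
    by (simp add: sum_single_lookup)
  then have "poly_eval (f * g) a = (\<Sum>m\<in>Poly_Mapping.keys f. \<Sum>m'\<in>Poly_Mapping.keys g.
      (Poly_Mapping.lookup f m * mono_eval m a) * (Poly_Mapping.lookup g m' * mono_eval m' a))"
    by (simp add: sum_product mult_single mono_eval_add algebra_simps)
  also have "\<dots> = poly_eval f a * poly_eval g a"
    by (simp add: poly_eval_def mono_eval_def sum_product)
  finally show ?thesis .
qed

lemma poly_eval_const [simp]: "poly_eval (const c) a = c"
  by (simp add: const_def)

lemma poly_eval_var [simp]: "poly_eval (var x) a = a x"
  by (simp add: var_def)

lemma poly_eval_1 [simp]: "poly_eval 1 a = 1"
  by (simp flip: single_one)

lemma poly_eval_uminus [simp]: "poly_eval (- f) a = - poly_eval f a"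
proof -
  have "poly_eval (f + (- f)) a = 0" by simp
  then show ?thesis unfolding poly_eval_add by (simp add: eq_neg_iff_add_eq_0 add.commute)
qed

lemma poly_eval_diff [simp]: "poly_eval (f - g) a = poly_eval f a - poly_eval g a"
  using poly_eval_add[of f "- g" a] by simp

lemma poly_eval_power [simp]: "poly_eval (f ^ k) a = poly_eval f a ^ k"
  by (induction k) auto

lemma poly_eval_prod [simp]: "poly_eval (prod f A) a = (\<Prod>i\<in>A. poly_eval (f i) a)"
  by (induction A rule: infinite_finite_induct) auto

lemma poly_scale_conv: "poly_scale c f = const c * f"
  by (simp add: poly_scale_def const_def)

lemma poly_eval_scale [simp]: "poly_eval (poly_scale c f) a = c * poly_eval f a"
  by (simp add: poly_scale_conv)

lemma single_conv_const: "Poly_Mapping.single m c = const c * Poly_Mapping.single m (1::complex)"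
  by (simp add: const_def mult_single)

text \<open>Constants and variables generate the polynomial ring. This induction serves for
  operations that are not given monomial by monomial, such as substitution in
  \<open>divide_by_variable\<close>.\<close>

lemma cpoly_induct [case_names const var add mult]:
  assumes "\<And>c. P (const c)" "\<And>x. P (var x)" "\<And>f g. P f \<Longrightarrow> P g \<Longrightarrow> P (f + g)"
    "\<And>f g. P f \<Longrightarrow> P g \<Longrightarrow> P (f * g)"
  shows "P (f :: 'x cpoly)"
proof -
  have P0: "P 0" using assms(1)[of 0] by (simp add: const_def)
  have P1: "P 1" using assms(1)[of 1] by (simp add: const_def)
  have single: "P (Poly_Mapping.single (Poly_Mapping.single x k) 1)" for x k
  proof (induction k)
    case (Suc k)
    have "Poly_Mapping.single (Poly_Mapping.single x (Suc k)) (1::complex) =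
      Poly_Mapping.single (Poly_Mapping.single x k) 1 * var x"
      by (simp add: var_def mult_single flip: single_add)
    then show ?case using Suc assms(2,4) by simp
  qed (use P1 in simp)
  have mono: "finite K \<Longrightarrow> P (Poly_Mapping.single (\<Sum>x\<in>K. Poly_Mapping.single x (l x)) 1)"
    for K and l :: "'x \<Rightarrow> nat"
  proof (induction K rule: finite_induct)
    case (insert x K)
    have "Poly_Mapping.single (\<Sum>x\<in>insert x K. Poly_Mapping.single x (l x)) (1::complex) =
       Poly_Mapping.single (Poly_Mapping.single x (l x)) 1 *
       Poly_Mapping.single (\<Sum>x\<in>K. Poly_Mapping.single x (l x)) 1"
      using insert by (simp add: mult_single)
    then show ?case using insert assms(4) single by simp
  qed (use P1 in simp)
  have exp: "(\<Sum>x\<in>Poly_Mapping.keys m. Poly_Mapping.single x (Poly_Mapping.lookup m x)) = m"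
    for m :: "'x \<Rightarrow>\<^sub>0 nat"
  proof (rule poly_mapping_eqI)
    fix k
    have "Poly_Mapping.lookup (\<Sum>x\<in>Poly_Mapping.keys m. Poly_Mapping.single x (Poly_Mapping.lookup m x)) k
      = (\<Sum>x\<in>Poly_Mapping.keys m. if x = k then Poly_Mapping.lookup m k else 0)"
      unfolding lookup_sum by (rule sum.cong) (auto simp: lookup_single when_def)
    then show "Poly_Mapping.lookup (\<Sum>x\<in>Poly_Mapping.keys m. Poly_Mapping.single x (Poly_Mapping.lookup m x)) k
      = Poly_Mapping.lookup m k" by (auto simp: in_keys_iff)
  qed
  have monom: "P (Poly_Mapping.single m c)" for m c
    using mono[of "Poly_Mapping.keys m" "Poly_Mapping.lookup m"] assms(1,4)
    unfolding exp by (subst single_conv_const) auto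
  have "finite K \<Longrightarrow> P (\<Sum>m\<in>K. Poly_Mapping.single m (Poly_Mapping.lookup f m))" for K
    by (induction K rule: finite_induct) (use P0 assms(3) monom in auto)
  then show ?thesis
    using sum_single_lookup[of "Poly_Mapping.keys f" f] by (metis finite_keys order_refl)
qed

subsection \<open>Weights and homogeneous components\<close>

text \<open>The degree in the variables from S. One grading serves three purposes: S =
  \<open>UNIV\<close> gives the total degree, S = \<open>{k} \<times> UNIV\<close> the degree in the
  coordinates of the k-th point, and a singleton the degree in one variable.\<close>

definition weight :: "'x set \<Rightarrow> ('x \<Rightarrow>\<^sub>0 nat) \<Rightarrow> nat" where
  "weight S m = (\<Sum>x\<in>Poly_Mapping.keys m \<inter> S. Poly_Mapping.lookup m x)"

definition weight_part :: "'x set \<Rightarrow> nat \<Rightarrow> 'x cpoly \<Rightarrow> 'x cpoly" where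
  "weight_part S k f =
     (\<Sum>m\<in>{m \<in> Poly_Mapping.keys f. weight S m = k}. Poly_Mapping.single m (Poly_Mapping.lookup f m))"

lemma weight_superset:
  assumes "finite K" "Poly_Mapping.keys m \<inter> S \<subseteq> K" "K \<subseteq> S"
  shows "weight S m = (\<Sum>x\<in>K. Poly_Mapping.lookup m x)"
  unfolding weight_def by (rule sum.mono_neutral_left) (use assms in \<open>auto simp: in_keys_iff\<close>)

lemma weight_add [simp]: "weight S (m + m') = weight S m + weight S m'"
proof -
  let ?K = "(Poly_Mapping.keys m \<union> Poly_Mapping.keys m') \<inter> S"
  have "weight S (m + m') = (\<Sum>x\<in>?K. Poly_Mapping.lookup (m + m') x)"
    by (rule weight_superset) (use keys_add[of m m'] in auto)
  then show ?thesis
    by (subst (1 2) weight_superset[of ?K]) (auto simp: lookup_add sum.distrib)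
qed

lemma weight_0 [simp]: "weight S 0 = 0"
  by (simp add: weight_def)

lemma weight_single: "weight S (Poly_Mapping.single x k) = (if x \<in> S then k else 0)"
  by (cases "k = 0") (auto simp: weight_def)

lemma lookup_weight_part: "Poly_Mapping.lookup (weight_part S k f) m = (if weight S m = k then Poly_Mapping.lookup f m else 0)"
proof -
  have "Poly_Mapping.lookup (weight_part S k f) m =
     (\<Sum>m'\<in>{m \<in> Poly_Mapping.keys f. weight S m = k}. if m' = m then Poly_Mapping.lookup f m else 0)"
    unfolding weight_part_def lookup_sum by (rule sum.cong) (auto simp: lookup_single when_def)
  also have "\<dots> = (if weight S m = k then Poly_Mapping.lookup f m else 0)"
    by (auto simp: in_keys_iff)
  finally show ?thesis .
qed

lemma keys_weight_part: "Poly_Mapping.keys (weight_part S k f) = {m \<in> Poly_Mapping.keys f. weight S m = k}"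
  by (auto simp: in_keys_iff lookup_weight_part split: if_splits)

lemma weight_part_bound: "\<exists>B. \<forall>k\<ge>B. weight_part S k f = 0"
proof -
  have "finite (weight S ` Poly_Mapping.keys f)" by simp
  then obtain B where B: "\<And>m. m \<in> Poly_Mapping.keys f \<Longrightarrow> weight S m < B"
    by (metis (no_types, lifting) finite_nat_set_iff_bounded image_eqI)
  have "weight_part S k f = 0" if "k \<ge> B" for k
  proof -
    have "Poly_Mapping.keys (weight_part S k f) = {}"
      using B that by (force simp: keys_weight_part)
    then show ?thesis by simp
  qed
  then show ?thesis by blast
qed

lemma sum_weight_part:
  assumes "\<And>k. k \<ge> B \<Longrightarrow> weight_part S k f = 0"
  shows "(\<Sum>k<B. weight_part S k f) = f"
proof (rule poly_mapping_eqI)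
  fix m
  have "Poly_Mapping.lookup (\<Sum>k<B. weight_part S k f) m = (if weight S m < B then Poly_Mapping.lookup f m else 0)"
    unfolding lookup_sum lookup_weight_part by simp
  also have "\<dots> = Poly_Mapping.lookup f m"
    using assms[of "weight S m"] lookup_weight_part[of S "weight S m" f m] by auto
  finally show "Poly_Mapping.lookup (\<Sum>k<B. weight_part S k f) m = Poly_Mapping.lookup f m" .
qed

lemma mono_eval_scaled:
  "mono_eval m (\<lambda>x. if x \<in> S then t * a x else a x) = t ^ weight S m * mono_eval m a"
proof -
  have "mono_eval m (\<lambda>x. if x \<in> S then t * a x else a x) =
    (\<Prod>x\<in>Poly_Mapping.keys m. (if x \<in> S then t ^ Poly_Mapping.lookup m x else 1) * a x ^ Poly_Mapping.lookup m x)"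
    unfolding mono_eval_def by (rule prod.cong) (auto simp: power_mult_distrib)
  also have "\<dots> = (\<Prod>x\<in>Poly_Mapping.keys m. (if x \<in> S then t ^ Poly_Mapping.lookup m x else 1)) * mono_eval m a"
    by (simp add: prod.distrib mono_eval_def)
  also have "(\<Prod>x\<in>Poly_Mapping.keys m. (if x \<in> S then t ^ Poly_Mapping.lookup m x else 1)) = t ^ weight S m"
    unfolding weight_def power_sum by (subst prod.inter_restrict) auto
  finally show ?thesis .
qed

lemma poly_eval_weight_part_scaled:
  "poly_eval (weight_part S k f) (\<lambda>x. if x \<in> S then t * a x else a x) = t ^ k * poly_eval (weight_part S k f) a"
  unfolding weight_part_def by (simp add: sum_distrib_left mono_eval_scaled) (rule sum.cong, auto)

lemma poly_eval_scaled:
  assumes "\<And>k. k \<ge> B \<Longrightarrow> weight_part S k f = 0"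
  shows "poly_eval f (\<lambda>x. if x \<in> S then t * a x else a x) = (\<Sum>k<B. t ^ k * poly_eval (weight_part S k f) a)"
proof -
  have "poly_eval f (\<lambda>x. if x \<in> S then t * a x else a x) =
    poly_eval (\<Sum>k<B. weight_part S k f) (\<lambda>x. if x \<in> S then t * a x else a x)"
    by (simp add: sum_weight_part[OF assms])
  then show ?thesis by (simp add: poly_eval_weight_part_scaled)
qed

lemma exists_nonroot:
  fixes c :: "nat \<Rightarrow> complex"
  assumes "i < B" "c i \<noteq> 0" "finite E"
  shows "\<exists>t. t \<notin> E \<and> (\<Sum>k<B. t ^ k * c k) \<noteq> 0"
proof -
  define p where "p = (\<Sum>k<B. monom (c k) k)"
  have "coeff p i = c i" using assms(1) by (simp add: p_def coeff_sum)
  then have "p \<noteq> 0" using assms(2) by auto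
  then have "finite ({t. poly p t = 0} \<union> E)" using poly_roots_finite assms(3) by auto
  then obtain t where "t \<notin> {t. poly p t = 0} \<union> E"
    using ex_new_if_finite[OF infinite_UNIV_char_0] by blast
  then show ?thesis by (intro exI[of _ t]) (auto simp: p_def poly_sum poly_monom mult.commute)
qed

text \<open>Along the scaling of the variables in S the value of f is a polynomial in t whose
  coefficients are the values of the components; if it vanishes for all nonzero t, each coefficient
  is zero.\<close>

lemma weight_part_vanishes:
  assumes "\<And>t. t \<noteq> 0 \<Longrightarrow> poly_eval f (\<lambda>x. if x \<in> S then t * a x else a x) = 0"
  shows "poly_eval (weight_part S k f) a = 0"
proof -
  obtain B where B: "\<And>k. k \<ge> B \<Longrightarrow> weight_part S k f = 0" using weight_part_bound by blast
  show ?thesis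
  proof (cases "k < B")
    case True
    show ?thesis
    proof (rule ccontr)
      assume "poly_eval (weight_part S k f) a \<noteq> 0"
      then obtain t where "t \<notin> {0}" "(\<Sum>k<B. t ^ k * poly_eval (weight_part S k f) a) \<noteq> 0"
        using exists_nonroot[OF True, of "\<lambda>k. poly_eval (weight_part S k f) a" "{0}"] by auto
      then show False using assms[of t] poly_eval_scaled[of B S f t a, OF B] by auto
    qed
  qed (use B in auto)
qed

text \<open>Separating a polynomial into components with respect to each single variable leaves
  monomials.\<close>

lemma poly_eval_eq_0:
  fixes f :: "'x::finite cpoly"
  assumes "\<And>a. poly_eval f a = 0"
  shows "f = 0"
proof -
  have comp: "\<forall>a. poly_eval (weight_part S k g) a = 0" if "\<forall>a. poly_eval g a = 0" for S k and g :: "'x cpoly"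
    using that by (auto intro: weight_part_vanishes)
  have fin: "finite A \<Longrightarrow> \<exists>g. (\<forall>a. poly_eval g a = 0) \<and> (\<forall>m. Poly_Mapping.lookup g m =
     (if \<forall>x\<in>A. Poly_Mapping.lookup m x = Poly_Mapping.lookup m0 x then Poly_Mapping.lookup f m else 0))"
    for A m0
  proof (induction A rule: finite_induct)
    case empty
    then show ?case using assms by auto
  next
    case (insert x A)
    then obtain g where g: "\<forall>a. poly_eval g a = 0" "\<forall>m. Poly_Mapping.lookup g m =
       (if \<forall>x\<in>A. Poly_Mapping.lookup m x = Poly_Mapping.lookup m0 x then Poly_Mapping.lookup f m else 0)"
      by blast
    have w: "weight {x} m = Poly_Mapping.lookup m x" for m
      by (subst weight_superset[of "{x}"]) auto
    show ?case
      by (rule exI[of _ "weight_part {x} (Poly_Mapping.lookup m0 x) g"])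
        (use comp[OF g(1)] g(2) in \<open>auto simp: lookup_weight_part w\<close>)
  qed
  show ?thesis
  proof (rule poly_mapping_eqI)
    fix m0
    obtain g where g: "\<forall>a. poly_eval g a = 0" "\<forall>m. Poly_Mapping.lookup g m =
       (if \<forall>x\<in>UNIV. Poly_Mapping.lookup m x = Poly_Mapping.lookup m0 x then Poly_Mapping.lookup f m else 0)"
      using fin[of UNIV m0] by auto
    have "g = Poly_Mapping.single m0 (Poly_Mapping.lookup f m0)"
    proof (rule poly_mapping_eqI)
      fix m
      have "(\<forall>x\<in>UNIV. Poly_Mapping.lookup m x = Poly_Mapping.lookup m0 x) \<longleftrightarrow> m0 = m"
        by (auto intro: poly_mapping_eqI)
      then show "Poly_Mapping.lookup g m = Poly_Mapping.lookup (Poly_Mapping.single m0 (Poly_Mapping.lookup f m0)) m"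
        unfolding g(2)[rule_format] lookup_single when_def by (simp only:) simp
    qed
    moreover have "mono_eval m0 (\<lambda>_. 1) = 1" by (simp add: mono_eval_def)
    ultimately show "Poly_Mapping.lookup f m0 = Poly_Mapping.lookup 0 m0"
      using g(1) by (metis mult.right_neutral poly_eval_single lookup_zero)
  qed
qed

subsection \<open>Forms\<close>

abbreviation hom_part :: "nat \<Rightarrow> 3 cpoly \<Rightarrow> 3 cpoly" where
  "hom_part \<equiv> weight_part UNIV"

lemma weight_UNIV: "weight UNIV m = (\<Sum>i\<in>UNIV. Poly_Mapping.lookup m i)" for m :: "3 \<Rightarrow>\<^sub>0 nat"
  by (rule weight_superset) auto

lemma homogeneous_weight: "homogeneous k f \<longleftrightarrow> (\<forall>m\<in>Poly_Mapping.keys f. weight UNIV m = k)"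
  by (simp add: homogeneous_def weight_UNIV)

lemma homogeneous_0 [simp]: "homogeneous k 0"
  by (simp add: homogeneous_def)

lemma homogeneous_add: "homogeneous k f \<Longrightarrow> homogeneous k g \<Longrightarrow> homogeneous k (f + g)"
  using keys_add[of f g] by (auto simp: homogeneous_weight)

lemma homogeneous_sum: "(\<And>i. i \<in> A \<Longrightarrow> homogeneous k (f i)) \<Longrightarrow> homogeneous k (sum f A)"
  by (induction A rule: infinite_finite_induct) (auto intro: homogeneous_add)

lemma homogeneous_mult: "homogeneous j f \<Longrightarrow> homogeneous k g \<Longrightarrow> homogeneous (j + k) (f * g)"
  unfolding homogeneous_weight using keys_mult[of f g] by fastforce

lemma homogeneous_const [simp]: "homogeneous 0 (const c)"
  by (simp add: homogeneous_weight const_def)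

lemma homogeneous_1 [simp]: "homogeneous 0 1"
  by (simp add: homogeneous_weight)

lemma homogeneous_var [simp]: "homogeneous (Suc 0) (var x)"
  by (simp add: homogeneous_weight var_def weight_single)

lemma homogeneous_const_mult [intro]: "homogeneous k f \<Longrightarrow> homogeneous k (const c * f)"
  using homogeneous_mult[of 0 "const c" k f] by simp

lemma homogeneous_uminus: "homogeneous k f \<Longrightarrow> homogeneous k (- f)"
  by (auto simp: homogeneous_weight in_keys_iff)

lemma homogeneous_diff: "homogeneous k f \<Longrightarrow> homogeneous k g \<Longrightarrow> homogeneous k (f - g)"
  using homogeneous_add[of k f "- g"] homogeneous_uminus by auto

lemma homogeneous_power: "homogeneous k f \<Longrightarrow> homogeneous (k * j) (f ^ j)"
  by (induction j) (auto intro: homogeneous_mult simp: algebra_simps)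

lemma homogeneous_prod:
  "(\<And>i. i \<in> A \<Longrightarrow> homogeneous (k i) (f i)) \<Longrightarrow> homogeneous (sum k A) (prod f A)"
  by (induction A rule: infinite_finite_induct) (auto intro: homogeneous_mult)

lemma homogeneous_hom_part [simp]: "homogeneous k (hom_part k f)"
  by (auto simp: homogeneous_weight keys_weight_part)

lemma hom_part_homogeneous: "homogeneous j f \<Longrightarrow> hom_part k f = (if k = j then f else 0)"
  by (rule poly_mapping_eqI) (auto simp: lookup_weight_part homogeneous_weight in_keys_iff)

lemma hom_part_add: "hom_part k (f + g) = hom_part k f + hom_part k g"
  by (rule poly_mapping_eqI) (auto simp: lookup_weight_part lookup_add)

lemma hom_part_0 [simp]: "hom_part k 0 = 0"
  by (rule poly_mapping_eqI) (auto simp: lookup_weight_part)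

lemma hom_part_diff: "hom_part k (f - g) = hom_part k f - hom_part k g"
  by (rule poly_mapping_eqI) (auto simp: lookup_weight_part lookup_minus)

lemma hom_part_sum: "hom_part k (sum f A) = (\<Sum>i\<in>A. hom_part k (f i))"
  by (induction A rule: infinite_finite_induct) (auto simp: hom_part_add)

lemma hom_part_decomp: "\<exists>B. f = (\<Sum>k<B. hom_part k f) \<and> (\<forall>k\<ge>B. hom_part k f = 0)"
  using weight_part_bound[of UNIV f] sum_weight_part[of _ UNIV f] by metis

lemma hom_part_mult:
  assumes "homogeneous j l"
  shows "hom_part i (l * f) = (if i < j then 0 else l * hom_part (i - j) f)"
proof -
  obtain B where B: "f = (\<Sum>k<B. hom_part k f)" "\<forall>k\<ge>B. hom_part k f = 0" using hom_part_decomp by blast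
  have "hom_part i (l * f) = (\<Sum>k<B. hom_part i (l * hom_part k f))"
    by (subst B(1)) (simp add: sum_distrib_left hom_part_sum)
  also have "\<dots> = (\<Sum>k<B. if i = j + k then l * hom_part k f else 0)"
    by (rule sum.cong) (use assms in \<open>auto simp: hom_part_homogeneous[OF homogeneous_mult]\<close>)
  also have "\<dots> = (if i < j then 0 else l * hom_part (i - j) f)"
  proof (cases "i < j")
    case False
    then have "(\<Sum>k<B. if i = j + k then l * hom_part k f else 0) =
       (\<Sum>k<B. if k = i - j then l * hom_part (i - j) f else 0)"
      by (intro sum.cong) auto
    then show ?thesis using False B(2) by auto
  qed auto
  finally show ?thesis .
qed

abbreviation ev :: "3 cpoly \<Rightarrow> complex ^ 3 \<Rightarrow> complex" where
  "ev f v \<equiv> poly_eval f (($) v)"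

text \<open>Identities of polynomials are checked pointwise through this. As the ring has no zero
  divisors, an extra nonzero factor such as \<open>var 1\<close> confines such a check to the points
  where the factor does not vanish.\<close>

lemma ev_eq_0:
  assumes "\<And>v. ev f v = 0" shows "f = 0"
proof (rule poly_eval_eq_0)
  fix a :: "3 \<Rightarrow> complex"
  have "($) (\<chi> i. a i) = a" by auto
  then show "poly_eval f a = 0" using assms[of "\<chi> i. a i"] by simp
qed

lemma ev_hom_scale:
  assumes "homogeneous k f"
  shows "ev f (c *s v) = c ^ k * ev f v"
proof -
  have "f = weight_part UNIV k f" using hom_part_homogeneous[OF assms, of k] by simp
  moreover have "(\<lambda>x. if x \<in> UNIV then c * v $ x else v $ x) = ($) (c *s v)"
    by (auto simp: vector_scalar_mult_def)
  ultimately show ?thesis using poly_eval_weight_part_scaled[of UNIV k f c "($) v"] by metis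
qed

lemma hom0_const: "homogeneous 0 f \<Longrightarrow> f = const (Poly_Mapping.lookup f 0)"
proof (rule poly_mapping_eqI)
  fix m assume f: "homogeneous 0 f"
  have "weight UNIV m = 0 \<Longrightarrow> m = 0" for m :: "3 \<Rightarrow>\<^sub>0 nat"
    by (rule poly_mapping_eqI) (simp add: weight_UNIV)
  then show "Poly_Mapping.lookup f m = Poly_Mapping.lookup (const (Poly_Mapping.lookup f 0)) m"
  proof (cases "m = 0")
    case False
    then have "m \<notin> Poly_Mapping.keys f" using f \<open>\<And>m. weight UNIV m = 0 \<Longrightarrow> m = 0\<close> by (auto simp: homogeneous_weight)
    then show ?thesis using False by (simp add: const_def lookup_single in_keys_iff)
  qed (simp add: const_def)
qed

text \<open>Every monomial of positive degree contains some variable. This is the induction step for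
  statements about forms of increasing degree.\<close>

lemma hom_Suc_decomp:
  assumes "homogeneous (Suc k) f"
  shows "\<exists>g. (\<forall>i. homogeneous k (g i)) \<and> f = (\<Sum>i\<in>UNIV. var i * g i)"
proof -
  have mono: "\<exists>g. (\<forall>i. homogeneous k (g i)) \<and> Poly_Mapping.single m c = (\<Sum>i\<in>UNIV. var i * g i)"
    if "weight UNIV m = Suc k" for m and c :: complex
  proof -
    have "\<exists>i. Poly_Mapping.lookup m i \<noteq> 0"
      using that by (metis Zero_not_Suc sum.neutral weight_UNIV)
    then obtain i where i: "Poly_Mapping.lookup m i \<noteq> 0" by blast
    have m: "m = Poly_Mapping.single i 1 + (m - Poly_Mapping.single i 1)"
      by (rule poly_mapping_eqI) (use i in \<open>auto simp: lookup_add lookup_minus lookup_single when_def\<close>)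
    have "weight UNIV m = weight UNIV (Poly_Mapping.single i 1) + weight UNIV (m - Poly_Mapping.single i 1)"
      by (subst m) simp
    then have w: "weight UNIV (m - Poly_Mapping.single i 1) = k"
      using that by (simp add: weight_single)
    define g where "g j = (if j = i then Poly_Mapping.single (m - Poly_Mapping.single i 1) c else 0)" for j
    have "Poly_Mapping.single m c = var i * Poly_Mapping.single (m - Poly_Mapping.single i 1) c"
      unfolding var_def mult_single using m by simp
    also have "\<dots> = (\<Sum>j\<in>UNIV. if j = i then var i * g i else 0)"
      by (simp add: g_def)
    also have "\<dots> = (\<Sum>j\<in>UNIV. var j * g j)"
      by (rule sum.cong) (auto simp: g_def)
    finally show ?thesis
      using w by (intro exI[of _ g]) (auto simp: g_def homogeneous_weight)
  qed
  have "finite K \<Longrightarrow> \<forall>m\<in>K. weight UNIV m = Suc k \<Longrightarrow> \<exists>g. (\<forall>i. homogeneous k (g i)) \<and>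
    (\<Sum>m\<in>K. Poly_Mapping.single m (Poly_Mapping.lookup f m)) = (\<Sum>i\<in>UNIV. var i * g i)" for K
  proof (induction K rule: finite_induct)
    case empty
    then show ?case by (intro exI[of _ "\<lambda>_. 0"]) auto
  next
    case (insert m K)
    then obtain g where g: "\<forall>i. homogeneous k (g i)"
       "(\<Sum>m\<in>K. Poly_Mapping.single m (Poly_Mapping.lookup f m)) = (\<Sum>i\<in>UNIV. var i * g i)" by auto
    obtain h where h: "\<forall>i. homogeneous k (h i)"
       "Poly_Mapping.single m (Poly_Mapping.lookup f m) = (\<Sum>i\<in>UNIV. var i * h i)"
      using mono insert by blast
    show ?case
      by (rule exI[of _ "\<lambda>i. h i + g i"])
        (use g h insert in \<open>auto simp: homogeneous_add distrib_left sum.distrib\<close>)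
  qed
  from this[of "Poly_Mapping.keys f"] show ?thesis
    using assms by (simp add: sum_single_lookup homogeneous_weight)
qed

subsection \<open>Ideals\<close>

interpretation ring_mod: Modules.module "(*) :: 'a::comm_ring_1 \<Rightarrow> 'a \<Rightarrow> 'a"
  by (rule module_times)

lemma ideal_gen_base: "f \<in> S \<Longrightarrow> f \<in> ideal_gen S"
  by (simp add: ideal_gen_def ring_mod.span_base)

lemma ideal_gen_0: "0 \<in> ideal_gen S"
  by (simp add: ideal_gen_def ring_mod.span_zero)

lemma ideal_gen_add: "f \<in> ideal_gen S \<Longrightarrow> g \<in> ideal_gen S \<Longrightarrow> f + g \<in> ideal_gen S"
  by (simp add: ideal_gen_def ring_mod.span_add)

lemma ideal_gen_mult: "f \<in> ideal_gen S \<Longrightarrow> g * f \<in> ideal_gen S"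
  by (simp add: ideal_gen_def ring_mod.span_scale)

lemma ideal_gen_mult2: "f \<in> ideal_gen S \<Longrightarrow> f * g \<in> ideal_gen S"
  using ideal_gen_mult[of f S g] by (simp add: mult.commute)

lemma ideal_gen_sum: "(\<And>i. i \<in> A \<Longrightarrow> f i \<in> ideal_gen S) \<Longrightarrow> sum f A \<in> ideal_gen S"
  by (simp add: ideal_gen_def ring_mod.span_sum)

lemma ideal_gen_minimal:
  assumes "S \<subseteq> J" "0 \<in> J" "\<And>f g. f \<in> J \<Longrightarrow> g \<in> J \<Longrightarrow> f + g \<in> J" "\<And>f g. f \<in> J \<Longrightarrow> g * f \<in> J"
  shows "ideal_gen S \<subseteq> J"
  unfolding ideal_gen_def
  by (rule ring_mod.span_minimal) (use assms in \<open>auto simp: ring_mod.subspace_def\<close>)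

lemma ideal_gen_subset: "S \<subseteq> ideal_gen T \<Longrightarrow> ideal_gen S \<subseteq> ideal_gen T"
  by (rule ideal_gen_minimal) (auto intro: ideal_gen_0 ideal_gen_add ideal_gen_mult)

lemma ideal_gen_zero: "ideal_gen {0} = {0}"
  by (intro equalityI ideal_gen_minimal) (auto intro: ideal_gen_0)

lemma ideal_gen_single: "ideal_gen {F} = {F * h | h. True}"
proof (intro equalityI ideal_gen_minimal)
  show "{F} \<subseteq> {F * h |h. True}" by (auto intro: exI[of _ 1])
  show "0 \<in> {F * h |h. True}" by (auto intro: exI[of _ 0])
  show "f + g \<in> {F * h |h. True}" if "f \<in> {F * h |h. True}" "g \<in> {F * h |h. True}" for f g
    using that by (auto simp flip: distrib_left)
  show "g * f \<in> {F * h |h. True}" if f: "f \<in> {F * h |h. True}" for f g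
    proof -
    obtain h where "f = F * h" using f by blast
    then have "g * f = F * (g * h)" by (simp add: mult.left_commute)
    then show ?thesis by blast
  qed
qed (auto intro: ideal_gen_mult2 ideal_gen_base)

lemma ideal_gen_pair: "ideal_gen {F, G} = {a * F + b * G | a b. True}"
proof (intro equalityI ideal_gen_minimal)
  have "F = 1 * F + 0 * G" "G = 0 * F + 1 * G" by simp_all
  then show "{F, G} \<subseteq> {a * F + b * G |a b. True}" by blast
  have "0 = 0 * F + 0 * G" by simp
  then show "0 \<in> {a * F + b * G |a b. True}" by blast
  show "f + g \<in> {a * F + b * G |a b. True}"
    if fg: "f \<in> {a * F + b * G |a b. True}" "g \<in> {a * F + b * G |a b. True}" for f g
  proof -
    obtain a b c e where "f = a * F + b * G" "g = c * F + e * G" using fg by blast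
    then have "f + g = (a + c) * F + (b + e) * G" by (simp add: algebra_simps)
    then show ?thesis by blast
  qed
  show "g * f \<in> {a * F + b * G |a b. True}" if f: "f \<in> {a * F + b * G |a b. True}" for f g
  proof -
    obtain a b where "f = a * F + b * G" using f by blast
    then have "g * f = (g * a) * F + (g * b) * G" by (simp only: distrib_left mult.assoc)
    then show ?thesis by blast
  qed
  have "a * F + b * G \<in> ideal_gen {F, G}" for a b
    by (intro ideal_gen_add ideal_gen_mult ideal_gen_base) auto
  then show "{a * F + b * G |a b. True} \<subseteq> ideal_gen {F, G}" by (clarify) simp
qed

subsection \<open>Points\<close>

definition pt :: "complex ^ 3 \<Rightarrow> proj_plane" where
  "pt v = Abs_proj_plane {c *s v | c. c \<noteq> 0}"

lemma coords_pt: "v \<noteq> 0 \<Longrightarrow> coords (pt v) = {c *s v | c. c \<noteq> 0}"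
  unfolding pt_def by (rule Abs_proj_plane_inverse) auto

lemma coords_self: "v \<noteq> 0 \<Longrightarrow> v \<in> coords (pt v)"
  unfolding coords_pt by (intro CollectI exI[of _ 1]) simp

lemma pt_coords:
  assumes "v \<in> coords P" shows "v \<noteq> 0" "P = pt v"
proof -
  obtain w where w: "w \<noteq> 0" "coords P = {c *s w | c. c \<noteq> 0}" using coords[of P] by auto
  then obtain c where c: "c \<noteq> 0" "v = c *s w" using assms by auto
  show "v \<noteq> 0" using w c by simp
  have "{b *s v | b. b \<noteq> 0} = {b *s w | b. b \<noteq> 0}"
  proof safe
    fix b :: complex assume "b \<noteq> 0"
    then show "\<exists>a. b *s v = a *s w \<and> a \<noteq> 0" using c by (intro exI[of _ "b * c"]) auto
    show "\<exists>a. b *s w = a *s v \<and> a \<noteq> 0" using c \<open>b \<noteq> 0\<close> by (intro exI[of _ "b / c"]) auto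
  qed
  then show "P = pt v" using w(2) unfolding pt_def by (metis coords_inverse)
qed

lemma ex_coords: "\<exists>v. v \<in> coords P"
proof -
  obtain w where w: "w \<noteq> 0" "coords P = {c *s w | c. c \<noteq> 0}" using coords[of P] by auto
  have "1 *s w \<in> coords P" unfolding w(2) by (rule CollectI, rule exI[of _ 1]) simp
  then show ?thesis by blast
qed

lemma pt_cases:
  obtains v where "v \<noteq> 0" "P = pt v"
  using ex_coords[of P] pt_coords by metis

lemma pt_eq_iff:
  assumes "v \<noteq> 0" "w \<noteq> 0" shows "pt v = pt w \<longleftrightarrow> (\<exists>c. c \<noteq> 0 \<and> w = c *s v)"
proof
  assume "pt v = pt w"
  then show "\<exists>c. c \<noteq> 0 \<and> w = c *s v" using coords_self[OF assms(2)] coords_pt[OF assms(1)] by auto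
next
  assume "\<exists>c. c \<noteq> 0 \<and> w = c *s v"
  then have "w \<in> coords (pt v)" using coords_pt[OF assms(1)] by auto
  then show "pt v = pt w" using pt_coords(2) by auto
qed

lemma vanishes_hom:
  assumes "homogeneous k f" "v \<noteq> 0" shows "vanishes_at f (pt v) \<longleftrightarrow> ev f v = 0"
  using coords_self[OF assms(2)] coords_pt[OF assms(2)]
  by (auto simp: vanishes_at_def ev_hom_scale[OF assms(1)])

lemma vanishes_hom_coords:
  assumes "homogeneous k f" "v \<in> coords P" shows "vanishes_at f P \<longleftrightarrow> ev f v = 0"
  using vanishes_hom[OF assms(1) pt_coords(1)[OF assms(2)]] pt_coords(2)[OF assms(2)] by simp

lemma vanishes_at_hom_part:
  assumes "vanishes_at f P" shows "vanishes_at (hom_part k f) P"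
  unfolding vanishes_at_def
proof
  fix v assume v: "v \<in> coords P"
  have "poly_eval f (\<lambda>x. if x \<in> UNIV then t * v $ x else v $ x) = 0" if "t \<noteq> 0" for t
  proof -
    have "t *s v \<in> coords P" using pt_coords[OF v] coords_pt[of v] that by auto
    then have "ev f (t *s v) = 0" using assms by (auto simp: vanishes_at_def)
    moreover have "(\<lambda>x. if x \<in> UNIV then t * v $ x else v $ x) = ($) (t *s v)"
      by (auto simp: vector_scalar_mult_def)
    ultimately show ?thesis by simp
  qed
  then show "ev (hom_part k f) v = 0" by (rule weight_part_vanishes)
qed

text \<open>A polynomial vanishing on all coordinate vectors of a point has homogeneous components
  that do so too, hence it is a sum of the generators. Membership can thus be tested by evaluation,
  also for polynomials that are not homogeneous.\<close>

lemma homogeneous_ideal_eq: "homogeneous_ideal W = {f. \<forall>P\<in>W. vanishes_at f P}"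
proof (rule equalityI)
  show "homogeneous_ideal W \<subseteq> {f. \<forall>P\<in>W. vanishes_at f P}"
    unfolding homogeneous_ideal_def by (rule ideal_gen_minimal) (auto simp: vanishes_at_def)
next
  show "{f. \<forall>P\<in>W. vanishes_at f P} \<subseteq> homogeneous_ideal W"
  proof
    fix f assume f: "f \<in> {f. \<forall>P\<in>W. vanishes_at f P}"
    obtain B where B: "f = (\<Sum>k<B. hom_part k f)" using hom_part_decomp by blast
    have "(\<Sum>k<B. hom_part k f) \<in> homogeneous_ideal W"
      unfolding homogeneous_ideal_def
      by (rule ideal_gen_sum, rule ideal_gen_base) (use f vanishes_at_hom_part homogeneous_hom_part in blast)
    then show "f \<in> homogeneous_ideal W" using B by simp
  qed
qed

lemma hom_part_in_homogeneous_ideal: "f \<in> homogeneous_ideal W \<Longrightarrow> hom_part k f \<in> homogeneous_ideal W"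
  by (auto simp: homogeneous_ideal_eq vanishes_at_hom_part)

lemma ideal_gen_homogeneous_ideal: "S \<subseteq> homogeneous_ideal W \<Longrightarrow> ideal_gen S \<subseteq> homogeneous_ideal W"
  unfolding homogeneous_ideal_def by (rule ideal_gen_subset)

subsection \<open>Linear forms and interpolation\<close>

definition linear_form :: "complex ^ 3 \<Rightarrow> 3 cpoly" where
  "linear_form u = (\<Sum>i\<in>UNIV. const (u $ i) * var i)"

lemma homogeneous_linear_form [simp]: "homogeneous (Suc 0) (linear_form u)"
  unfolding linear_form_def by (intro homogeneous_sum) auto

lemma ev_linear_form: "ev (linear_form u) v = u $ 1 * v $ 1 + u $ 2 * v $ 2 + u $ 3 * v $ 3"
  by (simp add: linear_form_def sum_3)

text \<open>The three linear forms tested on w are those whose values are, up to sign, the 2x2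
  minors of the pair (v, w). If all minors vanish, w is a multiple of v.\<close>

lemma separating_line:
  assumes "v \<noteq> 0" "w \<noteq> 0" "pt v \<noteq> pt w"
  shows "\<exists>u. ev (linear_form u) v = 0 \<and> ev (linear_form u) w \<noteq> 0"
proof (rule ccontr)
  assume "\<nexists>u. ev (linear_form u) v = 0 \<and> ev (linear_form u) w \<noteq> 0"
  then have H: "ev (linear_form u) v = 0 \<Longrightarrow> ev (linear_form u) w = 0" for u by blast
  have 12: "v $ 1 * w $ 2 = v $ 2 * w $ 1"
    using H[of "vector [- (v $ 2), v $ 1, 0]"] by (simp add: ev_linear_form vector_3 algebra_simps)
  have 13: "v $ 1 * w $ 3 = v $ 3 * w $ 1"
    using H[of "vector [- (v $ 3), 0, v $ 1]"] by (simp add: ev_linear_form vector_3 algebra_simps)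
  have 23: "v $ 2 * w $ 3 = v $ 3 * w $ 2"
    using H[of "vector [0, - (v $ 3), v $ 2]"] by (simp add: ev_linear_form vector_3 algebra_simps)
  have all: "v $ i * w $ j = v $ j * w $ i" for i j
    using 12 13 23 exhaust_3[of i] exhaust_3[of j] by (auto simp: mult.commute)
  obtain i where i: "v $ i \<noteq> 0" using assms(1) by (auto simp: Finite_Cartesian_Product.vec_eq_iff)
  have w: "w = (w $ i / v $ i) *s v"
  proof (rule Finite_Cartesian_Product.vec_eq_iff[THEN iffD2], rule allI)
    fix j show "w $ j = ((w $ i / v $ i) *s v) $ j" using all[of i j] i by (simp add: field_simps)
  qed
  then have "w $ i / v $ i \<noteq> 0" using assms(2) by (metis vector_smult_lzero)
  then show False using w assms pt_eq_iff by metis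
qed

text \<open>For a nonzero v the value of the form at v is a nonzero polynomial of degree at most 2
  in t, so finitely many v exclude finitely many t. The explicit coefficients allow
  \<open>curve_extra_point\<close> to parametrise the line.\<close>

lemma avoiding_line_explicit:
  assumes "finite V" "0 \<notin> V"
  shows "\<exists>t. \<forall>v\<in>V. ev (linear_form (vector [1, t, t\<^sup>2])) v \<noteq> 0"
proof -
  define p where "p v = [:v $ 1, v $ 2, v $ 3:]" for v :: "complex ^ 3"
  have "p v \<noteq> 0" if "v \<noteq> 0" for v
  proof
    assume "p v = 0"
    then have "v $ 1 = 0" "v $ 2 = 0" "v $ 3 = 0" unfolding p_def by (simp_all add: pCons_eq_0_iff)
    then have "v $ i = 0" for i using exhaust_3[of i] by auto
    then show False using that by (simp add: Finite_Cartesian_Product.vec_eq_iff)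
  qed
  then have "finite (\<Union>v\<in>V. {t. poly (p v) t = 0})"
    by (intro finite_UN_I assms(1) poly_roots_finite) (use assms(2) in metis)
  then obtain t where t: "t \<notin> (\<Union>v\<in>V. {t. poly (p v) t = 0})"
    using ex_new_if_finite[OF infinite_UNIV_char_0] by blast
  have "ev (linear_form (vector [1, t, t\<^sup>2])) v = poly (p v) t" for v
    by (simp add: p_def ev_linear_form vector_3 power2_eq_square distrib_left mult.left_commute mult.commute)
  then show ?thesis using t by (intro exI[of _ t]) simp
qed

lemma avoiding_line:
  assumes "finite V" "0 \<notin> V"
  shows "\<exists>u. \<forall>v\<in>V. ev (linear_form u) v \<noteq> 0"
  using avoiding_line_explicit[OF assms] by blast

text \<open>A product of lines, one through each point of W and all missing P, filled up to degree k
  by a power of another line that misses P.\<close>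

lemma interpolating_form:
  assumes "finite W" "P \<notin> W" "k \<ge> card W"
  shows "\<exists>e. homogeneous k e \<and> \<not> vanishes_at e P \<and> (\<forall>Q\<in>W. vanishes_at e Q)"
proof -
  obtain w where w: "w \<noteq> 0" "P = pt w" using pt_cases by blast
  have "\<exists>l. homogeneous (Suc 0) l \<and> ev l w \<noteq> 0 \<and> vanishes_at l Q" if "Q \<in> W" for Q
  proof -
    obtain v where v: "v \<noteq> 0" "Q = pt v" using pt_cases by blast
    have "pt v \<noteq> pt w" using v w assms(2) that by auto
    then obtain u where "ev (linear_form u) v = 0" "ev (linear_form u) w \<noteq> 0"
      using separating_line[OF v(1) w(1)] by blast
    then show ?thesis using vanishes_hom v by (metis homogeneous_linear_form)
  qed
  then obtain l where l: "\<And>Q. Q \<in> W \<Longrightarrow> homogeneous (Suc 0) (l Q) \<and> ev (l Q) w \<noteq> 0 \<and> vanishes_at (l Q) Q"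
    by metis
  obtain u where u: "ev (linear_form u) w \<noteq> 0" using avoiding_line[of "{w}"] w by auto
  define e where "e = linear_form u ^ (k - card W) * (\<Prod>Q\<in>W. l Q)"
  have "homogeneous (\<Sum>Q\<in>W. Suc 0) (\<Prod>Q\<in>W. l Q)"
    by (rule homogeneous_prod) (use l in auto)
  then have hp: "homogeneous (card W) (\<Prod>Q\<in>W. l Q)" by simp
  have "homogeneous (Suc 0 * (k - card W) + card W) e"
    unfolding e_def by (intro homogeneous_mult homogeneous_power hp) simp
  then have h: "homogeneous k e" using assms(3) by simp
  have "ev e w \<noteq> 0" using u l assms(1) by (simp add: e_def)
  moreover have "vanishes_at e Q" if "Q \<in> W" for Q
    using l that assms(1) by (auto simp: e_def vanishes_at_def)
  ultimately show ?thesis using vanishes_hom[OF h w(1)] h w(2) by blast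
qed

lemma homogeneous_ideal_subsetD:
  assumes "finite W" "homogeneous_ideal W \<subseteq> homogeneous_ideal Z"
  shows "Z \<subseteq> W"
proof
  fix P assume P: "P \<in> Z"
  show "P \<in> W"
  proof (rule ccontr)
    assume "P \<notin> W"
    then obtain f where f: "\<not> vanishes_at f P" "\<forall>Q\<in>W. vanishes_at f Q"
      using interpolating_form[OF assms(1), of P "card W"] by auto
    then have "f \<in> homogeneous_ideal W" by (simp add: homogeneous_ideal_eq)
    then have "f \<in> homogeneous_ideal Z" using assms(2) by blast
    then show False using f(1) P unfolding homogeneous_ideal_eq by blast
  qed
qed

subsection \<open>Saturation\<close>

lemma saturation_superset: "ideal_gen S \<subseteq> saturation (ideal_gen S)"
  by (auto simp: saturation_def ideal_gen_mult2)

lemma saturation_mono: "J \<subseteq> J' \<Longrightarrow> saturation J \<subseteq> saturation J'"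
  by (auto simp: saturation_def)

text \<open>At each point some linear form does not vanish, and its powers are among the multipliers
  that saturation allows; so the product can vanish there only if f does.\<close>

lemma saturation_homogeneous_ideal: "saturation (homogeneous_ideal W) = homogeneous_ideal W"
proof
  show "saturation (homogeneous_ideal W) \<subseteq> homogeneous_ideal W"
  proof
    fix f assume "f \<in> saturation (homogeneous_ideal W)"
    then obtain k where k: "\<And>g. homogeneous k g \<Longrightarrow> f * g \<in> homogeneous_ideal W"
      by (auto simp: saturation_def)
    have "ev f v = 0" if P: "P \<in> W" and v: "v \<in> coords P" for P v
    proof -
      obtain u where u: "ev (linear_form u) v \<noteq> 0" using avoiding_line[of "{v}"] pt_coords[OF v] by auto
      have "homogeneous k (linear_form u ^ k)" using homogeneous_power[of "Suc 0" "linear_form u" k] by simp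
      then have "f * linear_form u ^ k \<in> homogeneous_ideal W" by (rule k)
      then have "ev (f * linear_form u ^ k) v = 0" using P v unfolding homogeneous_ideal_eq vanishes_at_def by blast
      then show ?thesis using u by simp
    qed
    then show "f \<in> homogeneous_ideal W" by (auto simp: homogeneous_ideal_eq vanishes_at_def)
  qed
next
  show "homogeneous_ideal W \<subseteq> saturation (homogeneous_ideal W)"
    unfolding homogeneous_ideal_def by (rule saturation_superset)
qed

lemma var_nonzero: "var x \<noteq> 0"
proof
  assume "var x = 0"
  then have "poly_eval (var x) (\<lambda>_. 1) = 0" by (simp only: poly_eval_0)
  then show False by simp
qed

lemma saturation_0: "saturation {0} = {0 :: 3 cpoly}"
proof -
  have 1: "f = 0" if "\<And>g. homogeneous k g \<Longrightarrow> f * g = 0" for f :: "3 cpoly" and k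
  proof -
    have "homogeneous k (var 1 ^ k)" using homogeneous_power[of "Suc 0" "var 1" k] by simp
    then have "f * var 1 ^ k = 0" by (rule that)
    then show ?thesis using var_nonzero[of 1] by (auto simp only: mult_eq_0_iff power_eq_0_iff)
  qed
  show ?thesis
  proof (rule equalityI; rule subsetI)
    fix f assume "f \<in> saturation {0 :: 3 cpoly}"
    then obtain k where "\<And>g. homogeneous k g \<Longrightarrow> f * g = 0" by (auto simp: saturation_def)
    then have "f = 0" by (rule 1)
    then show "f \<in> {0}" by simp
  qed (simp add: saturation_def)
qed

text \<open>Saturation sees only high degrees. The bound k itself serves as the exponent: a
  homogeneous component of f times a form of degree k has degree at least k.\<close>

lemma saturation_eqI:
  assumes "S \<subseteq> homogeneous_ideal W"
    "\<And>j f. j \<ge> k \<Longrightarrow> homogeneous j f \<Longrightarrow> f \<in> homogeneous_ideal W \<Longrightarrow> f \<in> ideal_gen S"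
  shows "saturation (ideal_gen S) = homogeneous_ideal W"
proof
  have "ideal_gen S \<subseteq> homogeneous_ideal W" by (rule ideal_gen_homogeneous_ideal) (rule assms)
  then show "saturation (ideal_gen S) \<subseteq> homogeneous_ideal W"
    using saturation_mono saturation_homogeneous_ideal by metis
next
  show "homogeneous_ideal W \<subseteq> saturation (ideal_gen S)"
  proof
    fix f assume f: "f \<in> homogeneous_ideal W"
    obtain B where B: "f = (\<Sum>i<B. hom_part i f)" using hom_part_decomp by blast
    have "f * g \<in> ideal_gen S" if g: "homogeneous k g" for g
    proof -
      have "hom_part i f * g \<in> ideal_gen S" for i
      proof (rule assms(2))
        show "homogeneous (i + k) (hom_part i f * g)" using g by (simp add: homogeneous_mult)
        show "hom_part i f * g \<in> homogeneous_ideal W"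
          using hom_part_in_homogeneous_ideal[OF f, of i] unfolding homogeneous_ideal_def by (rule ideal_gen_mult2)
      qed simp
      then have "(\<Sum>i<B. hom_part i f * g) \<in> ideal_gen S" by (intro ideal_gen_sum)
      then show ?thesis using B by (metis sum_distrib_right)
    qed
    then show "f \<in> saturation (ideal_gen S)" by (auto simp: saturation_def)
  qed
qed

subsection \<open>Polynomial functions of a tuple of vectors\<close>

text \<open>Kept as functions, so that determinants and solutions by Cramer's rule are polynomial by
  closure rules alone; a representing polynomial is recovered only once, in
  \<open>tuple_eval_of_poly_fun\<close>. The parameter n bounds the indices of the vectors that may
  enter.\<close>

inductive_set poly_fun :: "nat \<Rightarrow> ((nat \<Rightarrow> complex ^ 3) \<Rightarrow> complex) set" for n where
  poly_fun_const: "(\<lambda>_. c) \<in> poly_fun n"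
| poly_fun_coord: "i < n \<Longrightarrow> (\<lambda>v. v i $ j) \<in> poly_fun n"
| poly_fun_add: "f \<in> poly_fun n \<Longrightarrow> g \<in> poly_fun n \<Longrightarrow> (\<lambda>v. f v + g v) \<in> poly_fun n"
| poly_fun_mult: "f \<in> poly_fun n \<Longrightarrow> g \<in> poly_fun n \<Longrightarrow> (\<lambda>v. f v * g v) \<in> poly_fun n"

lemma poly_fun_uminus: "f \<in> poly_fun n \<Longrightarrow> (\<lambda>v. - f v) \<in> poly_fun n"
  using poly_fun_mult[OF poly_fun_const[of "-1"]] by force

lemma poly_fun_diff: "f \<in> poly_fun n \<Longrightarrow> g \<in> poly_fun n \<Longrightarrow> (\<lambda>v. f v - g v) \<in> poly_fun n"
  using poly_fun_add[of f n "\<lambda>v. - g v"] poly_fun_uminus[of g n] by simp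

lemma poly_fun_sum: "(\<And>i. i \<in> A \<Longrightarrow> f i \<in> poly_fun n) \<Longrightarrow> (\<lambda>v. \<Sum>i\<in>A. f i v) \<in> poly_fun n"
  by (induction A rule: infinite_finite_induct) (auto intro: poly_fun_const poly_fun_add)

lemma poly_fun_prod: "(\<And>i. i \<in> A \<Longrightarrow> f i \<in> poly_fun n) \<Longrightarrow> (\<lambda>v. \<Prod>i\<in>A. f i v) \<in> poly_fun n"
  by (induction A rule: infinite_finite_induct) (auto intro: poly_fun_const poly_fun_mult)

lemma poly_fun_power: "f \<in> poly_fun n \<Longrightarrow> (\<lambda>v. f v ^ k) \<in> poly_fun n"
  by (induction k) (auto intro: poly_fun_const poly_fun_mult)

lemma poly_fun_mono: "f \<in> poly_fun n \<Longrightarrow> n \<le> n' \<Longrightarrow> f \<in> poly_fun n'"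
  by (induction rule: poly_fun.induct) (auto intro: poly_fun.intros)

lemma poly_fun_local:
  assumes "f \<in> poly_fun n" "\<And>i. i < n \<Longrightarrow> v i = w i" shows "f v = f w"
  using assms by (induction rule: poly_fun.induct) auto

lemma poly_fun_ev: "i < n \<Longrightarrow> (\<lambda>v. ev f (v i)) \<in> poly_fun n"
  unfolding poly_eval_def by (intro poly_fun_sum poly_fun_mult poly_fun_const poly_fun_prod poly_fun_power poly_fun_coord)

lemma poly_fun_rescale: "f \<in> poly_fun n \<Longrightarrow> (\<lambda>v. f (\<lambda>i. c i *s v i)) \<in> poly_fun n"
  by (induction rule: poly_fun.induct) (auto intro: poly_fun.intros)

lemma poly_fun_line:
  assumes "f \<in> poly_fun n"
  shows "\<exists>p. \<forall>t. poly p t = f (\<lambda>i. a i + t *s b i)"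
  using assms
proof (induction rule: poly_fun.induct)
  case (poly_fun_const c)
  show ?case by (rule exI[of _ "[:c:]"]) simp
next
  case (poly_fun_coord i j)
  show ?case by (rule exI[of _ "[:a i $ j, b i $ j:]"]) simp
next
  case (poly_fun_add f g)
  then obtain p q where "\<forall>t. poly p t = f (\<lambda>i. a i + t *s b i)" "\<forall>t. poly q t = g (\<lambda>i. a i + t *s b i)"
    by blast
  then show ?case by (intro exI[of _ "p + q"]) simp
next
  case (poly_fun_mult f g)
  then obtain p q where "\<forall>t. poly p t = f (\<lambda>i. a i + t *s b i)" "\<forall>t. poly q t = g (\<lambda>i. a i + t *s b i)"
    by blast
  then show ?case by (intro exI[of _ "p * q"]) simp
qed

definition nonzero_tuple :: "nat \<Rightarrow> (nat \<Rightarrow> complex ^ 3) \<Rightarrow> bool" where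
  "nonzero_tuple n v \<longleftrightarrow> (\<forall>i<n. v i \<noteq> 0)"

text \<open>Irreducibility of the space of tuples: restrict to the line joining two tuples.\<close>

lemma poly_fun_common_nonzero:
  assumes "f \<in> poly_fun n" "g \<in> poly_fun n" "f v \<noteq> 0" "g w \<noteq> 0" "nonzero_tuple n v"
  shows "\<exists>u. nonzero_tuple n u \<and> f u \<noteq> 0 \<and> g u \<noteq> 0"
proof -
  let ?l = "\<lambda>t i. v i + t *s (w i - v i)"
  obtain p where p: "\<And>t. poly p t = f (?l t)" using poly_fun_line[OF assms(1)] by metis
  obtain q where q: "\<And>t. poly q t = g (?l t)" using poly_fun_line[OF assms(2)] by metis
  have "?l 0 = v" "?l 1 = w" by auto
  then have "poly p 0 \<noteq> 0" "poly q 1 \<noteq> 0" unfolding p q using assms by auto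
  then have pq: "p \<noteq> 0" "q \<noteq> 0" by auto
  have fin: "finite {t. ?l t i = 0}" if "i < n" for i
  proof -
    have "v i \<noteq> 0" using assms(5) that by (simp add: nonzero_tuple_def)
    then obtain j where j: "v i $ j \<noteq> 0" by (metis Finite_Cartesian_Product.vec_eq_iff zero_index)
    have "{t. ?l t i = 0} \<subseteq> {t. poly [:v i $ j, w i $ j - v i $ j:] t = 0}"
      by (auto simp: Finite_Cartesian_Product.vec_eq_iff right_diff_distrib)
    moreover have "[:v i $ j, w i $ j - v i $ j:] \<noteq> 0" using j by simp
    ultimately show ?thesis using poly_roots_finite finite_subset by blast
  qed
  have "finite ({t. poly p t = 0} \<union> {t. poly q t = 0} \<union> (\<Union>i<n. {t. ?l t i = 0}))"
    using pq fin poly_roots_finite by auto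
  then have "\<exists>t. t \<notin> {t. poly p t = 0} \<union> {t. poly q t = 0} \<union> (\<Union>i<n. {t. ?l t i = 0})"
    by (rule ex_new_if_finite[OF infinite_UNIV_char_0])
  then obtain t where "t \<notin> {t. poly p t = 0} \<union> {t. poly q t = 0} \<union> (\<Union>i<n. {t. ?l t i = 0})" ..
  then have "poly p t \<noteq> 0 \<and> poly q t \<noteq> 0 \<and> (\<forall>i<n. ?l t i \<noteq> 0)" by simp
  then have "nonzero_tuple n (?l t) \<and> f (?l t) \<noteq> 0 \<and> g (?l t) \<noteq> 0" unfolding p q nonzero_tuple_def by blast
  then show ?thesis by (intro exI[of _ "?l t"])
qed

text \<open>Q holds on a nonempty principal open subset of the space of tuples of nonzero vectors.
  Irreducibility makes this notion stable under conjunction, so different conditions may have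
  different examples.\<close>

definition generic :: "nat \<Rightarrow> ((nat \<Rightarrow> complex ^ 3) \<Rightarrow> bool) \<Rightarrow> bool" where
  "generic n Q \<longleftrightarrow> (\<exists>g\<in>poly_fun n. (\<exists>v. nonzero_tuple n v \<and> g v \<noteq> 0) \<and> (\<forall>v. nonzero_tuple n v \<longrightarrow> g v \<noteq> 0 \<longrightarrow> Q v))"

lemma genI: "g \<in> poly_fun n \<Longrightarrow> nonzero_tuple n v \<Longrightarrow> g v \<noteq> 0 \<Longrightarrow> (\<And>v. nonzero_tuple n v \<Longrightarrow> g v \<noteq> 0 \<Longrightarrow> Q v) \<Longrightarrow> generic n Q"
  unfolding generic_def by blast

lemma generic_conj:
  assumes "generic n Q" "generic n R" shows "generic n (\<lambda>v. Q v \<and> R v)"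
proof -
  obtain f v where f: "f \<in> poly_fun n" "nonzero_tuple n v" "f v \<noteq> 0" "\<And>v. nonzero_tuple n v \<Longrightarrow> f v \<noteq> 0 \<Longrightarrow> Q v"
    using assms(1) unfolding generic_def by blast
  obtain g w where g: "g \<in> poly_fun n" "nonzero_tuple n w" "g w \<noteq> 0" "\<And>v. nonzero_tuple n v \<Longrightarrow> g v \<noteq> 0 \<Longrightarrow> R v"
    using assms(2) unfolding generic_def by blast
  obtain u where "nonzero_tuple n u" "f u \<noteq> 0" "g u \<noteq> 0" using poly_fun_common_nonzero f g by metis
  then show ?thesis
    by (intro genI[of "\<lambda>v. f v * g v" n u]) (use f g in \<open>auto intro: poly_fun_mult\<close>)
qed

lemma generic_mono: "generic n Q \<Longrightarrow> (\<And>v. nonzero_tuple n v \<Longrightarrow> Q v \<Longrightarrow> R v) \<Longrightarrow> generic n R"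
  unfolding generic_def by blast

subsection \<open>Comparison with the Zariski topology\<close>

abbreviation tuple_eval :: "(nat \<times> 3) cpoly \<Rightarrow> (nat \<Rightarrow> complex ^ 3) \<Rightarrow> complex" where
  "tuple_eval g v \<equiv> poly_eval g (\<lambda>(i, j). v i $ j)"

lemma poly_fun_tuple_eval:
  assumes "\<And>m. m \<in> Poly_Mapping.keys g \<Longrightarrow> Poly_Mapping.keys m \<subseteq> {..<n} \<times> UNIV"
  shows "(\<lambda>v. tuple_eval g v) \<in> poly_fun n"
  unfolding poly_eval_def
  by (intro poly_fun_sum poly_fun_mult poly_fun_const poly_fun_prod poly_fun_power)
    (use assms in \<open>fastforce simp: case_prod_unfold intro!: poly_fun_coord\<close>)

lemma tuple_eval_of_poly_fun:
  assumes "f \<in> poly_fun n"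
  shows "\<exists>g. (\<forall>m\<in>Poly_Mapping.keys g. Poly_Mapping.keys m \<subseteq> {..<n} \<times> UNIV) \<and> (\<forall>v. tuple_eval g v = f v)"
  using assms
proof (induction rule: poly_fun.induct)
  case (poly_fun_const c)
  show ?case by (rule exI[of _ "const c"]) (simp add: const_def)
next
  case (poly_fun_coord i j)
  then show ?case by (intro exI[of _ "var (i, j)"]) (simp add: var_def)
next
  case (poly_fun_add f g)
  then obtain p q where pq: "\<forall>m\<in>Poly_Mapping.keys p. Poly_Mapping.keys m \<subseteq> {..<n} \<times> UNIV" "\<forall>v. tuple_eval p v = f v"
     "\<forall>m\<in>Poly_Mapping.keys q. Poly_Mapping.keys m \<subseteq> {..<n} \<times> UNIV" "\<forall>v. tuple_eval q v = g v"
    by blast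
  then have "\<forall>m\<in>Poly_Mapping.keys (p + q). Poly_Mapping.keys m \<subseteq> {..<n} \<times> UNIV"
    using keys_add[of p q] by blast
  then show ?case by (intro exI[of _ "p + q"]) (simp add: pq)
next
  case (poly_fun_mult f g)
  then obtain p q where pq: "\<forall>m\<in>Poly_Mapping.keys p. Poly_Mapping.keys m \<subseteq> {..<n} \<times> UNIV" "\<forall>v. tuple_eval p v = f v"
     "\<forall>m\<in>Poly_Mapping.keys q. Poly_Mapping.keys m \<subseteq> {..<n} \<times> UNIV" "\<forall>v. tuple_eval q v = g v"
    by blast
  have "Poly_Mapping.keys m \<subseteq> {..<n} \<times> UNIV" if m: "m \<in> Poly_Mapping.keys (p * q)" for m
  proof -
    obtain a b where "m = a + b" "a \<in> Poly_Mapping.keys p" "b \<in> Poly_Mapping.keys q"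
      using keys_mult[of p q] m by blast
    then show ?thesis using keys_add[of a b] pq by blast
  qed
  then show ?case by (intro exI[of _ "p * q"]) (simp add: pq)
qed

text \<open>Passing to a component that is homogeneous in the coordinates of the j-th point, one point
  after the other.\<close>

lemma multihomogeneous_component:
  assumes keys: "\<forall>m\<in>Poly_Mapping.keys g. Poly_Mapping.keys m \<subseteq> {..<n} \<times> UNIV"
    and v0: "tuple_eval g v0 \<noteq> 0"
    and Q: "\<And>v. nonzero_tuple n v \<Longrightarrow> tuple_eval g v \<noteq> 0 \<Longrightarrow> Q v"
    and inv: "\<And>v j t. t \<noteq> 0 \<Longrightarrow> Q (v(j := t *s v j)) \<Longrightarrow> Q v"
  shows "\<exists>h. multihomogeneous n h \<and> tuple_eval h v0 \<noteq> 0 \<and> (\<forall>v. nonzero_tuple n v \<longrightarrow> tuple_eval h v \<noteq> 0 \<longrightarrow> Q v)"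
proof -
  have "\<exists>h e. (\<forall>m\<in>Poly_Mapping.keys h. Poly_Mapping.keys m \<subseteq> {..<n} \<times> UNIV \<and>
      (\<forall>i<k. weight ({i} \<times> UNIV) m = e i)) \<and> tuple_eval h v0 \<noteq> 0 \<and> (\<forall>v. nonzero_tuple n v \<longrightarrow> tuple_eval h v \<noteq> 0 \<longrightarrow> Q v)" for k
  proof (induction k)
    case 0
    show ?case by (rule exI[of _ g]) (use keys v0 Q in auto)
  next
    case (Suc k)
    then obtain h e where h: "\<forall>m\<in>Poly_Mapping.keys h. Poly_Mapping.keys m \<subseteq> {..<n} \<times> UNIV \<and>
      (\<forall>i<k. weight ({i} \<times> UNIV) m = e i)" "tuple_eval h v0 \<noteq> 0" "\<And>v. nonzero_tuple n v \<Longrightarrow> tuple_eval h v \<noteq> 0 \<Longrightarrow> Q v"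
      by blast
    define S :: "(nat \<times> 3) set" where "S = {k} \<times> UNIV"
    obtain B where B: "\<And>l. l \<ge> B \<Longrightarrow> weight_part S l h = 0" using weight_part_bound by blast
    have "tuple_eval h v0 = (\<Sum>l<B. tuple_eval (weight_part S l h) v0)"
      by (subst sum_weight_part[of B S h, OF B, symmetric]) (auto intro: poly_eval_sum)
    then have "\<not> (\<forall>l\<in>{..<B}. tuple_eval (weight_part S l h) v0 = 0)"
      using h(2) sum.neutral[of "{..<B}" "\<lambda>l. tuple_eval (weight_part S l h) v0"] by argo
    then obtain l where l: "l < B" "tuple_eval (weight_part S l h) v0 \<noteq> 0" by blast
    have "Q v" if v: "nonzero_tuple n v" "tuple_eval (weight_part S l h) v \<noteq> 0" for v
    proof -
      \<comment> \<open>The component is a coefficient of h along the scaling of the k-th vector.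
        Where it is nonzero, h is nonzero at some rescaled tuple, and Q passes back from there by
        its invariance under scaling.\<close>
      obtain t where t: "t \<notin> {0}" "(\<Sum>l<B. t ^ l * tuple_eval (weight_part S l h) v) \<noteq> 0"
        using exists_nonroot[of l B "\<lambda>l. tuple_eval (weight_part S l h) v" "{0}"] l(1) v(2) by auto
      have "(\<Sum>l<B. t ^ l * tuple_eval (weight_part S l h) v) =
        poly_eval h (\<lambda>x. if x \<in> S then t * (case x of (i, j) \<Rightarrow> v i $ j) else (case x of (i, j) \<Rightarrow> v i $ j))"
        using poly_eval_scaled[of B S h t "\<lambda>(i, j). v i $ j", OF B] by simp
      also have "(\<lambda>x. if x \<in> S then t * (case x of (i, j) \<Rightarrow> v i $ j) else (case x of (i, j) \<Rightarrow> v i $ j)) =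
        (\<lambda>(i, j). (v(k := t *s v k)) i $ j)"
        by (auto simp: S_def fun_eq_iff)
      finally have "tuple_eval h (v(k := t *s v k)) \<noteq> 0" using t(2) by simp
      moreover have "nonzero_tuple n (v(k := t *s v k))" using v(1) t(1) by (auto simp: nonzero_tuple_def)
      ultimately have "Q (v(k := t *s v k))" by (intro h(3))
      with t(1) show ?thesis by (intro inv[of t v k]) simp_all
    qed
    then show ?case
    proof (intro exI[of _ "weight_part S l h"] exI[of _ "e(k := l)"] conjI ballI allI impI)
      fix m assume "m \<in> Poly_Mapping.keys (weight_part S l h)"
      then have m: "m \<in> Poly_Mapping.keys h" "weight S m = l" by (auto simp: keys_weight_part)
      then show "Poly_Mapping.keys m \<subseteq> {..<n} \<times> UNIV" using h(1) by blast
      fix i assume "i < Suc k"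
      then show "weight ({i} \<times> UNIV) m = (e(k := l)) i"
        using m h(1) by (cases "i = k") (auto simp: S_def)
    qed (use l(2) in auto)
  qed
  then obtain h e where h: "\<forall>m\<in>Poly_Mapping.keys h. Poly_Mapping.keys m \<subseteq> {..<n} \<times> UNIV \<and>
      (\<forall>i<n. weight ({i} \<times> UNIV) m = e i)" "tuple_eval h v0 \<noteq> 0" "\<And>v. nonzero_tuple n v \<Longrightarrow> tuple_eval h v \<noteq> 0 \<Longrightarrow> Q v"
    by blast
  have w: "weight ({i} \<times> UNIV) m = (\<Sum>j\<in>UNIV. Poly_Mapping.lookup m (i, j))"
    for i and m :: "nat \<times> 3 \<Rightarrow>\<^sub>0 nat"
  proof -
    have "weight ({i} \<times> UNIV) m = (\<Sum>x\<in>{i} \<times> UNIV. Poly_Mapping.lookup m x)"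
      by (rule weight_superset) auto
    also have "\<dots> = (\<Sum>j\<in>UNIV. Poly_Mapping.lookup m (i, j))"
      by (rule sum.reindex_bij_witness[of _ "\<lambda>j. (i, j)" snd]) auto
    finally show ?thesis .
  qed
  have "multihomogeneous n h"
    unfolding multihomogeneous_def by (rule exI[of _ e]) (use h(1) in \<open>simp add: w\<close>)
  then show ?thesis using h by blast
qed

definition tuple_points :: "nat \<Rightarrow> (nat \<Rightarrow> complex ^ 3) \<Rightarrow> nat \<Rightarrow> proj_plane" where
  "tuple_points n v = restrict (\<lambda>i. pt (v i)) {..<n}"

lemma tuple_points_exhaust:
  assumes "z \<in> {..<n} \<rightarrow>\<^sub>E UNIV"
  shows "\<exists>v. nonzero_tuple n v \<and> (\<forall>i<n. v i \<in> coords (z i)) \<and> z = tuple_points n v"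
proof -
  have "\<forall>i. \<exists>v. v \<in> coords (z i)" using ex_coords by blast
  then obtain v where v: "\<And>i. v i \<in> coords (z i)" by metis
  have "z = tuple_points n v"
  proof
    fix i show "z i = tuple_points n v i"
      using assms pt_coords(2)[OF v[of i]] by (auto simp: tuple_points_def PiE_def extensional_def restrict_def)
  qed
  then show ?thesis using v pt_coords(1)[OF v] by (auto simp: nonzero_tuple_def)
qed

lemma in_nonvanishing_locusI:
  assumes "nonzero_tuple n v" "tuple_eval g (\<lambda>i. c i *s v i) \<noteq> 0" "\<And>i. i < n \<Longrightarrow> c i \<noteq> 0"
  shows "tuple_points n v \<in> nonvanishing_locus n g"
  unfolding nonvanishing_locus_def
proof (intro CollectI conjI exI)
  show "tuple_points n v \<in> {..<n} \<rightarrow>\<^sub>E UNIV" by (simp add: tuple_points_def)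
  show "\<forall>i<n. c i *s v i \<in> coords (tuple_points n v i)"
    using assms coords_pt by (auto simp: nonzero_tuple_def tuple_points_def)
qed (rule assms(2))

text \<open>Induction over the generated topology; an intersection is handled by the product of two
  functions.\<close>

lemma zariski_open_poly_fun:
  assumes "openin (zariski n) V" "nonzero_tuple n v" "tuple_points n v \<in> V"
  shows "\<exists>g\<in>poly_fun n. g v \<noteq> 0 \<and> (\<forall>w. nonzero_tuple n w \<longrightarrow> g w \<noteq> 0 \<longrightarrow> tuple_points n w \<in> V)"
proof -
  have "generate_topology_on {nonvanishing_locus n g | g. multihomogeneous n g} V"
    using assms(1) by (simp add: zariski_def openin_topology_generated_by_iff)
  then show ?thesis using assms(2,3)
  proof (induction arbitrary: v rule: generate_topology_on.induct)
    case (Int A B)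
    obtain f where f: "f \<in> poly_fun n" "f v \<noteq> 0" "\<forall>w. nonzero_tuple n w \<longrightarrow> f w \<noteq> 0 \<longrightarrow> tuple_points n w \<in> A"
      using Int by blast
    obtain g where g: "g \<in> poly_fun n" "g v \<noteq> 0" "\<forall>w. nonzero_tuple n w \<longrightarrow> g w \<noteq> 0 \<longrightarrow> tuple_points n w \<in> B"
      using Int by blast
    show ?case by (rule bexI[of _ "\<lambda>v. f v * g v"]) (use f g in \<open>auto intro: poly_fun_mult\<close>)
  next
    case (UN K)
    then show ?case by blast
  next
    case (Basis A)
    then obtain g where g: "A = nonvanishing_locus n g" "multihomogeneous n g" by blast
    then obtain w where w: "\<forall>i<n. w i \<in> coords (tuple_points n v i)" "tuple_eval g w \<noteq> 0"
      using Basis by (auto simp: nonvanishing_locus_def)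
    \<comment> \<open>The locus only says that g is nonzero for some choice w of coordinate vectors.
      The function required at v is therefore g after rescaling by the ratios c.\<close>
    have "\<exists>c. c \<noteq> 0 \<and> w i = c *s v i" if "i < n" for i
      using w(1) that Basis.prems(1) coords_pt[of "v i"] by (auto simp: tuple_points_def nonzero_tuple_def)
    then obtain c where c: "\<And>i. i < n \<Longrightarrow> c i \<noteq> 0 \<and> w i = c i *s v i" by metis
    have PFg: "(\<lambda>v. tuple_eval g v) \<in> poly_fun n"
      using g(2) by (intro poly_fun_tuple_eval) (auto simp: multihomogeneous_def)
    have "tuple_eval g w = tuple_eval g (\<lambda>i. c i *s v i)"
      by (rule poly_fun_local[OF PFg]) (use c in auto)
    then show ?case
      using w(2) g(1) c in_nonvanishing_locusI[of n _ g c]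
      by (intro bexI[of _ "\<lambda>v. tuple_eval g (\<lambda>i. c i *s v i)"] poly_fun_rescale[OF PFg]) auto
  qed auto
qed

text \<open>The property depends on the points only and so is invariant under rescaling the vectors.
  Hence a witness of genericity may be replaced by a multihomogeneous component, whose nonvanishing
  locus is an open set of tuples of points.\<close>

lemma general_pointsI:
  assumes "generic n (\<lambda>v. inj_on (tuple_points n v) {..<n} \<longrightarrow> Q (tuple_points n v ` {..<n}))"
  shows "general_points n Q"
proof -
  define Q' where "Q' v = (inj_on (tuple_points n v) {..<n} \<longrightarrow> Q (tuple_points n v ` {..<n})) " for v
  obtain f v0 where f: "f \<in> poly_fun n" "nonzero_tuple n v0" "f v0 \<noteq> 0" "\<And>v. nonzero_tuple n v \<Longrightarrow> f v \<noteq> 0 \<Longrightarrow> Q' v"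
    using assms unfolding generic_def Q'_def by blast
  obtain g where g: "\<forall>m\<in>Poly_Mapping.keys g. Poly_Mapping.keys m \<subseteq> {..<n} \<times> UNIV" "\<forall>v. tuple_eval g v = f v"
    using tuple_eval_of_poly_fun[OF f(1)] by blast
  have "\<exists>h. multihomogeneous n h \<and> tuple_eval h v0 \<noteq> 0 \<and> (\<forall>v. nonzero_tuple n v \<longrightarrow> tuple_eval h v \<noteq> 0 \<longrightarrow> nonzero_tuple n v \<longrightarrow> Q' v)"
  proof (rule multihomogeneous_component[OF g(1)])
    fix v j and t :: complex
    assume t: "t \<noteq> 0" and q: "nonzero_tuple n (v(j := t *s v j)) \<longrightarrow> Q' (v(j := t *s v j))"
    show "nonzero_tuple n v \<longrightarrow> Q' v"
    proof
      assume v: "nonzero_tuple n v"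
      have "nonzero_tuple n (v(j := t *s v j))" using v t by (auto simp: nonzero_tuple_def)
      moreover have "tuple_points n (v(j := t *s v j)) = tuple_points n v"
      proof -
        have "pt (t *s v j) = pt (v j)" if "j < n"
          using that v t pt_eq_iff[of "v j" "t *s v j"] by (auto simp: nonzero_tuple_def)
        then show ?thesis by (auto simp: tuple_points_def)
      qed
      ultimately show "Q' v" using q by (simp add: Q'_def)
    qed
  qed (use f g in auto)
  then obtain h where h: "multihomogeneous n h" "tuple_eval h v0 \<noteq> 0" "\<And>v. nonzero_tuple n v \<Longrightarrow> tuple_eval h v \<noteq> 0 \<Longrightarrow> Q' v"
    by blast
  have PFh: "(\<lambda>v. tuple_eval h v) \<in> poly_fun n"
    using h(1) by (intro poly_fun_tuple_eval) (auto simp: multihomogeneous_def)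
  define U where "U = nonvanishing_locus n h"
  show ?thesis
    unfolding general_points_def
  proof (intro exI[of _ U] conjI ballI impI)
    show "openin (zariski n) U"
      unfolding U_def zariski_def using h(1) by (intro topology_generated_by_Basis) blast
    \<comment> \<open>Density: around any of its points V contains the nonvanishing locus of a
      polynomial function k, and k and h are simultaneously nonzero at some tuple.\<close>
    have "V \<inter> U \<noteq> {}" if V: "openin (zariski n) V" "V \<noteq> {}" for V
    proof -
      obtain z where z: "z \<in> V" using V(2) by blast
      then have "z \<in> {..<n} \<rightarrow>\<^sub>E UNIV" using openin_subset[OF V(1)] topspace_zariski by blast
      then obtain v where v: "nonzero_tuple n v" "z = tuple_points n v" using tuple_points_exhaust by blast
      obtain k where k: "k \<in> poly_fun n" "k v \<noteq> 0" "\<forall>w. nonzero_tuple n w \<longrightarrow> k w \<noteq> 0 \<longrightarrow> tuple_points n w \<in> V"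
        using zariski_open_poly_fun[OF V(1) v(1)] z v(2) by blast
      obtain u where u: "nonzero_tuple n u" "k u \<noteq> 0" "tuple_eval h u \<noteq> 0"
        using poly_fun_common_nonzero[OF k(1) PFh k(2) h(2) v(1)] by blast
      have "tuple_points n u \<in> U"
        unfolding U_def using in_nonvanishing_locusI[of n u h "\<lambda>_. 1"] u by simp
      then show ?thesis using k(3) u by blast
    qed
    then show "zariski n closure_of U = topspace (zariski n)"
      by (simp add: dense_intersects_open Int_commute)
  next
    fix z assume z: "z \<in> U" "inj_on z {..<n}"
    obtain w where w: "\<forall>i<n. w i \<in> coords (z i)" "tuple_eval h w \<noteq> 0" "z \<in> {..<n} \<rightarrow>\<^sub>E UNIV"
      using z(1) by (auto simp: U_def nonvanishing_locus_def)
    have "nonzero_tuple n w" using w(1) pt_coords(1) by (auto simp: nonzero_tuple_def)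
    moreover have zw: "z = tuple_points n w"
    proof
      fix i show "z i = tuple_points n w i"
        using w(1,3) pt_coords(2)[of "w i" "z i"] by (auto simp: tuple_points_def PiE_def extensional_def restrict_def)
    qed
    ultimately show "Q (z ` {..<n})" using h(3)[of w] w(2) z(2) by (auto simp: Q'_def)
  qed
qed

subsection \<open>Determinants of families\<close>

text \<open>Taken over any commutative ring, since it is used both with complex entries and, for the
  eliminant, with entries in \<open>complex poly\<close>.\<close>

definition det_of :: "nat \<Rightarrow> (nat \<Rightarrow> nat \<Rightarrow> 'a::comm_ring_1) \<Rightarrow> 'a" where
  "det_of n a = Determinant.det (Matrix.mat n n (\<lambda>(i, j). a i j))"

lemma det_of_expand: "det_of n a = (\<Sum>p\<in>{p. p permutes {0..<n}}. signof p * (\<Prod>i=0..<n. a i (p i)))"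
proof -
  have "det_of n a = (\<Sum>p\<in>{p. p permutes {0..<n}}.
      signof p * (\<Prod>i=0..<n. Matrix.mat n n (\<lambda>(i, j). a i j) $$ (i, p i)))"
    unfolding det_of_def by (rule det_def'[of _ n]) simp
  also have "\<dots> = (\<Sum>p\<in>{p. p permutes {0..<n}}. signof p * (\<Prod>i=0..<n. a i (p i)))"
    by (intro sum.cong prod.cong arg_cong2[of _ _ _ _ "(*)"]) (auto simp: permutes_in_image)
  finally show ?thesis .
qed

lemma det_of_cong: "(\<And>i j. i < n \<Longrightarrow> j < n \<Longrightarrow> a i j = b i j) \<Longrightarrow> det_of n a = det_of n b"
  unfolding det_of_def by (intro arg_cong[of _ _ Determinant.det] cong_mat) auto

lemma poly_fun_det_of:
  assumes "\<And>i j. i < n \<Longrightarrow> j < n \<Longrightarrow> (\<lambda>v. a v i j) \<in> poly_fun m"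
  shows "(\<lambda>v. det_of n (a v)) \<in> poly_fun m"
  unfolding det_of_expand
  by (intro poly_fun_sum poly_fun_mult poly_fun_const poly_fun_prod) (auto intro!: assms simp: permutes_in_image)

lemma det_of_identity: "(\<And>i j. i < n \<Longrightarrow> j < n \<Longrightarrow> a i j = (if i = j then 1 else 0)) \<Longrightarrow> det_of n a = 1"
proof -
  assume "\<And>i j. i < n \<Longrightarrow> j < n \<Longrightarrow> a i j = (if i = j then 1 else 0)"
  then have "Matrix.mat n n (\<lambda>(i, j). a i j) = 1\<^sub>m n" by (intro eq_matI) auto
  then show ?thesis by (simp add: det_of_def)
qed

lemma mat_mult_vec_index:
  "i < n \<Longrightarrow> vec_index (Matrix.mat n n (\<lambda>(i, j). a i j) *\<^sub>v Matrix.vec n c) i = (\<Sum>j<n. a i j * c j)"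
  by (simp add: scalar_prod_def lessThan_atLeast0)

lemma det_of_eq_0_iff:
  fixes a :: "nat \<Rightarrow> nat \<Rightarrow> complex"
  shows "det_of n a = 0 \<longleftrightarrow> (\<exists>c. (\<exists>j<n. c j \<noteq> 0) \<and> (\<forall>i<n. (\<Sum>j<n. a i j * c j) = 0))"
proof -
  let ?A = "Matrix.mat n n (\<lambda>(i, j). a i j)"
  have "det_of n a = 0 \<longleftrightarrow> (\<exists>v. v \<in> carrier_vec n \<and> v \<noteq> 0\<^sub>v n \<and> ?A *\<^sub>v v = 0\<^sub>v n)"
    unfolding det_of_def by (rule det_0_iff_vec_prod_zero_field) simp
  also have "\<dots> \<longleftrightarrow> (\<exists>c. (\<exists>j<n. c j \<noteq> 0) \<and> (\<forall>i<n. (\<Sum>j<n. a i j * c j) = 0))"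
  proof safe
    fix v :: "complex Matrix.vec" assume v: "v \<in> carrier_vec n" "v \<noteq> 0\<^sub>v n" "?A *\<^sub>v v = 0\<^sub>v n"
    have vv: "Matrix.vec n (\<lambda>j. vec_index v j) = v" using v(1) by auto
    have "\<exists>j<n. vec_index v j \<noteq> 0"
    proof (rule ccontr)
      assume "\<not> (\<exists>j<n. vec_index v j \<noteq> 0)"
      then have "v = 0\<^sub>v n" using v(1) by (intro eq_vecI) auto
      then show False using v(2) by simp
    qed
    moreover have "(\<Sum>j<n. a i j * vec_index v j) = 0" if "i < n" for i
      using mat_mult_vec_index[OF that, of a "vec_index v"] that unfolding vv v(3) by simp
    ultimately show "\<exists>c. (\<exists>j<n. c j \<noteq> 0) \<and> (\<forall>i<n. (\<Sum>j<n. a i j * c j) = 0)" by blast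
  next
    fix c j assume c: "\<forall>i<n. (\<Sum>j<n. a i j * c j) = 0" "j < n" "c j \<noteq> 0"
    have "?A *\<^sub>v Matrix.vec n c = 0\<^sub>v n"
    proof (rule eq_vecI)
      fix i assume "i < dim_vec (0\<^sub>v n :: complex Matrix.vec)"
      then have i: "i < n" by simp
      show "vec_index (?A *\<^sub>v Matrix.vec n c) i = vec_index (0\<^sub>v n) i"
        using mat_mult_vec_index[OF i, of a c] c(1) i by simp
    qed simp
    moreover have "Matrix.vec n c \<noteq> 0\<^sub>v n"
    proof
      assume "Matrix.vec n c = 0\<^sub>v n"
      then have "vec_index (Matrix.vec n c) j = vec_index (0\<^sub>v n) j" by simp
      then show False using c by simp
    qed
    ultimately show "\<exists>v. v \<in> carrier_vec n \<and> v \<noteq> 0\<^sub>v n \<and> ?A *\<^sub>v v = 0\<^sub>v n"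
      by (intro exI[of _ "Matrix.vec n c"]) simp
  qed
  finally show ?thesis .
qed

text \<open>Cramer's rule: the solution is a polynomial function of the data, up to the determinant.\<close>

definition cramer_det :: "nat \<Rightarrow> (nat \<Rightarrow> nat \<Rightarrow> complex) \<Rightarrow> (nat \<Rightarrow> complex) \<Rightarrow> nat \<Rightarrow> complex" where
  "cramer_det n a b k = det_of n (\<lambda>i j. if j = k then b i else a i j)"

lemma cramer_det_solves:
  assumes "det_of n a \<noteq> 0" "i < n"
  shows "(\<Sum>j<n. a i j * cramer_det n a b j) = det_of n a * b i"
proof -
  let ?A = "Matrix.mat n n (\<lambda>(i, j). a i j)" and ?b = "Matrix.vec n b"
  have A: "?A \<in> carrier_mat n n" by simp
  define x where "x = (1 / det_of n a) \<cdot>\<^sub>v (adj_mat ?A *\<^sub>v ?b)"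
  have adj: "adj_mat ?A \<in> carrier_mat n n" "?A * adj_mat ?A = det_of n a \<cdot>\<^sub>m 1\<^sub>m n"
    using adj_mat[OF A] by (simp_all add: det_of_def)
  have x: "x \<in> carrier_vec n" unfolding x_def using adj(1) by simp
  have "?A *\<^sub>v x = (1 / det_of n a) \<cdot>\<^sub>v (?A *\<^sub>v (adj_mat ?A *\<^sub>v ?b))"
    unfolding x_def using A adj(1) by (intro mult_mat_vec) auto
  also have "?A *\<^sub>v (adj_mat ?A *\<^sub>v ?b) = (?A * adj_mat ?A) *\<^sub>v ?b"
    using assoc_mult_mat_vec[OF A adj(1), of ?b] by simp
  also have "\<dots> = det_of n a \<cdot>\<^sub>v ?b"
    unfolding adj(2) by (intro eq_vecI) (auto simp: scalar_prod_def mult_delta_left mult_delta_right)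
  finally have Ax: "?A *\<^sub>v x = ?b" using assms(1) by (auto simp: smult_smult_assoc)
  have r: "cramer_det n a b k = vec_index x k * det_of n a" if "k < n" for k
  proof -
    have "replace_col ?A ?b k = Matrix.mat n n (\<lambda>(i, j). if j = k then b i else a i j)"
      unfolding replace_col_def by (intro eq_matI) auto
    then show ?thesis
      using cramer_lemma_mat[OF A x that] unfolding Ax cramer_det_def det_of_def by simp
  qed
  have "(\<Sum>j<n. a i j * cramer_det n a b j) = det_of n a * (\<Sum>j<n. a i j * vec_index x j)"
    unfolding sum_distrib_left by (rule sum.cong) (auto simp: r)
  also have "(\<Sum>j<n. a i j * vec_index x j) = vec_index (?A *\<^sub>v x) i"
    using assms(2) x by (simp add: scalar_prod_def lessThan_atLeast0)
  also have "\<dots> = b i" using Ax assms(2) by simp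
  finally show ?thesis .
qed

lemma poly_fun_cramer_det:
  assumes "\<And>i j. i < n \<Longrightarrow> j < n \<Longrightarrow> (\<lambda>v. a v i j) \<in> poly_fun m" "\<And>i. i < n \<Longrightarrow> (\<lambda>v. b v i) \<in> poly_fun m"
  shows "(\<lambda>v. cramer_det n (a v) (b v) k) \<in> poly_fun m"
  unfolding cramer_det_def
proof (rule poly_fun_det_of)
  fix i j assume "i < n" "j < n"
  then show "(\<lambda>v. if j = k then b v i else a v i j) \<in> poly_fun m" using assms by (cases "j = k") auto
qed

subsection \<open>The space of forms of given degree\<close>

definition monomials :: "nat \<Rightarrow> (3 \<Rightarrow>\<^sub>0 nat) set" where
  "monomials k = {m. weight UNIV m = k}"

text \<open>The same index set labels the monomials of degree k, by the exponents of the last two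
  variables, and the nodes of the triangular arrangement. This is why the number of nodes is the
  dimension of the space of forms.\<close>

definition triangle_idx :: "nat \<Rightarrow> (nat \<times> nat) set" where
  "triangle_idx k = {(i, j). i + j \<le> k}"

abbreviation forms_dim :: "nat \<Rightarrow> nat" where
  "forms_dim k \<equiv> (k + 2) choose 2"

lemma finite_triangle_idx [simp]: "finite (triangle_idx k)"
  by (rule finite_subset[of _ "{..k} \<times> {..k}"]) (auto simp: triangle_idx_def)

lemma card_triangle_idx: "card (triangle_idx k) = forms_dim k"
proof (induction k)
  case 0
  have "triangle_idx 0 = {(0, 0)}" by (auto simp: triangle_idx_def)
  then show ?case by (simp add: numeral_2_eq_2)
next
  case (Suc k)
  have eq: "triangle_idx (Suc k) = triangle_idx k \<union> (\<lambda>i. (i, Suc k - i)) ` {..Suc k}"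
    by (auto simp: triangle_idx_def image_iff)
  have "triangle_idx k \<inter> (\<lambda>i. (i, Suc k - i)) ` {..Suc k} = {}" by (auto simp: triangle_idx_def)
  then have "card (triangle_idx (Suc k)) = card (triangle_idx k) + card ((\<lambda>i. (i, Suc k - i)) ` {..Suc k})"
    unfolding eq by (intro card_Un_disjoint) auto
  also have "card ((\<lambda>i. (i, Suc k - i)) ` {..Suc k}) = Suc (Suc k)"
    by (subst card_image) (auto simp: inj_on_def)
  finally show ?case using Suc by (simp add: numeral_2_eq_2)
qed

definition triangle_idx_nth_monomial :: "nat \<Rightarrow> nat \<times> nat \<Rightarrow> (3 \<Rightarrow>\<^sub>0 nat)" where
  "triangle_idx_nth_monomial k p = Poly_Mapping.single 1 (k - fst p - snd p) + Poly_Mapping.single 2 (fst p) +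
     Poly_Mapping.single 3 (snd p)"

lemma lookup_triangle_idx_nth_monomial:
  "Poly_Mapping.lookup (triangle_idx_nth_monomial k p) 1 = k - fst p - snd p"
  "Poly_Mapping.lookup (triangle_idx_nth_monomial k p) 2 = fst p"
  "Poly_Mapping.lookup (triangle_idx_nth_monomial k p) 3 = snd p"
  by (simp_all add: triangle_idx_nth_monomial_def lookup_add lookup_single)

lemma poly_mapping_3_eqI:
  fixes f g :: "3 \<Rightarrow>\<^sub>0 'a::zero"
  assumes "Poly_Mapping.lookup f 1 = Poly_Mapping.lookup g 1"
    "Poly_Mapping.lookup f 2 = Poly_Mapping.lookup g 2" "Poly_Mapping.lookup f 3 = Poly_Mapping.lookup g 3"
  shows "f = g"
proof (rule poly_mapping_eqI)
  fix i :: 3 show "Poly_Mapping.lookup f i = Poly_Mapping.lookup g i"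
    using exhaust_3[of i] assms by auto
qed

lemma bij_triangle_idx_nth_monomial: "bij_betw (triangle_idx_nth_monomial k) (triangle_idx k) (monomials k)"
proof (rule bij_betw_byWitness[of _ "\<lambda>m. (Poly_Mapping.lookup m 2, Poly_Mapping.lookup m 3)"])
  show "\<forall>m\<in>monomials k. triangle_idx_nth_monomial k (Poly_Mapping.lookup m 2, Poly_Mapping.lookup m 3) = m"
    by (auto intro!: poly_mapping_3_eqI simp: lookup_triangle_idx_nth_monomial monomials_def weight_UNIV sum_3)
  show "\<forall>p\<in>triangle_idx k. (Poly_Mapping.lookup (triangle_idx_nth_monomial k p) 2, Poly_Mapping.lookup (triangle_idx_nth_monomial k p) 3) = p"
    by (auto simp: lookup_triangle_idx_nth_monomial)
  show "triangle_idx_nth_monomial k ` triangle_idx k \<subseteq> monomials k"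
    by (auto simp: monomials_def weight_UNIV sum_3 lookup_triangle_idx_nth_monomial triangle_idx_def)
  show "(\<lambda>m. (Poly_Mapping.lookup m 2, Poly_Mapping.lookup m 3)) ` monomials k \<subseteq> triangle_idx k"
    by (auto simp: monomials_def weight_UNIV sum_3 triangle_idx_def)
qed

lemma finite_monomials [simp]: "finite (monomials k)" and card_monomials: "card (monomials k) = forms_dim k"
  using bij_betw_finite[OF bij_triangle_idx_nth_monomial, of k] bij_betw_same_card[OF bij_triangle_idx_nth_monomial, of k]
  by (simp_all add: card_triangle_idx)

definition nth_monomial :: "nat \<Rightarrow> nat \<Rightarrow> (3 \<Rightarrow>\<^sub>0 nat)" where
  "nth_monomial k = (SOME h. bij_betw h {..<forms_dim k} (monomials k))"

lemma bij_nth_monomial: "bij_betw (nth_monomial k) {..<forms_dim k} (monomials k)"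
proof -
  have "\<exists>h. bij_betw h {0..<card (monomials k)} (monomials k)" by (rule ex_bij_betw_nat_finite) simp
  then have "\<exists>h. bij_betw h {..<forms_dim k} (monomials k)" by (simp add: card_monomials lessThan_atLeast0)
  then show ?thesis unfolding nth_monomial_def by (rule someI_ex)
qed

definition monomial_form :: "nat \<Rightarrow> nat \<Rightarrow> 3 cpoly" where
  "monomial_form k j = Poly_Mapping.single (nth_monomial k j) 1"

lemma homogeneous_monomial_form [simp]: "j < forms_dim k \<Longrightarrow> homogeneous k (monomial_form k j)"
  using bij_betwE[OF bij_nth_monomial, of k] by (auto simp: monomial_form_def homogeneous_weight monomials_def)

lemma hom_expand:
  assumes "homogeneous k f"
  shows "f = (\<Sum>j<forms_dim k. const (Poly_Mapping.lookup f (nth_monomial k j)) * monomial_form k j)"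
proof -
  have "f = (\<Sum>m\<in>monomials k. Poly_Mapping.single m (Poly_Mapping.lookup f m))"
    by (rule sum_single_lookup[symmetric, OF finite_monomials]) (use assms in \<open>auto simp: homogeneous_weight monomials_def\<close>)
  also have "\<dots> = (\<Sum>j<forms_dim k. Poly_Mapping.single (nth_monomial k j) (Poly_Mapping.lookup f (nth_monomial k j)))"
    by (rule sum.reindex_bij_betw[OF bij_nth_monomial, symmetric])
  also have "\<dots> = (\<Sum>j<forms_dim k. const (Poly_Mapping.lookup f (nth_monomial k j)) * monomial_form k j)"
    by (simp add: monomial_form_def single_conv_const[symmetric])
  finally show ?thesis .
qed

lemma hom_eqI:
  assumes "homogeneous k f" "homogeneous k g"
    "\<And>j. j < forms_dim k \<Longrightarrow> Poly_Mapping.lookup f (nth_monomial k j) = Poly_Mapping.lookup g (nth_monomial k j)"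
  shows "f = g"
  using hom_expand[OF assms(1)] hom_expand[OF assms(2)] assms(3) by simp

lemma lookup_const_mult [simp]:
  "Poly_Mapping.lookup (const c * f) m = c * Poly_Mapping.lookup f m"
proof -
  have "const c * f = (\<Sum>m\<in>Poly_Mapping.keys f. Poly_Mapping.single m (c * Poly_Mapping.lookup f m))"
    by (subst (1) sum_single_lookup[of "Poly_Mapping.keys f" f, symmetric])
      (simp_all add: sum_distrib_left const_def mult_single)
  also have "Poly_Mapping.lookup \<dots> m = (\<Sum>m'\<in>Poly_Mapping.keys f. if m' = m then c * Poly_Mapping.lookup f m else 0)"
    unfolding lookup_sum by (rule sum.cong) (auto simp: lookup_single when_def)
  also have "\<dots> = c * Poly_Mapping.lookup f m" by (auto simp: in_keys_iff)
  finally show ?thesis .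
qed

definition lin_comb :: "nat \<Rightarrow> (nat \<Rightarrow> complex) \<Rightarrow> (nat \<Rightarrow> 3 cpoly) \<Rightarrow> 3 cpoly" where
  "lin_comb n c P = (\<Sum>i<n. const (c i) * P i)"

lemma homogeneous_lin_comb: "(\<And>i. i < n \<Longrightarrow> homogeneous k (P i)) \<Longrightarrow> homogeneous k (lin_comb n c P)"
  unfolding lin_comb_def by (intro homogeneous_sum homogeneous_const_mult) auto

lemma lookup_lin_comb: "Poly_Mapping.lookup (lin_comb n c P) m = (\<Sum>i<n. Poly_Mapping.lookup (P i) m * c i)"
  unfolding lin_comb_def lookup_sum lookup_const_mult by (intro sum.cong refl mult.commute)

lemma ev_lin_comb: "ev (lin_comb n c P) v = (\<Sum>i<n. ev (P i) v * c i)"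
  unfolding lin_comb_def poly_eval_sum by (intro sum.cong refl) (simp add: mult.commute[of "c _"])

definition indep :: "nat \<Rightarrow> (nat \<Rightarrow> 3 cpoly) \<Rightarrow> bool" where
  "indep n P \<longleftrightarrow> (\<forall>c. lin_comb n c P = 0 \<longrightarrow> (\<forall>i<n. c i = 0))"

definition spans :: "nat \<Rightarrow> nat \<Rightarrow> (nat \<Rightarrow> 3 cpoly) \<Rightarrow> bool" where
  "spans k n P \<longleftrightarrow> (\<forall>f. homogeneous k f \<longrightarrow> (\<exists>c. f = lin_comb n c P))"

text \<open>The matrix of a family in the monomial basis. Its determinant turns being a basis into a
  polynomial condition on a family that depends on the points.\<close>

definition coeff_det :: "nat \<Rightarrow> (nat \<Rightarrow> 3 cpoly) \<Rightarrow> complex" where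
  "coeff_det k P = det_of (forms_dim k) (\<lambda>i j. Poly_Mapping.lookup (P j) (nth_monomial k i))"

lemma coeff_det_indep:
  assumes "\<And>i. i < forms_dim k \<Longrightarrow> homogeneous k (P i)"
  shows "coeff_det k P \<noteq> 0 \<longleftrightarrow> indep (forms_dim k) P"
proof -
  have "lin_comb (forms_dim k) c P = 0 \<longleftrightarrow> (\<forall>i<forms_dim k. (\<Sum>j<forms_dim k. Poly_Mapping.lookup (P j) (nth_monomial k i) * c j) = 0)" for c
  proof
    assume "\<forall>i<forms_dim k. (\<Sum>j<forms_dim k. Poly_Mapping.lookup (P j) (nth_monomial k i) * c j) = 0"
    then show "lin_comb (forms_dim k) c P = 0"
      by (intro hom_eqI[of k] homogeneous_lin_comb) (auto simp: assms lookup_lin_comb)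
  next
    assume "lin_comb (forms_dim k) c P = 0"
    then show "\<forall>i<forms_dim k. (\<Sum>j<forms_dim k. Poly_Mapping.lookup (P j) (nth_monomial k i) * c j) = 0"
      using lookup_lin_comb[of "forms_dim k" c P] by simp
  qed
  then show ?thesis unfolding coeff_det_def det_of_eq_0_iff indep_def by blast
qed

lemma coeff_det_spans:
  assumes "\<And>i. i < forms_dim k \<Longrightarrow> homogeneous k (P i)" "coeff_det k P \<noteq> 0"
  shows "spans k (forms_dim k) P"
  unfolding spans_def
proof (intro allI impI)
  fix f assume f: "homogeneous k f"
  let ?c = "\<lambda>j. cramer_det (forms_dim k) (\<lambda>i j. Poly_Mapping.lookup (P j) (nth_monomial k i)) (\<lambda>i. Poly_Mapping.lookup f (nth_monomial k i)) j / coeff_det k P"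
  have "f = lin_comb (forms_dim k) ?c P"
  proof (rule hom_eqI[of k])
    fix i assume i: "i < forms_dim k"
    have "Poly_Mapping.lookup (lin_comb (forms_dim k) ?c P) (nth_monomial k i) =
      (\<Sum>j<forms_dim k. Poly_Mapping.lookup (P j) (nth_monomial k i) * cramer_det (forms_dim k) (\<lambda>i j. Poly_Mapping.lookup (P j) (nth_monomial k i))
         (\<lambda>i. Poly_Mapping.lookup f (nth_monomial k i)) j) / coeff_det k P"
      by (simp add: lookup_lin_comb sum_divide_distrib)
    also have "\<dots> = Poly_Mapping.lookup f (nth_monomial k i)"
      using cramer_det_solves[OF assms(2)[unfolded coeff_det_def] i, of "\<lambda>i. Poly_Mapping.lookup f (nth_monomial k i)"] assms(2)
      by (simp add: coeff_det_def)
    finally show "Poly_Mapping.lookup f (nth_monomial k i) = Poly_Mapping.lookup (lin_comb (forms_dim k) ?c P) (nth_monomial k i)" by simp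
  qed (use f assms(1) in \<open>auto intro: homogeneous_lin_comb\<close>)
  then show "\<exists>c. f = lin_comb (forms_dim k) c P" by blast
qed

lemma indep_spans:
  assumes "\<And>i. i < forms_dim k \<Longrightarrow> homogeneous k (P i)" "indep (forms_dim k) P"
  shows "spans k (forms_dim k) P"
proof (rule coeff_det_spans)
  show "coeff_det k P \<noteq> 0" using coeff_det_indep[of k P] assms by blast
qed (rule assms(1))

subsection \<open>Families of polynomials depending polynomially on a tuple\<close>

definition poly_family :: "nat \<Rightarrow> ((nat \<Rightarrow> complex ^ 3) \<Rightarrow> 3 cpoly) \<Rightarrow> bool" where
  "poly_family n F \<longleftrightarrow> (\<forall>m. (\<lambda>v. Poly_Mapping.lookup (F v) m) \<in> poly_fun n)"

lemma poly_family_fixed [simp]: "poly_family n (\<lambda>_. f)"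
  by (simp add: poly_family_def poly_fun_const)

lemma poly_family_add: "poly_family n F \<Longrightarrow> poly_family n G \<Longrightarrow> poly_family n (\<lambda>v. F v + G v)"
  by (simp add: poly_family_def lookup_add poly_fun_add)

lemma poly_family_diff: "poly_family n F \<Longrightarrow> poly_family n G \<Longrightarrow> poly_family n (\<lambda>v. F v - G v)"
  by (simp add: poly_family_def lookup_minus poly_fun_diff)

lemma poly_family_sum: "(\<And>i. i \<in> A \<Longrightarrow> poly_family n (F i)) \<Longrightarrow> poly_family n (\<lambda>v. \<Sum>i\<in>A. F i v)"
  by (simp add: poly_family_def lookup_sum poly_fun_sum)

lemma poly_family_const_mult: "c \<in> poly_fun n \<Longrightarrow> poly_family n F \<Longrightarrow> poly_family n (\<lambda>v. const (c v) * F v)"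
  by (simp add: poly_family_def poly_fun_mult)

lemma poly_family_lin_comb: "(\<And>i. i < k \<Longrightarrow> (\<lambda>v. c v i) \<in> poly_fun n) \<Longrightarrow> (\<And>i. i < k \<Longrightarrow> poly_family n (\<lambda>v. P v i)) \<Longrightarrow>
    poly_family n (\<lambda>v. lin_comb k (c v) (P v))"
  unfolding lin_comb_def by (intro poly_family_sum poly_family_const_mult) auto

lemma lookup_var_mult:
  "Poly_Mapping.lookup (var x * f) m =
     (if Poly_Mapping.lookup m x > 0 then Poly_Mapping.lookup f (m - Poly_Mapping.single x 1) else 0)"
proof -
  have "var x * f = (\<Sum>m\<in>Poly_Mapping.keys f. Poly_Mapping.single (Poly_Mapping.single x 1 + m) (Poly_Mapping.lookup f m))"
    by (subst (1) sum_single_lookup[of "Poly_Mapping.keys f" f, symmetric])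
      (simp_all add: sum_distrib_left var_def mult_single)
  then have "Poly_Mapping.lookup (var x * f) m =
    (\<Sum>m'\<in>Poly_Mapping.keys f. if Poly_Mapping.single x 1 + m' = m then Poly_Mapping.lookup f m' else 0)"
    by (simp add: lookup_sum lookup_single when_def)
  also have "\<dots> = (\<Sum>m'\<in>Poly_Mapping.keys f. if m' = m - Poly_Mapping.single x 1 then
     (if Poly_Mapping.lookup m x > 0 then Poly_Mapping.lookup f (m - Poly_Mapping.single x 1) else 0) else 0)"
  proof (rule sum.cong)
    fix m' assume "m' \<in> Poly_Mapping.keys f"
    have "Poly_Mapping.single x 1 + m' = m \<longleftrightarrow> m' = m - Poly_Mapping.single x 1 \<and> Poly_Mapping.lookup m x > 0"
    proof
      assume "Poly_Mapping.single x 1 + m' = m"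
      then show "m' = m - Poly_Mapping.single x 1 \<and> Poly_Mapping.lookup m x > 0"
        by (auto simp: lookup_add)
    next
      assume "m' = m - Poly_Mapping.single x 1 \<and> Poly_Mapping.lookup m x > 0"
      then show "Poly_Mapping.single x 1 + m' = m"
        by (intro poly_mapping_eqI) (auto simp: lookup_add lookup_minus lookup_single when_def)
    qed
    then show "(if Poly_Mapping.single x 1 + m' = m then Poly_Mapping.lookup f m' else 0) =
      (if m' = m - Poly_Mapping.single x 1 then
     (if Poly_Mapping.lookup m x > 0 then Poly_Mapping.lookup f (m - Poly_Mapping.single x 1) else 0) else 0)"
      by auto
  qed simp
  also have "\<dots> = (if Poly_Mapping.lookup m x > 0 then Poly_Mapping.lookup f (m - Poly_Mapping.single x 1) else 0)"
    by (auto simp: in_keys_iff)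
  finally show ?thesis .
qed

lemma poly_family_mult_fixed: "poly_family n F \<Longrightarrow> poly_family n (\<lambda>v. a * F v)"
proof (induction a arbitrary: F rule: cpoly_induct)
  case (const c)
  then show ?case by (intro poly_family_const_mult poly_fun_const)
next
  case (var x)
  show ?case
    unfolding poly_family_def
  proof
    fix m show "(\<lambda>v. Poly_Mapping.lookup (var x * F v) m) \<in> poly_fun n"
      using var by (cases "Poly_Mapping.lookup m x > 0") (simp_all add: lookup_var_mult poly_fun_const poly_family_def)
  qed
next
  case (add f g)
  then show ?case by (simp add: distrib_right poly_family_add)
next
  case (mult f g)
  have "poly_family n (\<lambda>v. f * (g * F v))" by (intro mult.IH mult.prems)
  then show ?case by (simp only: mult.assoc)
qed

lemma lookup_partial_deriv:
  "Poly_Mapping.lookup (partial_deriv x f) m =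
     of_nat (Poly_Mapping.lookup m x + 1) * Poly_Mapping.lookup f (m + Poly_Mapping.single x 1)"
proof -
  have "Poly_Mapping.lookup (partial_deriv x f) m = (\<Sum>m'\<in>Poly_Mapping.keys f.
      if m' - Poly_Mapping.single x 1 = m then of_nat (Poly_Mapping.lookup m' x) * Poly_Mapping.lookup f m' else 0)"
    unfolding partial_deriv_def lookup_sum by (simp add: lookup_single when_def)
  also have "\<dots> = (\<Sum>m'\<in>Poly_Mapping.keys f. if m' = m + Poly_Mapping.single x 1 then
      of_nat (Poly_Mapping.lookup m x + 1) * Poly_Mapping.lookup f (m + Poly_Mapping.single x 1) else 0)"
  proof (rule sum.cong)
    fix m' assume "m' \<in> Poly_Mapping.keys f"
    show "(if m' - Poly_Mapping.single x 1 = m then of_nat (Poly_Mapping.lookup m' x) * Poly_Mapping.lookup f m' else 0) =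
      (if m' = m + Poly_Mapping.single x 1 then
      of_nat (Poly_Mapping.lookup m x + 1) * Poly_Mapping.lookup f (m + Poly_Mapping.single x 1) else 0)"
    proof (cases "Poly_Mapping.lookup m' x = 0")
      case True
      then have "m' \<noteq> m + Poly_Mapping.single x 1" by (auto simp: lookup_add)
      then show ?thesis using True by simp
    next
      case False
      then have m': "m' = (m' - Poly_Mapping.single x 1) + Poly_Mapping.single x 1"
        by (intro poly_mapping_eqI) (auto simp: lookup_add lookup_minus lookup_single when_def)
      have "m + Poly_Mapping.single x 1 - Poly_Mapping.single x 1 = m"
        by (intro poly_mapping_eqI) (simp add: lookup_add lookup_minus)
      with m' have "m' - Poly_Mapping.single x 1 = m \<longleftrightarrow> m' = m + Poly_Mapping.single x 1"
        by auto
      then show ?thesis by (auto simp: lookup_add)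
    qed
  qed simp
  also have "\<dots> = of_nat (Poly_Mapping.lookup m x + 1) * Poly_Mapping.lookup f (m + Poly_Mapping.single x 1)"
    by (auto simp: in_keys_iff)
  finally show ?thesis .
qed

lemma poly_family_partial_deriv: "poly_family n F \<Longrightarrow> poly_family n (\<lambda>v. partial_deriv x (F v))"
  by (simp add: poly_family_def lookup_partial_deriv poly_fun_mult poly_fun_const)

lemma homogeneous_partial_deriv:
  assumes "homogeneous (Suc k) f" shows "homogeneous k (partial_deriv x f)"
  unfolding homogeneous_weight
proof
  fix m assume "m \<in> Poly_Mapping.keys (partial_deriv x f)"
  then have "m + Poly_Mapping.single x 1 \<in> Poly_Mapping.keys f"
    by (auto simp: in_keys_iff lookup_partial_deriv)
  then show "weight UNIV m = k" using assms by (force simp: homogeneous_weight weight_single)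
qed

lemma poly_fun_coeff_det: "(\<And>i. i < forms_dim k \<Longrightarrow> poly_family n (\<lambda>v. P v i)) \<Longrightarrow> (\<lambda>v. coeff_det k (P v)) \<in> poly_fun n"
  unfolding coeff_det_def by (rule poly_fun_det_of) (auto simp: poly_family_def)

text \<open>At v0 the coefficient matrix is the identity. Where its determinant remains nonzero, the
  family is still a basis.\<close>

lemma open_spanning:
  assumes "\<And>i. i < forms_dim k \<Longrightarrow> poly_family n (\<lambda>v. P v i)" "\<And>i v. i < forms_dim k \<Longrightarrow> homogeneous k (P v i)"
    "\<And>i. i < forms_dim k \<Longrightarrow> P v0 i = monomial_form k i"
  shows "\<exists>g\<in>poly_fun n. g v0 \<noteq> 0 \<and> (\<forall>v. g v \<noteq> 0 \<longrightarrow> spans k (forms_dim k) (P v))"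
proof (rule bexI[of _ "\<lambda>v. coeff_det k (P v)"])
  have inj: "inj_on (nth_monomial k) {..<forms_dim k}" using bij_nth_monomial bij_betw_def by blast
  have "coeff_det k (P v0) = 1"
    unfolding coeff_det_def
    by (rule det_of_identity)
      (use inj in \<open>auto simp: assms(3) monomial_form_def lookup_single when_def inj_on_def\<close>)
  then show "coeff_det k (P v0) \<noteq> 0 \<and> (\<forall>v. coeff_det k (P v) \<noteq> 0 \<longrightarrow> spans k (forms_dim k) (P v))"
    using coeff_det_spans assms(2) by simp
  show "(\<lambda>v. coeff_det k (P v)) \<in> poly_fun n" by (rule poly_fun_coeff_det) (rule assms(1))
qed

lemma const_mult: "const (a * b) = const a * const b"
  by (simp add: const_def mult_single)

lemma const_add: "const (a + b) = const a + const b"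
  by (simp add: const_def single_add)

lemma const_0 [simp]: "const 0 = 0" and const_1 [simp]: "const 1 = 1"
  by (simp_all add: const_def)

lemma const_sum: "const (sum f A) = (\<Sum>i\<in>A. const (f i))"
  by (induction A rule: infinite_finite_induct) (auto simp: const_add)

lemma const_uminus: "const (- a) = - const a"
  by (simp add: const_def single_uminus)

lemma lin_comb_Plus: "lin_comb (n + r) c P = lin_comb n c P + lin_comb r (\<lambda>i. c (n + i)) (\<lambda>i. P (n + i))"
  unfolding lin_comb_def by (induction r) (simp_all add: add.assoc)

lemma lin_comb_cong: "(\<And>i. i < n \<Longrightarrow> c i = c' i) \<Longrightarrow> (\<And>i. i < n \<Longrightarrow> P i = P' i) \<Longrightarrow> lin_comb n c P = lin_comb n c' P'"
  unfolding lin_comb_def by (rule sum.cong) auto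

lemma lin_comb_0: "(\<And>i. i < n \<Longrightarrow> c i = 0) \<Longrightarrow> lin_comb n c P = 0"
  unfolding lin_comb_def by (rule sum.neutral) auto

lemma lin_comb_add: "lin_comb n c P + lin_comb n c' P = lin_comb n (\<lambda>i. c i + c' i) P"
  unfolding lin_comb_def by (simp add: const_add distrib_right sum.distrib)

lemma lin_comb_uminus: "- lin_comb n c P = lin_comb n (\<lambda>i. - c i) P"
  unfolding lin_comb_def by (simp add: const_uminus sum_negf)

lemma lin_comb_lin_comb: "lin_comb r c (\<lambda>l. lin_comb n (R l) e) = lin_comb n (\<lambda>j. \<Sum>l<r. c l * R l j) e"
proof -
  have "lin_comb r c (\<lambda>l. lin_comb n (R l) e) = (\<Sum>l<r. \<Sum>j<n. const (c l * R l j) * e j)"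
    unfolding lin_comb_def sum_distrib_left const_mult mult.assoc ..
  also have "\<dots> = (\<Sum>j<n. \<Sum>l<r. const (c l * R l j) * e j)" by (rule sum.swap)
  also have "\<dots> = lin_comb n (\<lambda>j. \<Sum>l<r. c l * R l j) e"
    unfolding lin_comb_def const_sum sum_distrib_right ..
  finally show ?thesis .
qed

lemma lin_comb_scaled_diff:
  "lin_comb r c (\<lambda>l. const D * f l - A l) = lin_comb r (\<lambda>l. D * c l) f - lin_comb r c A"
proof -
  have "const (c l) * (const D * f l - A l) = const (D * c l) * f l - const (c l) * A l" for l
    unfolding const_mult by (simp only: right_diff_distrib mult.assoc mult.left_commute)
  then show ?thesis unfolding lin_comb_def by (simp add: sum_subtractf)
qed

lemma lin_comb_in_ideal: "(\<And>i. i < n \<Longrightarrow> P i \<in> ideal_gen S) \<Longrightarrow> lin_comb n c P \<in> ideal_gen S"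
  unfolding lin_comb_def by (intro ideal_gen_sum ideal_gen_mult) auto

subsection \<open>Forms vanishing on a varying set of points\<close>

text \<open>The points impose independent conditions on the forms of degree k, expressed by a dual
  family of forms.\<close>

definition interpolates :: "nat \<Rightarrow> nat \<Rightarrow> (nat \<Rightarrow> complex ^ 3) \<Rightarrow> bool" where
  "interpolates k n v \<longleftrightarrow> (\<forall>i<n. \<exists>u. homogeneous k u \<and> ev u (v i) = 1 \<and> (\<forall>j<n. j \<noteq> i \<longrightarrow> ev u (v j) = 0))"

definition vanishing_basis :: "nat \<Rightarrow> nat \<Rightarrow> (nat \<Rightarrow> complex ^ 3) \<Rightarrow> nat \<Rightarrow> (nat \<Rightarrow> 3 cpoly) \<Rightarrow> bool" where
  "vanishing_basis k n v r F \<longleftrightarrow>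
     (\<forall>l<r. homogeneous k (F l) \<and> (\<forall>i<n. ev (F l) (v i) = 0)) \<and> indep r F \<and>
     (\<forall>g. homogeneous k g \<longrightarrow> (\<forall>i<n. ev g (v i) = 0) \<longrightarrow> (\<exists>c. g = lin_comb r c F))"

text \<open>The forms e are dual to the points and the f vanish there, so evaluating a relation at
  the j-th point isolates c j; what remains is a relation among the f. As n + r is the full
  dimension, independence gives spanning.\<close>

lemma adapted_spans:
  assumes nr: "n + r = forms_dim k"
    and e: "\<And>j. j < n \<Longrightarrow> homogeneous k (e j)" and f: "\<And>l. l < r \<Longrightarrow> homogeneous k (f l)"
    and ee: "\<And>i j. i < n \<Longrightarrow> j < n \<Longrightarrow> ev (e j) (v0 i) = (if i = j then 1 else 0)"
    and fe: "\<And>i l. i < n \<Longrightarrow> l < r \<Longrightarrow> ev (f l) (v0 i) = 0"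
    and ind: "indep r f"
  shows "\<And>c c'. lin_comb n c e + lin_comb r c' f = 0 \<Longrightarrow> (\<forall>j<n. c j = 0) \<and> (\<forall>l<r. c' l = 0)"
    and "homogeneous k g \<Longrightarrow> \<exists>c c'. g = lin_comb n c e + lin_comb r c' f"
proof -
  show 1: "(\<forall>j<n. c j = 0) \<and> (\<forall>l<r. c' l = 0)" if z: "lin_comb n c e + lin_comb r c' f = 0" for c c'
  proof -
    have c: "c j = 0" if j: "j < n" for j
    proof -
      have "ev (lin_comb n c e + lin_comb r c' f) (v0 j) = (\<Sum>i<n. if i = j then c j else 0)"
        unfolding poly_eval_add ev_lin_comb using j by (simp add: ee fe mult_delta_left cong: if_cong)
      then show ?thesis using j z by simp
    qed
    then have "lin_comb n c e = 0" by (intro lin_comb_0)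
    then show ?thesis using z ind c by (simp add: indep_def)
  qed
  define P where "P i = (if i < n then e i else f (i - n))" for i
  have split: "lin_comb (forms_dim k) c P = lin_comb n c e + lin_comb r (\<lambda>i. c (n + i)) f" for c
    unfolding nr[symmetric] lin_comb_Plus by (intro arg_cong2[of _ _ _ _ "(+)"] lin_comb_cong) (auto simp: P_def)
  have "indep (forms_dim k) P"
    unfolding indep_def
  proof (intro allI impI)
    fix c i assume c: "lin_comb (forms_dim k) c P = 0" and i: "i < forms_dim k"
    show "c i = 0"
      using 1[of c "\<lambda>i. c (n + i)"] c i nr unfolding split
      by (cases "i < n") (auto dest: spec[of _ "i - n"])
  qed
  then have "spans k (forms_dim k) P"
    by (intro indep_spans) (use e f nr in \<open>auto simp: P_def\<close>)
  then show "homogeneous k g \<Longrightarrow> \<exists>c c'. g = lin_comb n c e + lin_comb r c' f"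
    unfolding spans_def split by blast
qed

text \<open>Cramer's rule deforms a basis of the forms of degree k vanishing on the points of v0 into a
  basis for the points of v.\<close>

lemma adapted_deformation:
  assumes nr: "n + r = forms_dim k"
    and e: "\<And>j. j < n \<Longrightarrow> homogeneous k (e j)" and f: "\<And>l. l < r \<Longrightarrow> homogeneous k (f l)"
    and ee: "\<And>i j. i < n \<Longrightarrow> j < n \<Longrightarrow> ev (e j) (v0 i) = (if i = j then 1 else 0)"
    and fe: "\<And>i l. i < n \<Longrightarrow> l < r \<Longrightarrow> ev (f l) (v0 i) = 0"
    and ind: "indep r f"
  shows "\<exists>F D. D \<in> poly_fun n \<and> D v0 \<noteq> 0 \<and> (\<forall>l<r. poly_family n (\<lambda>v. F v l) \<and> F v0 l = f l \<and> (\<forall>v. homogeneous k (F v l))) \<and>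
     (\<forall>v. D v \<noteq> 0 \<longrightarrow> vanishing_basis k n v r (F v) \<and> interpolates k n v)"
proof -
  define E where "E v i j = ev (e j) (v i)" for v :: "nat \<Rightarrow> complex ^ 3" and i j
  define D where "D v = det_of n (E v)" for v
  define R where "R v l = cramer_det n (E v) (\<lambda>i. ev (f l) (v i))" for v l
  \<comment> \<open>By Cramer's rule the combination of the e with coefficients R v l takes the
    values of D v times f l at the points of v; subtracting it makes the difference vanish there,
    without any division.\<close>
  define F where "F v l = const (D v) * f l - lin_comb n (R v l) e" for v l
  have ad1: "(\<forall>j<n. c j = 0) \<and> (\<forall>l<r. c' l = 0)" if "lin_comb n c e + lin_comb r c' f = 0" for c c'
    by (rule adapted_spans(1)[OF nr _ _ _ _ ind that, where ?v0.0 = v0]) (use e f ee fe in auto)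
  have ad2: "\<exists>c c'. g = lin_comb n c e + lin_comb r c' f" if "homogeneous k g" for g
    by (rule adapted_spans(2)[OF nr _ _ _ _ ind that, where ?v0.0 = v0]) (use e f ee fe in auto)
  have PFE: "(\<lambda>v. E v i j) \<in> poly_fun n" if "i < n" for i j
    unfolding E_def by (rule poly_fun_ev) (rule that)
  have PFD: "D \<in> poly_fun n"
    unfolding D_def by (rule poly_fun_det_of) (rule PFE)
  have PFR: "(\<lambda>v. R v l j) \<in> poly_fun n" for l j
    unfolding R_def by (rule poly_fun_cramer_det) (auto intro: PFE poly_fun_ev)
  have D0: "D v0 = 1"
    unfolding D_def E_def by (rule det_of_identity) (rule ee)
  have famF: "poly_family n (\<lambda>v. F v l)" for l
    unfolding F_def by (intro poly_family_diff poly_family_const_mult poly_family_lin_comb PFD PFR poly_family_fixed)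
  have homF: "homogeneous k (F v l)" if "l < r" for v l
    unfolding F_def by (intro homogeneous_diff homogeneous_const_mult homogeneous_lin_comb e f that)
  have F0: "F v0 l = f l" if l: "l < r" for l
  proof -
    have "R v0 l i = 0" if i: "i < n" for i
    proof -
      have "(\<Sum>j<n. E v0 i j * R v0 l j) = D v0 * ev (f l) (v0 i)"
        unfolding R_def D_def by (rule cramer_det_solves) (use i D0 in \<open>auto simp: D_def\<close>)
      also have "(\<Sum>j<n. E v0 i j * R v0 l j) = (\<Sum>j<n. if j = i then R v0 l i else 0)"
        by (rule sum.cong) (auto simp: E_def ee i)
      finally show ?thesis using i l fe by simp
    qed
    then have "lin_comb n (R v0 l) e = 0" by (rule lin_comb_0)
    then show ?thesis by (simp add: F_def D0)
  qed
  have main: "vanishing_basis k n v r (F v) \<and> interpolates k n v" if D: "D v \<noteq> 0" for v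
  proof
    have van: "ev (F v l) (v i) = 0" if "l < r" "i < n" for l i
      using cramer_det_solves[of n "E v" i "\<lambda>i. ev (f l) (v i)"] D that
      by (simp add: F_def ev_lin_comb R_def D_def E_def)
    have lF: "lin_comb r c (F v) = lin_comb r (\<lambda>l. D v * c l) f - lin_comb n (\<lambda>j. \<Sum>l<r. c l * R v l j) e" for c
      unfolding F_def lin_comb_scaled_diff lin_comb_lin_comb ..
    have "indep r (F v)"
      unfolding indep_def
    proof (intro allI impI)
      fix c l assume c: "lin_comb r c (F v) = 0" and l: "l < r"
      have "lin_comb n (\<lambda>j. - (\<Sum>l<r. c l * R v l j)) e + lin_comb r (\<lambda>l. D v * c l) f = 0"
        using c unfolding lF lin_comb_uminus[symmetric] by simp
      then have "D v * c l = 0" using ad1 l by blast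
      then show "c l = 0" using D by simp
    qed
    moreover have "\<exists>c. g = lin_comb r c (F v)" if g: "homogeneous k g" "\<forall>i<n. ev g (v i) = 0" for g
    proof -
      obtain c c' where cc: "g = lin_comb n c e + lin_comb r c' f" using ad2[OF g(1)] by blast
      define b where "b l = c' l / D v" for l
      \<comment> \<open>The coefficients of what is left of g in the span of e after its component
        along F v is removed. This rest vanishes at the points, and the evaluation matrix of the e
        is invertible.\<close>
      define a where "a j = c j + (\<Sum>l<r. b l * R v l j)" for j
      have "(\<lambda>l. D v * b l) = c'" using D by (auto simp: b_def)
      then have gb: "g - lin_comb r b (F v) = lin_comb n a e"
        unfolding lF a_def lin_comb_add[symmetric] cc by simp
      have "(\<Sum>j<n. E v i j * a j) = 0" if "i < n" for i
      proof -
        have "ev (g - lin_comb r b (F v)) (v i) = 0"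
          unfolding poly_eval_diff ev_lin_comb using g(2) van that by simp
        then show ?thesis unfolding gb ev_lin_comb E_def .
      qed
      then have "\<forall>j<n. a j = 0" using D det_of_eq_0_iff[of n "E v"] unfolding D_def by blast
      then have "g - lin_comb r b (F v) = 0" unfolding gb by (intro lin_comb_0) auto
      then show ?thesis by (intro exI[of _ b]) simp
    qed
    ultimately show "vanishing_basis k n v r (F v)"
      unfolding vanishing_basis_def using van homF by blast
    show "interpolates k n v"
      unfolding interpolates_def
    proof (intro allI impI)
      fix i assume i: "i < n"
      define b where "b i' = (if i' = i then 1 else 0 :: complex)" for i'
      define u where "u = lin_comb n (\<lambda>j. cramer_det n (E v) b j / D v) e"
      have "ev u (v i') = b i'" if "i' < n" for i'
      proof -
        have "ev u (v i') = (\<Sum>j<n. E v i' j * cramer_det n (E v) b j) / D v"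
          unfolding u_def ev_lin_comb E_def by (simp add: sum_divide_distrib)
        also have "\<dots> = b i'" using cramer_det_solves[of n "E v" i' b] D that by (simp add: D_def)
        finally show ?thesis .
      qed
      moreover have "homogeneous k u" unfolding u_def by (intro homogeneous_lin_comb e)
      ultimately show "\<exists>u. homogeneous k u \<and> ev u (v i) = 1 \<and> (\<forall>j<n. j \<noteq> i \<longrightarrow> ev u (v j) = 0)"
        using i by (intro exI[of _ u]) (auto simp: b_def)
    qed
  qed
  show ?thesis
    by (rule exI[of _ F], rule exI[of _ D]) (use PFD D0 famF F0 homF main in auto)
qed

subsection \<open>The ideal of a tuple of points\<close>

abbreviation tideal :: "nat \<Rightarrow> (nat \<Rightarrow> complex ^ 3) \<Rightarrow> 3 cpoly set" where
  "tideal n v \<equiv> homogeneous_ideal (tuple_points n v ` {..<n})"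

lemma tideal_hom_iff:
  assumes "nonzero_tuple n v" "homogeneous k f"
  shows "f \<in> tideal n v \<longleftrightarrow> (\<forall>i<n. ev f (v i) = 0)"
  using assms vanishes_hom[OF assms(2)] by (auto simp: homogeneous_ideal_eq tuple_points_def nonzero_tuple_def)

lemma graded_tideal:
  assumes "nonzero_tuple n v"
  shows "graded_piece (tideal n v) k = {f. homogeneous k f \<and> (\<forall>i<n. ev f (v i) = 0)}"
  using tideal_hom_iff[OF assms] by (auto simp: graded_piece_def)

lemma hom_linear_form_power: "homogeneous k (linear_form u ^ k)"
  using homogeneous_power[of "Suc 0" "linear_form u" k] by simp

lemma hom_var_power: "homogeneous k (var i ^ k)"
  using homogeneous_power[of "Suc 0" "var i" k] by simp

lemma nonzero_tuple_avoiding_line: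
  assumes "nonzero_tuple n v" shows "\<exists>u. \<forall>i<n. ev (linear_form u) (v i) \<noteq> 0"
proof -
  have "0 \<notin> v ` {..<n}" using assms by (metis imageE lessThan_iff nonzero_tuple_def)
  then show ?thesis using avoiding_line[of "v ` {..<n}"] by auto
qed

text \<open>If the points impose independent conditions in degree k, then every form of degree m > k is
  congruent to a multiple of a linear form avoiding the points; this is the induction step in
  Mumford's regularity theorem.\<close>

lemma regularity_step:
  assumes nonzero_tuple: "nonzero_tuple n v" and int: "interpolates k n v" and m: "m > k"
    and f: "homogeneous (Suc m) f" "f \<in> tideal n v"
  shows "f \<in> ideal_gen (graded_piece (tideal n v) m)"
proof -
  obtain y where L: "\<And>i. i < n \<Longrightarrow> ev (linear_form y) (v i) \<noteq> 0" using nonzero_tuple_avoiding_line[OF nonzero_tuple] by blast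
  obtain u where u: "\<And>i. i < n \<Longrightarrow> homogeneous k (u i)" "\<And>i. i < n \<Longrightarrow> ev (u i) (v i) = 1"
    "\<And>i j. i < n \<Longrightarrow> j < n \<Longrightarrow> j \<noteq> i \<Longrightarrow> ev (u i) (v j) = 0"
    using int unfolding interpolates_def by metis
  have dec: "\<exists>h. homogeneous (m - 1) h \<and> (\<forall>i<n. ev (g - linear_form y * h) (v i) = 0)" if g: "homogeneous m g" for g
  proof -
    \<comment> \<open>A multiple of the form dual to v i, raised to degree m - 1 by powers of the
      line. The exponent m - k in the constant accounts for these m - 1 - k factors and for the one
      further factor in \<open>linear_form y * h\<close>.\<close>
    define w where "w i = const (ev g (v i) / ev (linear_form y) (v i) ^ (m - k)) * (linear_form y ^ (m - 1 - k) * u i)" for i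
    have hw: "homogeneous (m - 1) (w i)" if "i < n" for i
    proof -
      have "homogeneous (m - 1 - k + k) (linear_form y ^ (m - 1 - k) * u i)"
        by (intro homogeneous_mult hom_linear_form_power u that)
      then show ?thesis using m unfolding w_def by (intro homogeneous_const_mult) simp
    qed
    have ew: "ev (linear_form y * w i) (v j) = (if i = j then ev g (v j) else 0)" if "i < n" "j < n" for i j
    proof -
      have "m - k = Suc (m - 1 - k)" using m by simp
      then show ?thesis using that L[of j] u by (auto simp: w_def)
    qed
    have "ev (g - linear_form y * (\<Sum>i<n. w i)) (v j) = 0" if "j < n" for j
    proof -
      have "ev (linear_form y * (\<Sum>i<n. w i)) (v j) = (\<Sum>i<n. ev (linear_form y * w i) (v j))"
        by (simp only: sum_distrib_left poly_eval_sum)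
      also have "\<dots> = (\<Sum>i<n. if i = j then ev g (v j) else 0)"
        by (rule sum.cong) (use ew that in auto)
      also have "\<dots> = ev g (v j)" using that by simp
      finally show ?thesis by (simp only: poly_eval_diff) simp
    qed
    then show ?thesis by (intro exI[of _ "\<Sum>i<n. w i"]) (auto intro!: homogeneous_sum hw simp del: One_nat_def)
  qed
  obtain g where g: "\<And>i. homogeneous m (g i)" "f = (\<Sum>i\<in>UNIV. var i * g i)"
    using hom_Suc_decomp[OF f(1)] by blast
  have "\<forall>i. \<exists>h. homogeneous (m - 1) h \<and> (\<forall>j<n. ev (g i - linear_form y * h) (v j) = 0)"
    using dec g(1) by blast
  then obtain h where h: "\<And>i. homogeneous (m - 1) (h i)" "\<And>i j. j < n \<Longrightarrow> ev (g i - linear_form y * h i) (v j) = 0"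
    by metis
  define a where "a i = g i - linear_form y * h i" for i
  define q where "q = (\<Sum>i\<in>UNIV. var i * h i)"
  have hlin: "homogeneous m (linear_form y * h i)" for i
    using homogeneous_mult[OF homogeneous_linear_form h(1), of y i] m by simp
  have aI: "a i \<in> graded_piece (tideal n v) m" for i
    unfolding graded_tideal[OF nonzero_tuple] using h(2) by (auto simp: a_def intro!: homogeneous_diff g hlin)
  have "var i * g i = var i * a i + linear_form y * (var i * h i)" for i
    unfolding a_def by (simp only: right_diff_distrib mult.left_commute) simp
  then have fq: "f = (\<Sum>i\<in>UNIV. var i * a i) + linear_form y * q"
    unfolding g(2) q_def sum_distrib_left by (simp only: sum.distrib)
  have "homogeneous m (var i * h i)" for i
    using homogeneous_mult[OF homogeneous_var h(1), of i i] m by simp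
  then have hq: "homogeneous m q" unfolding q_def by (intro homogeneous_sum)
  \<comment> \<open>All a i and f vanish at the points while the line does not, so the cofactor q
    vanishes there. Thus q, like the a i, lies in the piece of degree m.\<close>
  have "ev q (v j) = 0" if j: "j < n" for j
  proof -
    have "ev (a i) (v j) = 0" for i using h(2) j by (simp add: a_def)
    then have "ev f (v j) = ev (linear_form y) (v j) * ev q (v j)" by (simp add: fq)
    moreover have "ev f (v j) = 0" using f tideal_hom_iff[OF nonzero_tuple f(1)] j by blast
    ultimately show ?thesis using L j by simp
  qed
  then have "q \<in> graded_piece (tideal n v) m" using hq by (simp add: graded_tideal[OF nonzero_tuple])
  then show ?thesis
    unfolding fq by (intro ideal_gen_add ideal_gen_sum ideal_gen_mult ideal_gen_base aI)
qed

lemma regularity_ideal: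
  assumes nonzero_tuple: "nonzero_tuple n v" and int: "interpolates k n v" and m: "m > k"
    and j: "j \<ge> m" and f: "homogeneous j f" "f \<in> tideal n v"
  shows "f \<in> ideal_gen (graded_piece (tideal n v) m)"
  using j f
proof (induction j arbitrary: f rule: dec_induct)
  case base
  then show ?case by (intro ideal_gen_base) (simp add: graded_piece_def)
next
  case (step j)
  have "f \<in> ideal_gen (graded_piece (tideal n v) j)"
    using step m by (intro regularity_step[OF nonzero_tuple int]) auto
  moreover have "ideal_gen (graded_piece (tideal n v) j) \<subseteq> ideal_gen (graded_piece (tideal n v) m)"
    by (rule ideal_gen_subset) (use step in \<open>auto simp: graded_piece_def\<close>)
  ultimately show ?case by blast
qed

lemma regularity:
  assumes "nonzero_tuple n v" "interpolates k n v" "m > k"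
  shows "envelope (tideal n v) m = tideal n v"
  unfolding envelope_def
  by (rule saturation_eqI[of _ _ m]) (use regularity_ideal[OF assms] in \<open>auto simp: graded_piece_def\<close>)

subsection \<open>Generating degrees\<close>

lemma envelope_0:
  assumes "graded_piece J m = {0}" shows "envelope J m = {0}"
  by (simp add: envelope_def assms ideal_gen_zero saturation_0)

text \<open>Below d the envelope is the whole plane and above d it is the scheme itself. It jumps at
  d, and a second time at d + 1 precisely if the d-envelope is still too large.\<close>

lemma generating_degrees:
  assumes d: "d > 0" and low: "\<And>m. m < d \<Longrightarrow> envelope J m = {0}" and mid: "envelope J d \<noteq> {0}"
    and high: "\<And>m. m > d \<Longrightarrow> envelope J m = J"
  shows "geometric_generating_degrees J = (if envelope J d = J then {d} else {d, d + 1})"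
proof -
  have "envelope J m \<noteq> envelope J (m - 1) \<longleftrightarrow> m = d \<or> (m = d + 1 \<and> envelope J d \<noteq> J)" if "m > 0" for m
  proof -
    consider "m < d" | "m = d" | "m = d + 1" | "m > d + 1" by linarith
    then show ?thesis
    proof cases
      case 1
      then show ?thesis using low[of m] low[of "m - 1"] by simp
    next
      case 2
      then show ?thesis using low[of "m - 1"] mid d by auto
    next
      case 3
      then show ?thesis using high[of m] by auto
    next
      case 4
      then show ?thesis using high[of m] high[of "m - 1"] by simp
    qed
  qed
  then show ?thesis using d unfolding geometric_generating_degrees_def by auto
qed

text \<open>Multiplication by a power of X is injective and stays in the ideal.\<close>

lemma graded_piece_low:
  assumes "graded_piece (homogeneous_ideal W) k = {0}" "m \<le> k"
  shows "graded_piece (homogeneous_ideal W) m = {0}"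
proof -
  have "f = 0" if f: "f \<in> graded_piece (homogeneous_ideal W) m" for f
  proof -
    have "homogeneous (k - m + m) (var 1 ^ (k - m) * f)"
      using f by (intro homogeneous_mult hom_var_power) (simp add: graded_piece_def)
    moreover have "var 1 ^ (k - m) * f \<in> homogeneous_ideal W"
      using f by (simp add: graded_piece_def homogeneous_ideal_eq vanishes_at_def)
    ultimately have "var 1 ^ (k - m) * f \<in> graded_piece (homogeneous_ideal W) k"
      using assms(2) by (simp add: graded_piece_def)
    then have "var 1 ^ (k - m) * f = 0" using assms(1) by blast
    then show ?thesis using var_nonzero[of 1] by (auto simp only: mult_eq_0_iff power_eq_0_iff)
  qed
  moreover have "0 \<in> graded_piece (homogeneous_ideal W) m"
    by (simp add: graded_piece_def homogeneous_ideal_eq vanishes_at_def)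
  ultimately show ?thesis by blast
qed

section \<open>The dimension of the space of forms through the points\<close>

interpretation scale: Vector_Spaces.vector_space "poly_scale :: complex \<Rightarrow> 3 cpoly \<Rightarrow> 3 cpoly"
  by (rule vector_space_poly_scale)

lemma indep_independent:
  assumes "indep r F"
  shows "inj_on F {..<r}" "scale.independent (F ` {..<r})"
proof -
  show inj: "inj_on F {..<r}"
  proof (rule inj_onI, rule ccontr)
    fix i j assume ij: "i \<in> {..<r}" "j \<in> {..<r}" "F i = F j" "i \<noteq> j"
    define c where "c l = (if l = i then 1 else 0) - (if l = j then 1 else 0 :: complex)" for l
    have "lin_comb r c F = (\<Sum>l<r. (if l = i then F i else 0)) - (\<Sum>l<r. (if l = j then F j else 0))"
      unfolding lin_comb_def c_def sum_subtractf[symmetric] by (rule sum.cong) (auto simp: const_uminus)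
    then have "lin_comb r c F = 0" using ij by simp
    then have "c i = 0" using assms ij(1) by (auto simp: indep_def)
    then show False using ij by (simp add: c_def)
  qed
  show "scale.independent (F ` {..<r})"
  proof (rule scale.independent_if_scalars_zero)
    fix c x assume c: "(\<Sum>x\<in>F ` {..<r}. poly_scale (c x) x) = 0" and x: "x \<in> F ` {..<r}"
    have "lin_comb r (c \<circ> F) F = 0"
      using c unfolding lin_comb_def by (simp add: sum.reindex[OF inj] poly_scale_conv)
    then show "c x = 0" using assms x by (auto simp: indep_def)
  qed simp
qed

lemma lin_comb_in_span: "lin_comb r c F \<in> scale.span (F ` {..<r})"
  unfolding lin_comb_def poly_scale_conv[symmetric]
  by (intro scale.span_sum scale.span_scale scale.span_base) auto

lemma dim_graded_piece:
  assumes nonzero_tuple: "nonzero_tuple n v" and F: "vanishing_basis k n v r F"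
  shows "vector_space.dim poly_scale (graded_piece (tideal n v) k) = r"
proof (rule scale.dim_unique[of "F ` {..<r}"])
  let ?V = "graded_piece (tideal n v) k"
  have ind: "indep r F" using F by (simp add: vanishing_basis_def)
  show "F ` {..<r} \<subseteq> ?V"
    using F by (auto simp: vanishing_basis_def graded_tideal[OF nonzero_tuple])
  show "?V \<subseteq> scale.span (F ` {..<r})"
    using F lin_comb_in_span unfolding vanishing_basis_def graded_tideal[OF nonzero_tuple] by blast
  show "card (F ` {..<r}) = r" using indep_independent(1)[OF ind] by (simp add: card_image)
  show "scale.independent (F ` {..<r})" by (rule indep_independent(2)[OF ind])
qed

text \<open>Only the first n' points enter. This flexibility is for \<open>generic_no_forms\<close>,
  where r = 0 and the first \<open>forms_dim k\<close> of the n points already exclude every nonzero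
  form of degree k.\<close>

lemma generic_deformation:
  assumes nr: "n' + r = forms_dim k" and n': "n' \<le> n" and nonzero_tuple: "nonzero_tuple n v0"
    and e: "\<And>j. j < n' \<Longrightarrow> homogeneous k (e j)" and f: "\<And>l. l < r \<Longrightarrow> homogeneous k (f l)"
    and ee: "\<And>i j. i < n' \<Longrightarrow> j < n' \<Longrightarrow> ev (e j) (v0 i) = (if i = j then 1 else 0)"
    and fe: "\<And>i l. i < n' \<Longrightarrow> l < r \<Longrightarrow> ev (f l) (v0 i) = 0"
    and ind: "indep r f"
  shows "generic n (\<lambda>v. \<exists>F. vanishing_basis k n' v r F \<and> interpolates k n' v)"
proof -
  have "\<exists>F D. D \<in> poly_fun n' \<and> D v0 \<noteq> 0 \<and>
     (\<forall>l<r. poly_family n' (\<lambda>v. F v l) \<and> F v0 l = f l \<and> (\<forall>v. homogeneous k (F v l))) \<and>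
     (\<forall>v. D v \<noteq> 0 \<longrightarrow> vanishing_basis k n' v r (F v) \<and> interpolates k n' v)"
    by (rule adapted_deformation[where ?v0.0 = v0 and e = e]) (use assms in auto)
  then obtain F D where FD: "D \<in> poly_fun n'" "D v0 \<noteq> 0"
     "\<And>v. D v \<noteq> 0 \<Longrightarrow> vanishing_basis k n' v r (F v) \<and> interpolates k n' v" by blast
  show ?thesis
    by (rule genI[OF poly_fun_mono[OF FD(1) n'] nonzero_tuple FD(2)]) (use FD(3) in blast)
qed

subsection \<open>The triangular arrangement\<close>

text \<open>The coordinates are sheared so that the points of the square grid have distinct second
  coordinates.\<close>

definition node :: "nat \<Rightarrow> nat \<times> nat \<Rightarrow> complex ^ 3" where
  "node k p = vector [1, of_nat (fst p) + of_nat k * of_nat (snd p), of_nat (snd p)]"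

text \<open>In the unsheared coordinates (i, j) of the nodes the three families are the lines i = a,
  j = b and i + j = c.\<close>

definition line_A :: "nat \<Rightarrow> nat \<Rightarrow> 3 cpoly" where "line_A k a = linear_form (vector [- of_nat a, 1, - of_nat k])"
definition line_B :: "nat \<Rightarrow> 3 cpoly" where "line_B b = linear_form (vector [- of_nat b, 0, 1])"
definition line_C :: "nat \<Rightarrow> nat \<Rightarrow> 3 cpoly" where "line_C k c = linear_form (vector [- of_nat c, 1, 1 - of_nat k])"

text \<open>A product of k lines that miss the node p. Any other node of the triangle has a smaller
  first index, a smaller second index or a larger sum of indices, and so lies on one of the lines.
  Up to scaling these forms are the basis dual to the nodes.\<close>

definition triangle_form :: "nat \<Rightarrow> nat \<times> nat \<Rightarrow> 3 cpoly" where
  "triangle_form k p = (\<Prod>a<fst p. line_A k a) * (\<Prod>b<snd p. line_B b) * (\<Prod>c\<in>{fst p + snd p<..k}. line_C k c)"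

lemma ev_lABC:
  "ev (line_A k a) (node k p) = of_nat (fst p) - of_nat a"
  "ev (line_B b) (node k p) = of_nat (snd p) - of_nat b"
  "ev (line_C k c) (node k p) = of_nat (fst p + snd p) - of_nat c"
  by (simp_all add: line_A_def line_B_def line_C_def node_def ev_linear_form vector_3 algebra_simps)

lemma hom_lABC [simp]:
  "homogeneous (Suc 0) (line_A k a)" "homogeneous (Suc 0) (line_B b)" "homogeneous (Suc 0) (line_C k c)"
  by (simp_all add: line_A_def line_B_def line_C_def)

lemma node_nonzero: "node k p \<noteq> 0"
proof
  assume "node k p = 0"
  then have "node k p $ 1 = 0" by simp
  then show False by (simp add: node_def vector_3)
qed

lemma ev_var1_node [simp]: "node k p $ 1 = 1"
  by (simp add: node_def vector_3)

lemma homogeneous_prod_linear: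
  "finite A \<Longrightarrow> (\<And>i. i \<in> A \<Longrightarrow> homogeneous (Suc 0) (f i)) \<Longrightarrow> homogeneous (card A) (prod f A)"
  using homogeneous_prod[of A "\<lambda>_. Suc 0" f] by simp

lemma homogeneous_triangle_form:
  assumes "p \<in> triangle_idx k" shows "homogeneous k (triangle_form k p)"
proof -
  have "homogeneous (card {..<fst p} + card {..<snd p} + card {fst p + snd p<..k}) (triangle_form k p)"
    unfolding triangle_form_def by (intro homogeneous_mult homogeneous_prod_linear) auto
  moreover have "card {..<fst p} + card {..<snd p} + card {fst p + snd p<..k} = k"
    using assms by (auto simp: triangle_idx_def)
  ultimately show ?thesis by simp
qed

lemma ev_triangle_form_diag:
  shows "ev (triangle_form k p) (node k p) \<noteq> 0"
proof -
  have "of_nat (fst p + snd p) - of_nat c \<noteq> (0 :: complex)" if "c \<in> {fst p + snd p<..k}" for c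
    using that by (simp del: of_nat_add)
  then show ?thesis by (auto simp: triangle_form_def ev_lABC simp del: of_nat_add)
qed

lemma ev_triangle_form_off:
  assumes "q \<in> triangle_idx k" "p \<noteq> q"
  shows "ev (triangle_form k p) (node k q) = 0"
proof -
  have "fst q < fst p \<or> snd q < snd p \<or> fst p + snd p < fst q + snd q"
    using assms(2) by (cases p, cases q) auto
  moreover have "fst q + snd q \<le> k" using assms(1) by (auto simp: triangle_idx_def)
  ultimately show ?thesis
    by (auto simp: triangle_form_def ev_lABC simp del: of_nat_add intro!: bexI[of _ "fst q + snd q"])
qed

text \<open>Removing the nodes listed by s splits the dual basis: their forms vanish on the
  remaining nodes, and the other forms, normalised, are dual to these. This is exactly the input of
  \<open>adapted_deformation\<close>.\<close>

lemma triangle_example: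
  assumes s: "inj_on s {..<r}" "s ` {..<r} \<subseteq> triangle_idx k" and nr: "n + r = forms_dim k"
  shows "\<exists>p e. bij_betw p {..<n} (triangle_idx k - s ` {..<r}) \<and> (\<forall>j<n. homogeneous k (e j)) \<and>
    (\<forall>l<r. homogeneous k (triangle_form k (s l))) \<and>
    (\<forall>i<n. \<forall>j<n. ev (e j) (node k (p i)) = (if i = j then 1 else 0)) \<and>
    (\<forall>i<n. \<forall>l<r. ev (triangle_form k (s l)) (node k (p i)) = 0) \<and> indep r (\<lambda>l. triangle_form k (s l))"
proof -
  have "card (triangle_idx k - s ` {..<r}) = n"
    using nr s card_triangle_idx[of k] by (simp add: card_Diff_subset card_image)
  then obtain p where p: "bij_betw p {..<n} (triangle_idx k - s ` {..<r})"
    using ex_bij_betw_nat_finite[of "triangle_idx k - s ` {..<r}"] by (auto simp: lessThan_atLeast0)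
  have pT: "p i \<in> triangle_idx k" "p i \<notin> s ` {..<r}" if "i < n" for i
    using bij_betwE[OF p] that by auto
  define e where "e j = const (1 / ev (triangle_form k (p j)) (node k (p j))) * triangle_form k (p j)" for j
  have "ev (e j) (node k (p i)) = (if i = j then 1 else 0)" if "i < n" "j < n" for i j
  proof (cases "i = j")
    case True
    then show ?thesis using ev_triangle_form_diag[of k "p j"] by (simp add: e_def)
  next
    case False
    then have "p j \<noteq> p i" using p that by (auto simp: bij_betw_def inj_on_def)
    then show ?thesis using ev_triangle_form_off[of "p i" k "p j"] pT(1)[OF that(1)] False by (simp add: e_def)
  qed
  moreover have "ev (triangle_form k (s l)) (node k (p i)) = 0" if "i < n" "l < r" for i l
  proof (rule ev_triangle_form_off)
    have "s l \<in> s ` {..<r}" using that(2) by simp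
    then show "s l \<noteq> p i" using pT(2)[OF that(1)] by metis
  qed (rule pT(1)[OF that(1)])
  moreover have "indep r (\<lambda>l. triangle_form k (s l))"
    unfolding indep_def
  proof (intro allI impI)
    fix c l assume c: "lin_comb r c (\<lambda>l. triangle_form k (s l)) = 0" and l: "l < r"
    have "ev (triangle_form k (s l')) (node k (s l)) * c l' = (if l' = l then ev (triangle_form k (s l)) (node k (s l)) * c l else 0)"
      if "l' < r" for l'
    proof (cases "l' = l")
      case False
      then have "s l' \<noteq> s l" using s(1) that l by (auto simp: inj_on_def)
      moreover have "s l \<in> triangle_idx k" using s(2) l by auto
      ultimately show ?thesis using False by (simp add: ev_triangle_form_off)
    qed simp
    then have "ev (lin_comb r c (\<lambda>l. triangle_form k (s l))) (node k (s l)) =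
        (\<Sum>l'<r. if l' = l then ev (triangle_form k (s l)) (node k (s l)) * c l else 0)"
      unfolding ev_lin_comb by (intro sum.cong) auto
    then show "c l = 0" using c l ev_triangle_form_diag[of k "s l"] by simp
  qed
  moreover have "homogeneous k (e j)" if "j < n" for j
    unfolding e_def by (intro homogeneous_const_mult homogeneous_triangle_form pT that)
  moreover have "homogeneous k (triangle_form k (s l))" if "l < r" for l
    by (rule homogeneous_triangle_form) (use s(2) that in auto)
  ultimately show ?thesis using p by blast
qed

lemma generic_basis:
  assumes nr: "n' + r = forms_dim k" and n': "n' \<le> n"
  shows "generic n (\<lambda>v. \<exists>F. vanishing_basis k n' v r F \<and> interpolates k n' v)"
proof -
  have "r \<le> card (triangle_idx k)" using nr by (simp add: card_triangle_idx)
  then obtain S where S: "S \<subseteq> triangle_idx k" "card S = r" by (meson obtain_subset_with_card_n)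
  then have "finite S" using finite_subset finite_triangle_idx by blast
  then obtain s where s: "bij_betw s {..<r} S"
    using ex_bij_betw_nat_finite[of S] S(2) by (auto simp: lessThan_atLeast0)
  then have s': "inj_on s {..<r}" "s ` {..<r} \<subseteq> triangle_idx k" using S(1) by (auto simp: bij_betw_def)
  obtain p e where pe: "\<forall>j<n'. homogeneous k (e j)" "\<forall>l<r. homogeneous k (triangle_form k (s l))"
    "\<forall>i<n'. \<forall>j<n'. ev (e j) (node k (p i)) = (if i = j then 1 else 0)"
    "\<forall>i<n'. \<forall>l<r. ev (triangle_form k (s l)) (node k (p i)) = 0" "indep r (\<lambda>l. triangle_form k (s l))"
    using triangle_example[OF s' nr] by blast
  show ?thesis
    by (rule generic_deformation[OF nr n', where ?v0.0 = "\<lambda>i. node k (p i)" and e = e and f = "\<lambda>l. triangle_form k (s l)"])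
      (use pe in \<open>auto simp: nonzero_tuple_def node_nonzero\<close>)
qed

lemma generic_no_forms:
  assumes "forms_dim k \<le> n"
  shows "generic n (\<lambda>v. graded_piece (tideal n v) k = {0})"
proof (rule generic_mono)
  show "generic n (\<lambda>v. \<exists>F. vanishing_basis k (forms_dim k) v 0 F \<and> interpolates k (forms_dim k) v)"
    by (rule generic_basis) (use assms in auto)
next
  fix v assume nonzero_tuple: "nonzero_tuple n v" and "\<exists>F. vanishing_basis k (forms_dim k) v 0 F \<and> interpolates k (forms_dim k) v"
  then obtain F where "vanishing_basis k (forms_dim k) v 0 F" by blast
  then have "g = 0" if "homogeneous k g" "\<forall>i<n. ev g (v i) = 0" for g
    using that assms unfolding vanishing_basis_def lin_comb_def by fastforce
  then show "graded_piece (tideal n v) k = {0}"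
    unfolding graded_tideal[OF nonzero_tuple] by auto
qed

subsection \<open>The square grid\<close>

text \<open>All lines of the two families through the square grid except the two through p; up to
  scaling, the forms of degree 2 * (d - 1) dual to the d^2 grid points.\<close>

definition grid_form :: "nat \<Rightarrow> nat \<times> nat \<Rightarrow> 3 cpoly" where
  "grid_form d p = (\<Prod>a\<in>{..<d} - {fst p}. line_A d a) * (\<Prod>b\<in>{..<d} - {snd p}. line_B b)"

lemma homogeneous_grid_form:
  assumes "p \<in> {..<d} \<times> {..<d}" shows "homogeneous (2 * (d - 1)) (grid_form d p)"
proof -
  have "homogeneous (card ({..<d} - {fst p}) + card ({..<d} - {snd p})) (grid_form d p)"
    unfolding grid_form_def by (intro homogeneous_mult homogeneous_prod_linear) auto
  then show ?thesis using assms by (auto simp: mult_2)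
qed

lemma ev_grid_form_diag: "ev (grid_form d p) (node d p) \<noteq> 0"
  by (auto simp: grid_form_def ev_lABC)

lemma ev_grid_form_off: "q \<in> {..<d} \<times> {..<d} \<Longrightarrow> p \<noteq> q \<Longrightarrow> ev (grid_form d p) (node d q) = 0"
  by (cases p; cases q) (auto simp: grid_form_def ev_lABC)

text \<open>The forms of two corners are the two families of d parallel lines whose intersections
  are the square grid. The form of the third corner consists of the diagonals, which meet the grid
  in the nodes with 0 < i + j and i + j at most d.\<close>

lemma triangle_form_corners:
  "triangle_form d (d, 0) = (\<Prod>a<d. line_A d a)" "triangle_form d (0, d) = (\<Prod>b<d. line_B b)" "triangle_form d (0, 0) = (\<Prod>c\<in>{0<..d}. line_C d c)"
  by (simp_all add: triangle_form_def)

lemma ev_corners_grid: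
  assumes "q \<in> {..<d} \<times> {..<d}"
  shows "ev (triangle_form d (d, 0)) (node d q) = 0" "ev (triangle_form d (0, d)) (node d q) = 0"
  using assms by (auto simp: triangle_form_corners ev_lABC)

text \<open>By the shear the second coordinate is the number with base-d digits fst p and snd p. Its
  injectivity on the grid gives the eliminant of the example distinct roots.\<close>

lemma second_coordinate_inj:
  assumes "p \<in> {..<d} \<times> {..<d}" "q \<in> {..<d} \<times> {..<d}" "node d p $ 2 = node d q $ 2"
  shows "p = q"
proof -
  have "of_nat (fst p + d * snd p) = (of_nat (fst q + d * snd q) :: complex)"
    using assms(3) by (simp add: node_def vector_3)
  then have eq: "fst p + d * snd p = fst q + d * snd q" by (simp only: of_nat_eq_iff)
  have "(fst p + d * snd p) mod d = fst p" "(fst q + d * snd q) mod d = fst q"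
    "(fst p + d * snd p) div d = snd p" "(fst q + d * snd q) div d = snd q"
    using assms(1,2) by auto
  then show ?thesis using eq by (metis prod_eqI)
qed

text \<open>The coefficient in degree k is the value at q, which is the point of the line at t =
  infinity; if it is nonzero, the restriction has full degree.\<close>

lemma form_on_line:
  assumes "homogeneous k f"
  shows "\<exists>P. degree P \<le> k \<and> coeff P k = ev f q \<and> (\<forall>t. poly P t = ev f (p + t *s q))"
  using assms
proof (induction k arbitrary: f)
  case 0
  then obtain c where f: "f = const c" using hom0_const by blast
  show ?case by (rule exI[of _ "[:c:]"]) (simp add: f)
next
  case (Suc k)
  obtain g where g: "\<forall>i. homogeneous k (g i)" "f = (\<Sum>i\<in>UNIV. var i * g i)"
    using hom_Suc_decomp[OF Suc.prems] by blast
  have "\<forall>i. \<exists>P. degree P \<le> k \<and> coeff P k = ev (g i) q \<and> (\<forall>t. poly P t = ev (g i) (p + t *s q))"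
    using Suc.IH g(1) by blast
  then obtain P where P: "\<And>i. degree (P i) \<le> k" "\<And>i. coeff (P i) k = ev (g i) q"
     "\<And>i t. poly (P i) t = ev (g i) (p + t *s q)" by metis
  define Q where "Q = (\<Sum>i\<in>UNIV. [:p $ i, q $ i:] * P i)"
  have "degree ([:p $ i, q $ i:] * P i) \<le> Suc k" for i
    using degree_mult_le[of "[:p $ i, q $ i:]" "P i"] P(1)[of i] by (auto split: if_splits)
  then have "degree Q \<le> Suc k" unfolding Q_def by (intro degree_sum_le) auto
  moreover have "coeff Q (Suc k) = ev f q"
    unfolding Q_def coeff_sum g(2) poly_eval_sum
    by (rule sum.cong) (use P(1) in \<open>auto simp: P(2) coeff_eq_0 le_imp_less_Suc\<close>)
  moreover have "poly Q t = ev f (p + t *s q)" for t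
    unfolding Q_def poly_sum g(2) poly_eval_sum by (rule sum.cong) (auto simp: P(3) distrib_right)
  ultimately show ?case by blast
qed

text \<open>Restricted to a line of the first family, a form of degree below d has too many zeros.\<close>

lemma grid_syzygy:
  assumes d: "d > 0" and ab: "homogeneous (d - 1) a" "homogeneous (d - 1) b"
    and eq: "a * triangle_form d (d, 0) + b * triangle_form d (0, d) = 0"
  shows "a = 0 \<and> b = 0"
proof -
  let ?F = "triangle_form d (d, 0)" and ?G = "triangle_form d (0, d)"
  \<comment> \<open>At height z none of the lines in ?G vanishes, while ?F vanishes at the d points
    with unsheared first coordinate 0, ..., d - 1. There b must vanish, but its restriction has
    degree at most d - 1.\<close>
  have zero: "ev b (vector [1, y, z]) = 0" if z: "z \<notin> of_nat ` {..<d}" for y z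
  proof -
    obtain P where P: "degree P \<le> d - 1"
      "\<And>t. poly P t = ev b (vector [1, of_nat d * z, z] + t *s vector [0, 1, 0])"
      using form_on_line[OF ab(2), of "vector [0, 1, 0]" "vector [1, of_nat d * z, z]"] by blast
    have v: "vector [1, of_nat d * z, z] + t *s vector [0, 1, 0] = (vector [1, of_nat d * z + t, z] :: complex ^ 3)" for t
      by (simp add: Finite_Cartesian_Product.vec_eq_iff forall_3 vector_3)
    have "poly P (of_nat a') = 0" if "a' < d" for a'
    proof -
      let ?v = "vector [1, of_nat d * z + of_nat a', z] :: complex ^ 3"
      have "ev (a * ?F + b * ?G) ?v = 0" unfolding eq by simp
      moreover have "ev ?F ?v = 0"
        using that by (auto simp: triangle_form_corners line_A_def ev_linear_form vector_3)
      moreover have "ev ?G ?v \<noteq> 0"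
        using z by (auto simp: triangle_form_corners line_B_def ev_linear_form vector_3)
      ultimately show ?thesis unfolding P(2) v by simp
    qed
    then have "of_nat ` {..<d} \<subseteq> {t. poly P t = 0}" by auto
    moreover have "card (of_nat ` {..<d} :: complex set) = d" by (subst card_image) (auto simp: inj_on_def)
    ultimately have "P = 0"
      using poly_roots_degree[of P] poly_roots_finite[of P] P(1) d card_mono
      by (metis Suc_pred' leD le_imp_less_Suc order.trans)
    then show ?thesis using P(2)[of "y - of_nat d * z"] unfolding v by simp
  qed
  \<comment> \<open>The extra factors leave only points with nonzero first coordinate off the lines
    in ?G, which can be scaled to the form treated by \<open>zero\<close>.\<close>
  have "b * (var 1 * ?G) = 0"
  proof (rule ev_eq_0)
    fix v
    show "ev (b * (var 1 * ?G)) v = 0"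
    proof (cases "v $ 1 = 0 \<or> ev ?G v = 0")
      case False
      define w :: "complex ^ 3" where "w = vector [1, v $ 2 / v $ 1, v $ 3 / v $ 1]"
      have vw: "v = v $ 1 *s w"
        using False by (simp add: w_def Finite_Cartesian_Product.vec_eq_iff forall_3 vector_3)
      have "v $ 3 / v $ 1 \<notin> of_nat ` {..<d}"
        using False by (auto simp: triangle_form_corners line_B_def ev_linear_form vector_3 field_simps)
      then have "ev b w = 0" unfolding w_def by (rule zero)
      then have "ev b v = 0" using ev_hom_scale[OF ab(2), of "v $ 1" w] vw by simp
      then show ?thesis by simp
    qed auto
  qed
  moreover have G0: "?G \<noteq> 0" using ev_triangle_form_diag[of d "(0, d)"] by auto
  ultimately have b: "b = 0" using var_nonzero[of 1] by (auto simp only: mult_eq_0_iff)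
  have "?F \<noteq> 0" using ev_triangle_form_diag[of d "(d, 0)"] by auto
  moreover have "a * ?F = 0" using eq unfolding b by simp
  ultimately show ?thesis using b by (auto simp only: mult_eq_0_iff)
qed

section \<open>Division by linear forms\<close>

text \<open>Division with remainder by \<open>var i - t\<close>. The remainder is f with t
  substituted for the variable; describing it by its values avoids a separate substitution
  operation.\<close>

lemma divide_by_variable:
  "\<exists>f' f0. f = (var i - t) * f' + f0 \<and>
     (\<forall>a. poly_eval f0 a = poly_eval f (a(i := poly_eval t a)))"
proof (induction f rule: cpoly_induct)
  case (const c)
  show ?case by (rule exI[of _ 0], rule exI[of _ "const c"]) simp
next
  case (var x)
  show ?case
  proof (cases "x = i")
    case True
    then show ?thesis by (intro exI[of _ 1] exI[of _ t]) simp
  next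
    case False
    then show ?thesis by (intro exI[of _ 0] exI[of _ "var x"]) simp
  qed
next
  case (add f g)
  then obtain f' f0 g' g0 where fg: "f = (var i - t) * f' + f0" "g = (var i - t) * g' + g0"
    "\<forall>a. poly_eval f0 a = poly_eval f (a(i := poly_eval t a))"
    "\<forall>a. poly_eval g0 a = poly_eval g (a(i := poly_eval t a))" by blast
  have "f + g = (var i - t) * (f' + g') + (f0 + g0)"
    by (subst fg(1), subst fg(2)) (simp add: algebra_simps)
  moreover have "\<forall>a. poly_eval (f0 + g0) a = poly_eval (f + g) (a(i := poly_eval t a))"
    using fg(3,4) by simp
  ultimately show ?case by blast
next
  case (mult f g)
  then obtain f' f0 g' g0 where fg: "f = (var i - t) * f' + f0" "g = (var i - t) * g' + g0"
    "\<forall>a. poly_eval f0 a = poly_eval f (a(i := poly_eval t a))"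
    "\<forall>a. poly_eval g0 a = poly_eval g (a(i := poly_eval t a))" by blast
  define l where "l = var i - t"
  have "f * g = l * (f' * g + f0 * g') + f0 * g0"
  proof -
    have "f * g = (l * f' + f0) * g" by (simp only: l_def fg(1)[symmetric])
    also have "\<dots> = l * (f' * g) + f0 * (l * g' + g0)"
      by (simp only: distrib_right mult.assoc l_def fg(2)[symmetric])
    also have "\<dots> = l * (f' * g + f0 * g') + f0 * g0"
      by (simp only: distrib_left mult.left_commute add.assoc)
    finally show ?thesis .
  qed
  moreover have "\<forall>a. poly_eval (f0 * g0) a = poly_eval (f * g) (a(i := poly_eval t a))"
    using fg(3,4) by simp
  ultimately have "f * g = l * (f' * g + f0 * g') + f0 * g0 \<and>
      (\<forall>a. poly_eval (f0 * g0) a = poly_eval (f * g) (a(i := poly_eval t a)))" by (rule conjI)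
  then show ?case unfolding l_def by (intro exI)
qed

text \<open>By the first assumption t does not involve the variable i, so replacing the i-th
  coordinate of v by the value of t gives a point where \<open>var i - t\<close> vanishes. The
  factor \<open>var j\<close> in the proof allows the vanishing of f to be checked only where the
  j-th coordinate is nonzero.\<close>

lemma var_diff_dvd:
  fixes t :: "3 cpoly"
  assumes tt: "\<And>a b. (\<forall>j. j \<noteq> i \<longrightarrow> a j = b j) \<Longrightarrow> poly_eval t a = poly_eval t b"
    and j: "j \<noteq> i"
    and van: "\<And>v. v $ i = ev t v \<Longrightarrow> v $ j \<noteq> 0 \<Longrightarrow> ev f v = 0"
  shows "\<exists>f'. f = (var i - t) * f'"
proof -
  obtain f' f0 where f: "f = (var i - t) * f' + f0"
     "\<And>a. poly_eval f0 a = poly_eval f (a(i := poly_eval t a))"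
    using divide_by_variable by metis
  have "var j * f0 = 0"
  proof (rule ev_eq_0)
    fix v :: "complex ^ 3"
    define w :: "complex ^ 3" where "w = (\<chi> l. if l = i then ev t v else v $ l)"
    have w: "($) w = (($) v)(i := ev t v)" by (auto simp: w_def)
    have "ev t w = ev t v" by (rule tt) (simp add: w_def)
    then have "v $ j \<noteq> 0 \<Longrightarrow> ev f w = 0" by (intro van) (use j in \<open>auto simp: w_def\<close>)
    then show "ev (var j * f0) v = 0" unfolding w using f(2) by auto
  qed
  then have "f0 = 0" using var_nonzero[of j] by (auto simp only: mult_eq_0_iff)
  then show ?thesis using f(1) by (intro exI[of _ f']) simp
qed

lemma var1_dvd:
  assumes f: "homogeneous k f" and van: "\<And>z. ev f (vector [0, 1, z]) = 0"
  shows "\<exists>f'. f = var 1 * f'"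
proof -
  have "\<exists>f'. f = (var 1 - 0) * f'"
  proof (rule var_diff_dvd[of _ _ 2])
    fix v :: "complex ^ 3" assume v: "v $ 1 = ev 0 v" "v $ 2 \<noteq> 0"
    have "v = v $ 2 *s vector [0, 1, v $ 3 / v $ 2]"
      using v by (simp add: Finite_Cartesian_Product.vec_eq_iff forall_3 vector_3)
    then show "ev f v = 0" using ev_hom_scale[OF f, of "v $ 2"] van by (metis mult_zero_right)
  qed auto
  then show ?thesis by simp
qed

lemma var2_diff_dvd:
  assumes f: "homogeneous k f" and van: "\<And>z. ev f (vector [1, s, z]) = 0"
  shows "\<exists>f'. f = (var 2 - const s * var 1) * f'"
proof (rule var_diff_dvd[of _ _ 1])
  fix v :: "complex ^ 3" assume v: "v $ 2 = ev (const s * var 1) v" "v $ 1 \<noteq> 0"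
  have "v = v $ 1 *s vector [1, s, v $ 3 / v $ 1]"
    using v by (simp add: Finite_Cartesian_Product.vec_eq_iff forall_3 vector_3)
  then show "ev f v = 0" using ev_hom_scale[OF f, of "v $ 1"] van by (metis mult_zero_right)
qed auto

lemma hom_factor:
  assumes l: "homogeneous (Suc 0) l" and f: "homogeneous (Suc k) f" and fl: "f = l * f'"
  shows "\<exists>f''. homogeneous k f'' \<and> f = l * f''"
proof -
  have "f = hom_part (Suc k) (l * f')" using hom_part_homogeneous[OF f, of "Suc k"] fl by simp
  also have "\<dots> = l * hom_part k f'" using hom_part_mult[OF l, of "Suc k" f'] by simp
  finally show ?thesis by (intro exI[of _ "hom_part k f'"]) simp
qed

lemma hom0_factor:
  assumes l: "homogeneous (Suc 0) l" and f: "homogeneous 0 f" and fl: "f = l * f'"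
  shows "f = 0"
proof -
  have "f = hom_part 0 (l * f')" using hom_part_homogeneous[OF f, of 0] fl by simp
  also have "\<dots> = 0" using hom_part_mult[OF l, of 0 f'] by simp
  finally show ?thesis .
qed

subsection \<open>Square families of forms\<close>

text \<open>All products of F and G with monomials of degree d - 1, followed by l times candidates e
  for a basis of degree 2 * d - 2 modulo (F, G). Since it has as many members as there are monomials
  of degree 2 * d - 1, independence is a determinant condition; it says that there are no syzygies
  of F and G in degree d - 1 and that the l * e i form a basis modulo (F, G).\<close>

definition square_family :: "nat \<Rightarrow> 3 cpoly \<Rightarrow> 3 cpoly \<Rightarrow> 3 cpoly \<Rightarrow> (nat \<Rightarrow> 3 cpoly) \<Rightarrow> nat \<Rightarrow> 3 cpoly" where
  "square_family d l F G e i =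
     (if i < forms_dim (d - 1) then monomial_form (d - 1) i * F
      else if i < 2 * forms_dim (d - 1) then monomial_form (d - 1) (i - forms_dim (d - 1)) * G
      else l * e (i - 2 * forms_dim (d - 1)))"

lemma forms_dim_square_family: "d > 0 \<Longrightarrow> forms_dim (2 * d - 1) = forms_dim (d - 1) + forms_dim (d - 1) + d\<^sup>2"
proof -
  assume "d > 0"
  then obtain k where d: "d = Suc k" by (cases d) auto
  have "2 * d - 1 + 2 = 2 * k + 3" "2 * k + 3 - 1 = 2 * k + 2" using d by simp_all
  then have "forms_dim (2 * d - 1) = (2 * k + 3) * (2 * k + 2) div 2" by (simp only: choose_two)
  also have "\<dots> = (2 * k + 3) * (k + 1)"
  proof -
    have "(2 * k + 3) * (2 * k + 2) = 2 * ((2 * k + 3) * (k + 1))" 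
    proof -
      have "2 * k + 2 = 2 * (k + 1)" by simp
      then show ?thesis by (simp only: mult.left_commute)
    qed
    then show ?thesis by (simp only: nonzero_mult_div_cancel_left[OF zero_neq_numeral[symmetric]])
  qed
  finally have 1: "forms_dim (2 * d - 1) = (2 * k + 3) * (k + 1)" .
  have "forms_dim (d - 1) = (k + 2) * (k + 1) div 2" using d by (simp add: choose_two)
  moreover have "even ((k + 2) * (k + 1))" by simp
  ultimately have "forms_dim (d - 1) + forms_dim (d - 1) = (k + 2) * (k + 1)" by (metis dvd_mult_div_cancel mult_2)
  moreover have "(2 * k + 3) * (k + 1) = (k + 2) * (k + 1) + (Suc k)\<^sup>2"
    by (simp add: power2_eq_square distrib_left distrib_right)
  ultimately show ?thesis using 1 d by simp
qed

lemma three_blocks: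
  fixes i :: nat
  assumes "i < N + N + m"
  obtains "i < N" | j where "j < N" "i = N + j" | j where "j < m" "i = N + N + j"
proof -
  consider "i < N" | "N \<le> i" "i < N + N" | "N + N \<le> i" by linarith
  then show thesis
  proof cases
    case 2
    then show thesis using that(2)[of "i - N"] by auto
  next
    case 3
    then show thesis using that(3)[of "i - (N + N)"] assms by auto
  qed (rule that(1))
qed

lemma square_family_split:
  "i < forms_dim (d - 1) \<Longrightarrow> square_family d l F G e i = monomial_form (d - 1) i * F"
  "i < forms_dim (d - 1) \<Longrightarrow> square_family d l F G e (forms_dim (d - 1) + i) = monomial_form (d - 1) i * G"
  "square_family d l F G e (forms_dim (d - 1) + forms_dim (d - 1) + i) = l * e i"
  unfolding square_family_def mult_2 by simp_all

lemma lin_comb_mult_right: "lin_comb n c (\<lambda>i. P i * F) = lin_comb n c P * F"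
  unfolding lin_comb_def sum_distrib_right mult.assoc ..

lemma lin_comb_mult_left: "lin_comb n c (\<lambda>i. l * P i) = l * lin_comb n c P"
  unfolding lin_comb_def sum_distrib_left by (rule sum.cong) (simp_all only: mult.left_commute)

lemma lin_comb_square_family:
  assumes "d > 0"
  shows "lin_comb (forms_dim (2 * d - 1)) c (square_family d l F G e) =
    lin_comb (forms_dim (d - 1)) c (monomial_form (d - 1)) * F +
    lin_comb (forms_dim (d - 1)) (\<lambda>i. c (forms_dim (d - 1) + i)) (monomial_form (d - 1)) * G +
    l * lin_comb (d\<^sup>2) (\<lambda>i. c (forms_dim (d - 1) + forms_dim (d - 1) + i)) e"
  unfolding forms_dim_square_family[OF assms] lin_comb_Plus
  by (simp only: lin_comb_mult_right[symmetric] lin_comb_mult_left[symmetric])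
    (intro arg_cong2[of _ _ _ _ "(+)"] lin_comb_cong square_family_split refl)

lemma homogeneous_square_family:
  assumes d: "d > 0" and FG: "homogeneous d F" "homogeneous d G" and l: "homogeneous (Suc 0) l"
    and e: "\<And>i. i < d\<^sup>2 \<Longrightarrow> homogeneous (2 * (d - 1)) (e i)" and i: "i < forms_dim (2 * d - 1)"
  shows "homogeneous (2 * d - 1) (square_family d l F G e i)"
proof -
  have h1: "d - 1 + d = 2 * d - 1" "Suc 0 + 2 * (d - 1) = 2 * d - 1" using d by auto
  consider "i < forms_dim (d - 1)" | j where "j < forms_dim (d - 1)" "i = forms_dim (d - 1) + j"
    | j where "j < d\<^sup>2" "i = forms_dim (d - 1) + forms_dim (d - 1) + j"
    using i unfolding forms_dim_square_family[OF d]
    by (rule three_blocks)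
  then show ?thesis
  proof cases
    case 1
    have "homogeneous (d - 1 + d) (monomial_form (d - 1) i * F)" by (intro homogeneous_mult homogeneous_monomial_form FG 1)
    then show ?thesis by (simp only: square_family_split(1)[OF 1] h1)
  next
    case (2 j)
    have "homogeneous (d - 1 + d) (monomial_form (d - 1) j * G)" by (intro homogeneous_mult homogeneous_monomial_form FG 2)
    then show ?thesis by (simp only: 2(2) square_family_split(2)[OF 2(1)] h1)
  next
    case (3 j)
    have "homogeneous (Suc 0 + 2 * (d - 1)) (l * e j)" by (intro homogeneous_mult l e 3)
    then show ?thesis by (simp only: 3(2) square_family_split(3) h1)
  qed
qed

lemma monomial_form_rep:
  assumes "homogeneous k a" shows "a = lin_comb (forms_dim k) (\<lambda>j. Poly_Mapping.lookup a (nth_monomial k j)) (monomial_form k)"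
  using hom_expand[OF assms] by (simp add: lin_comb_def)

lemma monomial_form_indep:
  assumes "lin_comb (forms_dim k) c (monomial_form k) = 0" "i < forms_dim k" shows "c i = 0"
proof -
  have inj: "inj_on (nth_monomial k) {..<forms_dim k}" using bij_nth_monomial bij_betw_def by blast
  have "Poly_Mapping.lookup (lin_comb (forms_dim k) c (monomial_form k)) (nth_monomial k i) = (\<Sum>j<forms_dim k. if j = i then c i else 0)"
    unfolding lookup_lin_comb
    by (rule sum.cong) (use inj assms(2) in \<open>auto simp: monomial_form_def lookup_single when_def inj_on_def\<close>)
  then show ?thesis using assms by simp
qed

text \<open>Collecting the coefficients of the first two blocks into forms a and b frees the
  condition from the enumeration of monomials.\<close>

lemma indep_square_family_iff:
  assumes d: "d > 0"
  shows "indep (forms_dim (2 * d - 1)) (square_family d l F G e) \<longleftrightarrow>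
    (\<forall>a b c. homogeneous (d - 1) a \<longrightarrow> homogeneous (d - 1) b \<longrightarrow> a * F + b * G + l * lin_comb (d\<^sup>2) c e = 0 \<longrightarrow>
       a = 0 \<and> b = 0 \<and> (\<forall>i<d\<^sup>2. c i = 0))" (is "?L \<longleftrightarrow> ?R")
proof
  assume L: ?L
  show ?R
  proof (intro allI impI)
    fix a b c assume a: "homogeneous (d - 1) a" and b: "homogeneous (d - 1) b"
      and eq: "a * F + b * G + l * lin_comb (d\<^sup>2) c e = 0"
    define M where "M = forms_dim (d - 1)"
    define C where "C i = (if i < M then Poly_Mapping.lookup a (nth_monomial (d - 1) i)
      else if i < M + M then Poly_Mapping.lookup b (nth_monomial (d - 1) (i - M)) else c (i - (M + M)))" for i
    have 1: "lin_comb M C (monomial_form (d - 1)) = a"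
      by (rule trans[OF _ monomial_form_rep[OF a, symmetric]]) (auto intro!: lin_comb_cong simp: C_def M_def)
    have 2: "lin_comb M (\<lambda>i. C (M + i)) (monomial_form (d - 1)) = b"
      by (rule trans[OF _ monomial_form_rep[OF b, symmetric]]) (auto intro!: lin_comb_cong simp: C_def M_def)
    have 3: "lin_comb (d\<^sup>2) (\<lambda>i. C (M + M + i)) e = lin_comb (d\<^sup>2) c e"
      by (rule lin_comb_cong) (auto simp: C_def)
    have "lin_comb (forms_dim (2 * d - 1)) C (square_family d l F G e) = 0"
      unfolding lin_comb_square_family[OF d] M_def[symmetric] 1 2 3 by (rule eq)
    then have C: "C i = 0" if "i < M + M + d\<^sup>2" for i
      using L that unfolding indep_def forms_dim_square_family[OF d] M_def by blast
    have "a = 0" unfolding 1[symmetric] by (rule lin_comb_0) (use C in auto)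
    moreover have "b = 0" unfolding 2[symmetric] by (rule lin_comb_0) (use C in auto)
    moreover have "c i = 0" if "i < d\<^sup>2" for i using C[of "M + M + i"] that by (simp add: C_def)
    ultimately show "a = 0 \<and> b = 0 \<and> (\<forall>i<d\<^sup>2. c i = 0)" by blast
  qed
next
  assume R: ?R
  show ?L
    unfolding indep_def
  proof (intro allI impI)
    fix c i assume c: "lin_comb (forms_dim (2 * d - 1)) c (square_family d l F G e) = 0" and i: "i < forms_dim (2 * d - 1)"
    have h: "homogeneous (d - 1) (lin_comb (forms_dim (d - 1)) c' (monomial_form (d - 1)))" for c'
      by (intro homogeneous_lin_comb homogeneous_monomial_form)
    have R': "lin_comb (forms_dim (d - 1)) c (monomial_form (d - 1)) = 0 \<and>
      lin_comb (forms_dim (d - 1)) (\<lambda>i. c (forms_dim (d - 1) + i)) (monomial_form (d - 1)) = 0 \<and>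
      (\<forall>i<d\<^sup>2. c (forms_dim (d - 1) + forms_dim (d - 1) + i) = 0)"
      using R[rule_format, OF h h c[unfolded lin_comb_square_family[OF d]]] by blast
    consider "i < forms_dim (d - 1)" | j where "j < forms_dim (d - 1)" "i = forms_dim (d - 1) + j"
      | j where "j < d\<^sup>2" "i = forms_dim (d - 1) + forms_dim (d - 1) + j"
      using i unfolding forms_dim_square_family[OF d]
      by (rule three_blocks)
    then show "c i = 0"
    proof cases
      case 1
      then show ?thesis using R' monomial_form_indep by blast
    next
      case 2
      then show ?thesis using R' monomial_form_indep[of "d - 1" "\<lambda>i. c (forms_dim (d - 1) + i)"] by blast
    next
      case 3
      then show ?thesis using R' by blast
    qed
  qed
qed

subsection \<open>Complete intersections of two curves of degree d\<close>

text \<open>The Koszul syzygy with coefficient c cancels, and the factor x comes out. Used to divide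
  a relation by X once it is known to be Koszul modulo X.\<close>

lemma syzygy_expand:
  fixes c :: "'a::comm_ring_1"
  shows "(- c * G + x * a) * F + (c * F + x * b) * G = x * (a * F + b * G)"
proof -
  have "(- c * G + x * a) * F + (c * F + x * b) * G =
      (- (c * G * F) + x * a * F) + (c * F * G + x * b * G)"
    by (simp only: distrib_right mult_minus_left)
  also have "c * F * G = c * G * F" by (simp only: mult.assoc mult.commute[of F])
  also have "(- (c * G * F) + x * a * F) + (c * G * F + x * b * G) = x * a * F + x * b * G"
    by (simp only: add.assoc add.left_commute[of _ "c * G * F"] minus_add_cancel add_minus_cancel)
  finally show ?thesis by (simp only: distrib_left mult.assoc)
qed

lemma neg_combination:
  fixes b :: "'a::comm_ring_1"
  assumes "- b = c * F + x * b'" shows "b = - (F * c + x * b')"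
  using assms by (metis minus_minus mult.commute)

lemma mult_neg_eq:
  fixes a :: "'a::comm_ring_1"
  shows "a * F = b * G \<longleftrightarrow> a * F + (- b) * G = 0"
  by (simp only: mult_minus_left diff_conv_add_uminus[symmetric] eq_iff_diff_eq_0[symmetric])

text \<open>Both nondegeneracy conditions are open: the independence is a nonvanishing determinant,
  and \<open>F_monic\<close> keeps (0, 0, 1) off the first curve. That F, G is a regular sequence
  and that X is a nonzerodivisor modulo (F, G) are conclusions.\<close>

locale plane_ci =
  fixes d :: nat and F G :: "3 cpoly" and e :: "nat \<Rightarrow> 3 cpoly"
  assumes d_pos: "d > 0"
    and hom_F: "homogeneous d F" and hom_G: "homogeneous d G"
    and hom_e: "\<And>i. i < d\<^sup>2 \<Longrightarrow> homogeneous (2 * (d - 1)) (e i)"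
    and indep_X: "indep (forms_dim (2 * d - 1)) (square_family d (var 1) F G e)"
    and F_monic: "ev F (vector [0, 0, 1]) \<noteq> 0"
begin

lemma in_FG: "f \<in> ideal_gen {F, G} \<longleftrightarrow> (\<exists>a b. f = a * F + b * G)"
  by (auto simp: ideal_gen_pair)

lemma hom_in_FG:
  assumes "f \<in> ideal_gen {F, G}" "homogeneous (k + d) f"
  shows "\<exists>a b. homogeneous k a \<and> homogeneous k b \<and> f = a * F + b * G"
proof -
  obtain a b where f: "f = a * F + b * G" using assms(1) in_FG by blast
  have "f = hom_part (k + d) f" using hom_part_homogeneous[OF assms(2)] by simp
  also have "\<dots> = hom_part (k + d) (F * a) + hom_part (k + d) (G * b)"
    unfolding f by (simp add: hom_part_add mult.commute)
  also have "\<dots> = hom_part k a * F + hom_part k b * G"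
    by (simp add: hom_part_mult[OF hom_F] hom_part_mult[OF hom_G] mult.commute)
  finally show ?thesis by (intro exI[of _ "hom_part k a"] exI[of _ "hom_part k b"]) simp
qed

lemma hom_low_FG:
  assumes "f \<in> ideal_gen {F, G}" "homogeneous j f" "j < d"
  shows "f = 0"
proof -
  obtain a b where f: "f = a * F + b * G" using assms(1) in_FG by blast
  have "f = hom_part j f" using hom_part_homogeneous[OF assms(2)] by simp
  also have "\<dots> = hom_part j (F * a) + hom_part j (G * b)"
    unfolding f by (simp add: hom_part_add mult.commute)
  also have "\<dots> = 0" using assms(3) by (simp add: hom_part_mult[OF hom_F] hom_part_mult[OF hom_G])
  finally show ?thesis .
qed

lemma spans_X:
  assumes "homogeneous (2 * d - 1) f"
  shows "\<exists>g c. g \<in> ideal_gen {F, G} \<and> f = g + var 1 * lin_comb (d\<^sup>2) c e"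
proof -
  have "spans (2 * d - 1) (forms_dim (2 * d - 1)) (square_family d (var 1) F G e)"
    by (rule indep_spans[OF _ indep_X]) (intro homogeneous_square_family d_pos hom_F hom_G homogeneous_var hom_e)
  then obtain c where "f = lin_comb (forms_dim (2 * d - 1)) c (square_family d (var 1) F G e)"
    using assms unfolding spans_def by blast
  then show ?thesis unfolding lin_comb_square_family[OF d_pos] in_FG by blast
qed

text \<open>Multiplying a combination of the e by any variable gives degree 2 * d - 1, where modulo
  (F, G) it is again X times a combination of the e. So in each degree 2 * d - 1 + j the quotient is
  spanned by the d^2 forms X^(j+1) * e i.\<close>

lemma spans_X_power:
  assumes "homogeneous (2 * d - 1 + j) f"
  shows "\<exists>g c. g \<in> ideal_gen {F, G} \<and> f = g + var 1 ^ Suc j * lin_comb (d\<^sup>2) c e"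
  using assms
proof (induction j arbitrary: f)
  case 0
  then show ?case using spans_X by simp
next
  case (Suc j)
  obtain h where h: "\<And>i. homogeneous (2 * d - 1 + j) (h i)" "f = (\<Sum>i\<in>UNIV. var i * h i)"
    using hom_Suc_decomp[of "2 * d - 1 + j" f] Suc.prems by auto
  have "\<forall>i. \<exists>g c. g \<in> ideal_gen {F, G} \<and> h i = g + var 1 ^ Suc j * lin_comb (d\<^sup>2) c e"
    using Suc.IH h(1) by blast
  then obtain g c where gc: "\<And>i. g i \<in> ideal_gen {F, G}" "\<And>i. h i = g i + var 1 ^ Suc j * lin_comb (d\<^sup>2) (c i) e"
    by metis
  define q where "q = (\<Sum>i\<in>UNIV. var i * lin_comb (d\<^sup>2) (c i) e)"
  have "homogeneous (Suc 0 + 2 * (d - 1)) q"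
    unfolding q_def by (intro homogeneous_sum homogeneous_mult homogeneous_var homogeneous_lin_comb hom_e)
  moreover have "Suc 0 + 2 * (d - 1) = 2 * d - 1" using d_pos by simp
  ultimately obtain g' c' where q: "g' \<in> ideal_gen {F, G}" "q = g' + var 1 * lin_comb (d\<^sup>2) c' e"
    using spans_X[of q] by auto
  have "f = (\<Sum>i\<in>UNIV. var i * g i) + var 1 ^ Suc j * q"
    unfolding h(2) gc(2) q_def sum_distrib_left
    by (simp only: distrib_left sum.distrib mult.left_commute)
  also have "var 1 ^ Suc j * q = var 1 ^ Suc j * g' + var 1 ^ Suc (Suc j) * lin_comb (d\<^sup>2) c' e"
    unfolding q(2) by (simp only: distrib_left power_Suc2 mult.assoc)
  finally have f: "f = ((\<Sum>i\<in>UNIV. var i * g i) + var 1 ^ Suc j * g') + var 1 ^ Suc (Suc j) * lin_comb (d\<^sup>2) c' e"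
    by (simp only: add.assoc)
  have "(\<Sum>i\<in>UNIV. var i * g i) + var 1 ^ Suc j * g' \<in> ideal_gen {F, G}"
    by (intro ideal_gen_add ideal_gen_sum ideal_gen_mult gc(1) q(1))
  then show ?case using f by blast
qed

lemma vector_line: "vector [x, y, 0] + t *s vector [0, 0, 1] = (vector [x, y, t] :: complex ^ 3)"
  by (simp add: Finite_Cartesian_Product.vec_eq_iff forall_3 vector_3)

lemma on_line:
  assumes "homogeneous k f"
  shows "\<exists>P. degree P \<le> k \<and> coeff P k = ev f (vector [0, 0, 1]) \<and> (\<forall>t. poly P t = ev f (vector [x, y, t]))"
  using form_on_line[OF assms, of "vector [0, 0, 1]" "vector [x, y, 0]"] unfolding vector_line .

lemma coprime_if_no_common_root:
  fixes p q :: "complex poly"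
  assumes "p \<noteq> 0" "\<And>z. poly p z = 0 \<Longrightarrow> poly q z = 0 \<Longrightarrow> False"
  shows "coprime p q"
proof (rule ccontr)
  assume "\<not> coprime p q"
  moreover have g: "gcd p q \<noteq> 0" using assms(1) by simp
  ultimately have "degree (gcd p q) \<noteq> 0"
    using is_unit_iff_degree[OF g] is_unit_gcd_iff[of p q] by (metis coprime_iff_gcd_eq_1)
  then have "\<not> constant (poly (gcd p q))" by (simp add: constant_degree)
  then obtain z where "poly (gcd p q) z = 0" using fundamental_theorem_of_algebra by blast
  then have "poly p z = 0" "poly q z = 0"
    by (meson dvd_trans gcd_dvd1 gcd_dvd2 poly_eq_0_iff_dvd)+
  then show False using assms(2) by blast
qed

text \<open>The power of Y in degree 2 * d - 1 lies in (F, G, X), so it would vanish at the common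
  zero, where its value is 1.\<close>

lemma no_common_zero_at_infinity:
  assumes "ev F (vector [0, 1, z]) = 0" "ev G (vector [0, 1, z]) = 0" shows False
proof -
  have "homogeneous (2 * d - 1) (var 2 ^ (2 * d - 1))" by (rule hom_var_power)
  then obtain g c where g: "g \<in> ideal_gen {F, G}" "var 2 ^ (2 * d - 1) = g + var 1 * lin_comb (d\<^sup>2) c e"
    using spans_X by blast
  have "ev g (vector [0, 1, z]) = 0" using g(1) assms by (auto simp: in_FG)
  moreover have "ev (var 2 ^ (2 * d - 1)) (vector [0, 1, z]) = 1" by (simp add: vector_3)
  ultimately show False unfolding g(2) by (simp add: vector_3)
qed

text \<open>On the line X = 0 the forms F and G become coprime polynomials p and q in z, so every
  relation between them is a multiple of the trivial one; lifting the multiplier r to a form c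
  leaves differences divisible by X.\<close>

lemma syzygy_mod_X:
  assumes ab: "homogeneous k a" "homogeneous k b"
    and van: "\<And>z. ev (a * F + b * G) (vector [0, 1, z]) = 0"
  shows "\<exists>c a' b'. a = - c * G + var 1 * a' \<and> b = c * F + var 1 * b'"
proof -
  obtain p where p: "degree p \<le> d" "coeff p d = ev F (vector [0, 0, 1])" "\<And>z. poly p z = ev F (vector [0, 1, z])"
    using on_line[OF hom_F, of 0 1] by blast
  obtain q where q: "\<And>z. poly q z = ev G (vector [0, 1, z])"
    using on_line[OF hom_G, of 0 1] by blast
  obtain u where u: "\<And>z. poly u z = ev a (vector [0, 1, z])"
    using on_line[OF ab(1), of 0 1] by blast
  obtain w where w: "degree w \<le> k" "\<And>z. poly w z = ev b (vector [0, 1, z])"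
    using on_line[OF ab(2), of 0 1] by blast
  have dp: "degree p = d" using p(1,2) F_monic le_degree[of p d] by simp
  have p0: "p \<noteq> 0" using p(2) F_monic by auto
  have "coprime p q"
    by (rule coprime_if_no_common_root[OF p0]) (use no_common_zero_at_infinity p(3) q in metis)
  moreover have eq: "u * p + w * q = 0"
  proof -
    have "poly (u * p + w * q) = poly 0" using van by (auto simp: p q u w)
    then show ?thesis by (simp only: poly_eq_poly_eq_iff)
  qed
  ultimately have "p dvd w"
    by (metis coprime_dvd_mult_left_iff dvd_add_right_iff dvd_0_right dvd_triv_right)
  then obtain r where r: "w = p * r" by blast
  have ur: "u = - r * q"
  proof -
    have "p * (u + r * q) = 0" using eq unfolding r by (simp only: distrib_left mult_ac)
    then have "u + r * q = 0" using p0 by simp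
    then show ?thesis by (simp add: eq_neg_iff_add_eq_0)
  qed
  have rdeg: "r = 0 \<or> degree r + d \<le> k"
    using w(1) dp p0 degree_mult_eq[of p r] unfolding r by (cases "r = 0") auto
  \<comment> \<open>The homogenisation of r in degree k - d. The case r = 0 is separate because k
    may then be smaller than d.\<close>
  define c :: "3 cpoly" where "c = (if r = 0 then 0 else \<Sum>j\<le>degree r. const (coeff r j) * (var 2 ^ (k - d - j) * var 3 ^ j))"
  have evc: "ev c (vector [0, 1, z]) = poly r z" for z
    by (simp add: c_def vector_3 poly_altdef)
  have homc: "homogeneous k (c * H)" if H: "homogeneous d H" for H
  proof -
    have "homogeneous (k - d) c \<and> (r \<noteq> 0 \<longrightarrow> d \<le> k)"
    proof (cases "r = 0")
      case False
      have "homogeneous (k - d - j + j) (var 2 ^ (k - d - j) * var 3 ^ j)" for j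
        by (intro homogeneous_mult hom_var_power)
      then have "homogeneous (k - d) (const (coeff r j) * (var 2 ^ (k - d - j) * var 3 ^ j))" if "j \<le> degree r" for j
      proof -
        have "k - d - j + j = k - d" using rdeg False that by arith
        then show ?thesis
          using \<open>\<And>j. homogeneous (k - d - j + j) (var 2 ^ (k - d - j) * var 3 ^ j)\<close>[of j]
          by (intro homogeneous_const_mult) (simp only:)
      qed
      then have "homogeneous (k - d) c" unfolding c_def if_not_P[OF False] by (intro homogeneous_sum) simp
      moreover have "d \<le> k" using rdeg False by arith
      ultimately show ?thesis by blast
    qed (simp add: c_def)
    then have hom_part: "homogeneous (k - d) c" "r \<noteq> 0 \<Longrightarrow> d \<le> k" by blast+
    show "homogeneous k (c * H)"
    proof (cases "r = 0")
      case True
      then show ?thesis by (simp add: c_def)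
    next
      case False
      then show ?thesis using homogeneous_mult[OF hom_part(1) H] hom_part(2) by simp
    qed
  qed
  have "\<exists>b'. b - c * F = var 1 * b'"
  proof (rule var1_dvd)
    show "homogeneous k (b - c * F)" by (intro homogeneous_diff ab homc hom_F)
    have "poly w z = poly p z * poly r z" for z unfolding r by simp
    then show "ev (b - c * F) (vector [0, 1, z]) = 0" for z by (simp add: evc w(2) p(3))
  qed
  then obtain b' where b': "b - c * F = var 1 * b'" by blast
  have "\<exists>a'. a + c * G = var 1 * a'"
  proof (rule var1_dvd)
    show "homogeneous k (a + c * G)" by (intro homogeneous_add ab homc hom_G)
    have "poly u z = - poly r z * poly q z" for z unfolding ur by simp
    then show "ev (a + c * G) (vector [0, 1, z]) = 0" for z by (simp add: evc u q)
  qed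
  then obtain a' where a': "a + c * G = var 1 * a'" by blast
  have "a = - c * G + var 1 * a'" unfolding a'[symmetric] by simp
  moreover have "b = c * F + var 1 * b'" unfolding b'[symmetric] by simp
  ultimately show ?thesis by (intro exI conjI)
qed

text \<open>X is a nonzerodivisor modulo (F, G): a representation of X * f restricts to a syzygy on
  X = 0, and after removal of its Koszul part the whole relation is divisible by X.\<close>

lemma X_cancel:
  assumes f: "homogeneous k f" and Xf: "var 1 * f \<in> ideal_gen {F, G}"
  shows "f \<in> ideal_gen {F, G}"
proof -
  have h: "homogeneous (Suc 0 + k) (var 1 * f)" by (intro homogeneous_mult homogeneous_var f)
  show ?thesis
  proof (cases "Suc k < d")
    case True
    then have "var 1 * f = 0" using hom_low_FG[OF Xf h] by simp
    then have "f = 0" using var_nonzero[of 1] by (auto simp only: mult_eq_0_iff)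
    then show ?thesis by (simp add: ideal_gen_0)
  next
    case False
    then have "Suc 0 + k = (Suc k - d) + d" by simp
    then obtain a b where ab: "homogeneous (Suc k - d) a" "homogeneous (Suc k - d) b" "var 1 * f = a * F + b * G"
      using hom_in_FG[OF Xf, of "Suc k - d"] h by metis
    have "ev (a * F + b * G) (vector [0, 1, z]) = 0" for z
      unfolding ab(3)[symmetric] by (simp add: vector_3)
    then obtain c a' b' where c: "a = - c * G + var 1 * a'" "b = c * F + var 1 * b'"
      using syzygy_mod_X[OF ab(1,2)] by blast
    have "var 1 * f = var 1 * (a' * F + b' * G)"
      unfolding ab(3) c by (rule syzygy_expand)
    then have "f = a' * F + b' * G" using var_nonzero[of 1] by (auto simp only: mult_cancel_left)
    then show ?thesis using in_FG by blast
  qed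
qed

lemma X_power_cancel:
  assumes f: "homogeneous k f" and Xf: "var 1 ^ j * f \<in> ideal_gen {F, G}"
  shows "f \<in> ideal_gen {F, G}"
  using Xf
proof (induction j)
  case (Suc j)
  have "homogeneous (j + k) (var 1 ^ j * f)" by (intro homogeneous_mult hom_var_power f)
  then have "var 1 ^ j * f \<in> ideal_gen {F, G}"
    by (rule X_cancel) (use Suc.prems in \<open>simp only: power_Suc mult.assoc\<close>)
  then show ?case by (rule Suc.IH)
qed simp

lemma hom_part_uminus: "hom_part k (- f) = - hom_part k f"
  using hom_part_diff[of k 0 f] by simp

text \<open>Induction on the degree: the syzygy is Koszul modulo X, and the rest is X times a syzygy
  of smaller degree.\<close>

lemma syzygy_hom:
  assumes "homogeneous k a" "homogeneous k b" "a * F = b * G"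
  shows "\<exists>c. b = F * c"
  using assms
proof (induction k arbitrary: a b)
  case 0
  have "\<exists>c a' b'. a = - c * G + var 1 * a' \<and> - b = c * F + var 1 * b'"
  proof (rule syzygy_mod_X[of 0])
    have "a * F + (- b) * G = 0" using 0(3) by (simp only: mult_neg_eq)
    then show "ev (a * F + (- b) * G) (vector [0, 1, z]) = 0" for z by (simp only: poly_eval_0)
  qed (use 0 in \<open>auto intro: homogeneous_uminus\<close>)
  then obtain c a' b' where "- b = c * F + var 1 * b'" by blast
  then have "b = - (F * c + var 1 * b')" by (rule neg_combination)
  then have "b = - hom_part 0 (F * c + var 1 * b')"
    using hom_part_homogeneous[OF 0(2), of 0] hom_part_uminus by metis
  also have "hom_part 0 (F * c + var 1 * b') = 0"
    using d_pos by (simp add: hom_part_add hom_part_mult[OF hom_F] hom_part_mult[OF homogeneous_var])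
  finally show ?case by (intro exI[of _ 0]) simp
next
  case (Suc k)
  have "\<exists>c a' b'. a = - c * G + var 1 * a' \<and> - b = c * F + var 1 * b'"
  proof (rule syzygy_mod_X[of "Suc k"])
    have "a * F + (- b) * G = 0" using Suc.prems(3) by (simp only: mult_neg_eq)
    then show "ev (a * F + (- b) * G) (vector [0, 1, z]) = 0" for z by (simp only: poly_eval_0)
  qed (use Suc.prems in \<open>auto intro: homogeneous_uminus\<close>)
  then obtain c a' b' where c: "a = - c * G + var 1 * a'" "- b = c * F + var 1 * b'" by blast
  have "a * F + (- b) * G = 0" using Suc.prems(3) by (simp only: mult_neg_eq)
  then have "var 1 * (a' * F + b' * G) = 0" unfolding c by (simp only: syzygy_expand)
  then have ab: "a' * F + b' * G = 0" using var_nonzero[of 1] by (auto simp only: mult_eq_0_iff)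
  have "F * hom_part k a' + G * hom_part k b' = hom_part (d + k) (F * a' + G * b')"
    by (simp add: hom_part_add hom_part_mult[OF hom_F] hom_part_mult[OF hom_G])
  also have "F * a' + G * b' = 0" using ab by (simp add: mult.commute)
  finally have "hom_part k a' * F + (- (- hom_part k b')) * G = 0" by (simp only: mult.commute minus_minus hom_part_0)
  then have "hom_part k a' * F = - hom_part k b' * G" by (simp only: mult_neg_eq)
  then obtain t where t: "- hom_part k b' = F * t"
    using Suc.IH[of "hom_part k a'" "- hom_part k b'"] homogeneous_uminus by auto
  have "b = - (F * c + var 1 * b')" by (rule neg_combination) (rule c(2))
  then have "b = - hom_part (Suc k) (F * c + var 1 * b')"
    using hom_part_homogeneous[OF Suc.prems(2), of "Suc k"] hom_part_uminus by metis
  also have "hom_part (Suc k) (F * c + var 1 * b') = F * (if Suc k < d then 0 else hom_part (Suc k - d) c) + var 1 * hom_part k b'"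
    by (simp add: hom_part_add hom_part_mult[OF hom_F] hom_part_mult[OF homogeneous_var])
  also have "hom_part k b' = F * (- t)" using t by (metis minus_minus mult_minus_right)
  finally have "b = F * (- ((if Suc k < d then 0 else hom_part (Suc k - d) c) + var 1 * (- t)))"
    by (simp only: distrib_left mult.left_commute mult_minus_right)
  then show ?case by (rule exI)
qed

lemma G_regular:
  assumes "G * h \<in> ideal_gen {F}" shows "h \<in> ideal_gen {F}"
proof -
  obtain a where a: "G * h = F * a" using assms by (auto simp: ideal_gen_single)
  obtain B where B: "h = (\<Sum>k<B. hom_part k h)" using hom_part_decomp by blast
  have "hom_part k h \<in> ideal_gen {F}" for k
  proof -
    have "G * hom_part k h = hom_part (d + k) (G * h)" by (simp add: hom_part_mult[OF hom_G])
    also have "\<dots> = F * hom_part k a" unfolding a by (simp add: hom_part_mult[OF hom_F])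
    finally have "hom_part k a * F = hom_part k h * G" by (simp add: mult.commute)
    then show ?thesis
      using syzygy_hom[of k "hom_part k a" "hom_part k h"] by (auto simp: ideal_gen_single)
  qed
  then have "(\<Sum>k<B. hom_part k h) \<in> ideal_gen {F}" by (intro ideal_gen_sum)
  then show ?thesis using B by simp
qed

lemma F_nonzero: "F \<noteq> 0"
  using F_monic by auto

end

lemma det_of_transpose: "det_of n (\<lambda>i j. a j i) = det_of n a"
proof -
  have "Matrix.mat n n (\<lambda>(i, j). a j i) = transpose_mat (Matrix.mat n n (\<lambda>(i, j). a i j))"
    by (intro eq_matI) auto
  then show ?thesis unfolding det_of_def by (simp add: det_transpose[of _ n])
qed

context plane_ci
begin

text \<open>In high degree the forms modulo (F, G) are spanned by d^2 elements, and they map onto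
  all functions on the d^2 points of W, so the map is injective. This settles high degrees, and
  cancelling X the low ones.\<close>

lemma ideal_of_zeros:
  assumes W: "finite W" "card W = d\<^sup>2"
    and van: "\<And>P. P \<in> W \<Longrightarrow> vanishes_at F P \<and> vanishes_at G P \<and> \<not> vanishes_at (var 1) P"
  shows "homogeneous_ideal W = ideal_gen {F, G}"
proof
  show "ideal_gen {F, G} \<subseteq> homogeneous_ideal W"
  proof (rule ideal_gen_homogeneous_ideal)
    have "\<forall>P\<in>W. vanishes_at F P" "\<forall>P\<in>W. vanishes_at G P" using van by blast+
    then show "{F, G} \<subseteq> homogeneous_ideal W" unfolding homogeneous_ideal_eq by simp
  qed
next
  obtain h where h: "bij_betw h {..<d\<^sup>2} W"
    using ex_bij_betw_nat_finite[OF W(1)] W(2) by (auto simp: lessThan_atLeast0)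
  have hW: "h i \<in> W" if "i < d\<^sup>2" for i using bij_betwE[OF h] that by blast
  have "\<exists>v. v \<in> coords P \<and> v $ 1 = 1" if "P \<in> W" for P
  proof -
    obtain v where v: "v \<noteq> 0" "P = pt v" using pt_cases by blast
    then have "v $ 1 \<noteq> 0" using van[OF that] vanishes_hom[OF homogeneous_var, of v 1] by simp
    then have "(1 / v $ 1) *s v \<in> coords P" using v coords_pt by force
    moreover have "((1 / v $ 1) *s v) $ 1 = 1" using \<open>v $ 1 \<noteq> 0\<close> by simp
    ultimately show ?thesis by blast
  qed
  then obtain p where p: "\<And>P. P \<in> W \<Longrightarrow> p P \<in> coords P \<and> p P $ 1 = 1" by metis
  define w where "w i = p (h i)" for i
  have w: "w i \<in> coords (h i)" "w i $ 1 = 1" if "i < d\<^sup>2" for i using p hW[OF that] by (auto simp: w_def)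
  have FGw: "ev g (w i) = 0" if "g \<in> ideal_gen {F, G}" "i < d\<^sup>2" for g i
  proof -
    have "ev F (w i) = 0" "ev G (w i) = 0"
      using van[OF hW[OF that(2)]] w(1)[OF that(2)] by (auto simp: vanishes_at_def)
    then show ?thesis using that(1) by (auto simp: in_FG)
  qed
  \<comment> \<open>A singular evaluation matrix would give a nontrivial linear relation, with
    coefficients c, between the values at W of all forms of degree K; a form vanishing at all points
    of W but one contradicts it.\<close>
  have D: "det_of (d\<^sup>2) (\<lambda>i j. ev (e j) (w i)) \<noteq> 0"
  proof
    assume "det_of (d\<^sup>2) (\<lambda>i j. ev (e j) (w i)) = 0"
    then have "det_of (d\<^sup>2) (\<lambda>j i. ev (e j) (w i)) = 0"
      using det_of_transpose[of "d\<^sup>2" "\<lambda>i j. ev (e j) (w i)"] by simp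
    then obtain c i0 where c: "i0 < d\<^sup>2" "c i0 \<noteq> 0" "\<And>j. j < d\<^sup>2 \<Longrightarrow> (\<Sum>i<d\<^sup>2. ev (e j) (w i) * c i) = 0"
      unfolding det_of_eq_0_iff by blast
    \<comment> \<open>Large enough for \<open>interpolating_form\<close>, which needs at least as
      many lines as points, and of the shape 2 * d - 1 + j of \<open>spans_X_power\<close>.\<close>
    define K where "K = 2 * d - 1 + d\<^sup>2"
    have "card (W - {h i0}) \<le> card W" using W(1) by (intro card_mono) auto
    then have cK: "card (W - {h i0}) \<le> K" using W(2) by (simp add: K_def)
    have "\<exists>q. homogeneous K q \<and> \<not> vanishes_at q (h i0) \<and> (\<forall>Q\<in>W - {h i0}. vanishes_at q Q)"
      by (rule interpolating_form) (use W(1) cK in simp_all)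
    then obtain q where q: "homogeneous K q" "\<not> vanishes_at q (h i0)" "\<forall>Q\<in>W - {h i0}. vanishes_at q Q"
      by blast
    obtain g b where g: "g \<in> ideal_gen {F, G}" "q = g + var 1 ^ Suc (d\<^sup>2) * lin_comb (d\<^sup>2) b e"
      using spans_X_power[of "d\<^sup>2" q] q(1) unfolding K_def by blast
    have qw: "ev q (w i) = (\<Sum>j<d\<^sup>2. ev (e j) (w i) * b j)" if "i < d\<^sup>2" for i
    proof -
      have "ev q (w i) = ev g (w i) + w i $ 1 ^ Suc (d\<^sup>2) * ev (lin_comb (d\<^sup>2) b e) (w i)"
        unfolding g(2) by (simp only: poly_eval_add poly_eval_mult poly_eval_power poly_eval_var)
      then show ?thesis using FGw[OF g(1) that] w(2)[OF that] by (simp only: ev_lin_comb power_one mult_1 add_0)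
    qed
    have "(\<Sum>i<d\<^sup>2. ev q (w i) * c i) = (\<Sum>i<d\<^sup>2. \<Sum>j<d\<^sup>2. ev (e j) (w i) * c i * b j)"
    proof (rule sum.cong)
      fix i assume "i \<in> {..<d\<^sup>2}"
      then show "ev q (w i) * c i = (\<Sum>j<d\<^sup>2. ev (e j) (w i) * c i * b j)"
        using qw[of i] by (simp only: lessThan_iff sum_distrib_right mult.assoc mult.commute[of "b _"])
    qed simp
    also have "\<dots> = (\<Sum>j<d\<^sup>2. (\<Sum>i<d\<^sup>2. ev (e j) (w i) * c i) * b j)"
      unfolding sum_distrib_right by (rule sum.swap)
    also have "\<dots> = 0" using c(3) by simp
    finally have 0: "(\<Sum>i<d\<^sup>2. ev q (w i) * c i) = 0" .
    have "ev q (w i) * c i = (if i = i0 then ev q (w i0) * c i0 else 0)" if "i < d\<^sup>2" for i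
    proof (cases "i = i0")
      case False
      then have "h i \<in> W - {h i0}" using h that c(1) hW by (auto simp: bij_betw_def inj_on_def)
      then have "ev q (w i) = 0" using q(3) w(1)[OF that] by (auto simp: vanishes_at_def)
      then show ?thesis using False by simp
    qed simp
    then have "(\<Sum>i<d\<^sup>2. ev q (w i) * c i) = (\<Sum>i<d\<^sup>2. if i = i0 then ev q (w i0) * c i0 else 0)"
      by (intro sum.cong) auto
    then have "ev q (w i0) * c i0 = 0" using 0 c(1) by simp
    then show False using c(2) q(2) vanishes_hom_coords[OF q(1) w(1)[OF c(1)]] by simp
  qed
  have high: "f \<in> ideal_gen {F, G}" if f: "homogeneous (2 * d - 1 + j) f" "f \<in> homogeneous_ideal W" for f j
  proof -
    obtain g b where g: "g \<in> ideal_gen {F, G}" "f = g + var 1 ^ Suc j * lin_comb (d\<^sup>2) b e"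
      using spans_X_power[OF f(1)] by blast
    have "(\<Sum>l<d\<^sup>2. ev (e l) (w i) * b l) = 0" if i: "i < d\<^sup>2" for i
    proof -
      have "ev f (w i) = 0" using f(2) hW[OF i] w(1)[OF i] by (auto simp: homogeneous_ideal_eq vanishes_at_def)
      moreover have "ev f (w i) = ev g (w i) + w i $ 1 ^ Suc j * ev (lin_comb (d\<^sup>2) b e) (w i)"
        unfolding g(2) by (simp only: poly_eval_add poly_eval_mult poly_eval_power poly_eval_var)
      ultimately show ?thesis using FGw[OF g(1) i] w(2)[OF i] by (simp only: ev_lin_comb power_one mult_1 add_0)
    qed
    then have "\<forall>l<d\<^sup>2. b l = 0" using D unfolding det_of_eq_0_iff by blast
    then have "lin_comb (d\<^sup>2) b e = 0" by (intro lin_comb_0) auto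
    then show ?thesis using g by simp
  qed
  show "homogeneous_ideal W \<subseteq> ideal_gen {F, G}"
  proof
    fix f assume f: "f \<in> homogeneous_ideal W"
    have "hom_part k f \<in> ideal_gen {F, G}" for k
    proof (rule X_power_cancel[of k])
      \<comment> \<open>A power of X lifts the component into the range of \<open>high\<close>;
        \<open>X_power_cancel\<close> removes it afterwards.\<close>
      have "homogeneous (2 * d - 1 + k) (var 1 ^ (2 * d - 1) * hom_part k f)"
        by (intro homogeneous_mult hom_var_power homogeneous_hom_part)
      moreover have "var 1 ^ (2 * d - 1) * hom_part k f \<in> homogeneous_ideal W"
        using hom_part_in_homogeneous_ideal[OF f, of k] by (auto simp: homogeneous_ideal_eq vanishes_at_def)
      ultimately show "var 1 ^ (2 * d - 1) * hom_part k f \<in> ideal_gen {F, G}" by (rule high)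
    qed simp
    moreover obtain B where B: "f = (\<Sum>k<B. hom_part k f)" using hom_part_decomp by blast
    ultimately have "(\<Sum>k<B. hom_part k f) \<in> ideal_gen {F, G}" by (intro ideal_gen_sum)
    then show "f \<in> ideal_gen {F, G}" using B by simp
  qed
qed

end

subsection \<open>The eliminant\<close>

text \<open>The coefficient determinant of the square family for l = Y - s * X, as a polynomial in
  s. Under \<open>indep_X\<close> it is, up to a nonzero constant, the characteristic polynomial of
  Y / X acting on the quotient by (F, G). Only the last d^2 columns involve s, and linearly, whence
  its degree bound. The 0 in the first columns is a placeholder for l, which does not occur in
  them.\<close>

definition eliminant :: "nat \<Rightarrow> 3 cpoly \<Rightarrow> 3 cpoly \<Rightarrow> (nat \<Rightarrow> 3 cpoly) \<Rightarrow> complex poly" where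
  "eliminant d F G e = det_of (forms_dim (2 * d - 1)) (\<lambda>i j.
     if j < forms_dim (d - 1) + forms_dim (d - 1) then [:Poly_Mapping.lookup (square_family d 0 F G e j) (nth_monomial (2 * d - 1) i):]
     else [:Poly_Mapping.lookup (var 2 * e (j - (forms_dim (d - 1) + forms_dim (d - 1)))) (nth_monomial (2 * d - 1) i),
        - Poly_Mapping.lookup (var 1 * e (j - (forms_dim (d - 1) + forms_dim (d - 1)))) (nth_monomial (2 * d - 1) i):])"

lemma poly_signof: "poly (signof p) s = (signof p :: complex)"
  by (cases "evenperm p") (simp_all add: sign_def)

lemma poly_det_of: "poly (det_of n a) s = det_of n (\<lambda>i j. poly (a i j) (s :: complex))"
  by (simp add: det_of_expand poly_sum poly_prod poly_signof)

lemma poly_eliminant: "poly (eliminant d F G e) s = coeff_det (2 * d - 1) (square_family d (var 2 - const s * var 1) F G e)"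
proof -
  have l: "Poly_Mapping.lookup ((var 2 - const s * var 1) * f) m =
    Poly_Mapping.lookup (var 2 * f) m - s * Poly_Mapping.lookup (var 1 * f) m" for f m
    by (simp only: left_diff_distrib lookup_minus mult.assoc lookup_const_mult)
  define N K where "N = forms_dim (d - 1)" and "K = 2 * d - 1"
  show ?thesis
    unfolding eliminant_def poly_det_of coeff_det_def square_family_def mult_2[of "forms_dim (d - 1)"] N_def[symmetric] K_def[symmetric]
    by (rule det_of_cong) (simp add: l mult_2)
qed

lemma degree_det_of_le:
  fixes a :: "nat \<Rightarrow> nat \<Rightarrow> complex poly"
  assumes "\<And>i j. i < n \<Longrightarrow> j < n \<Longrightarrow> degree (a i j) \<le> b j"
  shows "degree (det_of n a) \<le> (\<Sum>j<n. b j)"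
  unfolding det_of_expand
proof (rule degree_sum_le)
  fix p assume "p \<in> {p. p permutes {0..<n}}"
  then have p: "p permutes {0..<n}" by simp
  have "degree (signof p * (\<Prod>i=0..<n. a i (p i))) \<le> degree (signof p :: complex poly) + degree (\<Prod>i=0..<n. a i (p i))"
    by (rule degree_mult_le)
  also have "degree (signof p :: complex poly) = 0"
    by (cases "evenperm p") (simp_all add: sign_def)
  also have "degree (\<Prod>i=0..<n. a i (p i)) \<le> (\<Sum>i=0..<n. degree (a i (p i)))"
    using degree_prod_sum_le[of "{0..<n}" "\<lambda>i. a i (p i)"] by (simp add: o_def)
  also have "\<dots> \<le> (\<Sum>i=0..<n. b (p i))"
    by (rule sum_mono) (use p in \<open>auto intro!: assms simp: permutes_in_image\<close>)
  also have "\<dots> = (\<Sum>j=0..<n. b j)"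
    using sum.permute[OF p, of b] by (simp add: o_def)
  finally show "degree (signof p * (\<Prod>i=0..<n. a i (p i))) \<le> (\<Sum>j<n. b j)"
    by (simp add: lessThan_atLeast0)
qed (simp add: finite_permutations)

lemma degree_eliminant:
  assumes "d > 0" shows "degree (eliminant d F G e) \<le> d\<^sup>2"
proof -
  define M where "M = forms_dim (d - 1) + forms_dim (d - 1)"
  have "degree (eliminant d F G e) \<le> (\<Sum>j<forms_dim (2 * d - 1). if j < M then 0 else 1)"
    unfolding eliminant_def M_def by (rule degree_det_of_le) auto
  also have "\<dots> = (\<Sum>j<M + d\<^sup>2. if j < M then 0 else 1)"
    by (simp only: forms_dim_square_family[OF assms] M_def)
  also have "(\<Sum>j<M + k. if j < M then 0 else 1 :: nat) = k" for k
    by (induction k) auto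
  finally show ?thesis .
qed

definition poly_coeff_fun :: "nat \<Rightarrow> ((nat \<Rightarrow> complex ^ 3) \<Rightarrow> complex poly) \<Rightarrow> bool" where
  "poly_coeff_fun n p \<longleftrightarrow> (\<forall>k. (\<lambda>v. coeff (p v) k) \<in> poly_fun n)"

lemma poly_coeff_fun_fixed: "poly_coeff_fun n (\<lambda>_. p)"
  by (simp add: poly_coeff_fun_def poly_fun_const)

lemma poly_coeff_fun_mult: "poly_coeff_fun n p \<Longrightarrow> poly_coeff_fun n q \<Longrightarrow> poly_coeff_fun n (\<lambda>v. p v * q v)"
  unfolding poly_coeff_fun_def coeff_mult by (intro allI poly_fun_sum poly_fun_mult) auto

lemma poly_coeff_fun_sum: "(\<And>i. i \<in> A \<Longrightarrow> poly_coeff_fun n (p i)) \<Longrightarrow> poly_coeff_fun n (\<lambda>v. \<Sum>i\<in>A. p i v)"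
  unfolding poly_coeff_fun_def coeff_sum by (intro allI poly_fun_sum) auto

lemma poly_coeff_fun_prod: "(\<And>i. i \<in> A \<Longrightarrow> poly_coeff_fun n (p i)) \<Longrightarrow> poly_coeff_fun n (\<lambda>v. \<Prod>i\<in>A. p i v)"
  by (induction A rule: infinite_finite_induct) (auto intro: poly_coeff_fun_fixed poly_coeff_fun_mult)

lemma poly_coeff_fun_pCons: "a \<in> poly_fun n \<Longrightarrow> poly_coeff_fun n p \<Longrightarrow> poly_coeff_fun n (\<lambda>v. pCons (a v) (p v))"
  unfolding poly_coeff_fun_def
proof
  fix k assume "a \<in> poly_fun n" "\<forall>k. (\<lambda>v. coeff (p v) k) \<in> poly_fun n"
  then show "(\<lambda>v. coeff (pCons (a v) (p v)) k) \<in> poly_fun n" by (cases k) simp_all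
qed

lemma poly_coeff_fun_det_of:
  assumes "\<And>i j. i < m \<Longrightarrow> j < m \<Longrightarrow> poly_coeff_fun n (\<lambda>v. a v i j)"
  shows "poly_coeff_fun n (\<lambda>v. det_of m (a v))"
  unfolding det_of_expand
  by (intro poly_coeff_fun_sum poly_coeff_fun_mult poly_coeff_fun_fixed poly_coeff_fun_prod) (auto intro!: assms simp: permutes_in_image)

lemma poly_coeff_fun_pderiv: "poly_coeff_fun n p \<Longrightarrow> poly_coeff_fun n (\<lambda>v. pderiv (p v))"
  unfolding poly_coeff_fun_def coeff_pderiv by (auto intro: poly_fun_mult poly_fun_const)

lemma poly_family_square_family:
  assumes "poly_family n F" "poly_family n G"
  shows "poly_family n (\<lambda>v. square_family d l (F v) (G v) e i)"
  using assms unfolding square_family_def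
  by (cases "i < forms_dim (d - 1)"; cases "i < 2 * forms_dim (d - 1)") (auto intro: poly_family_mult_fixed)

lemma poly_coeff_fun_eliminant:
  assumes "poly_family n F" "poly_family n G"
  shows "poly_coeff_fun n (\<lambda>v. eliminant d (F v) (G v) e)"
  unfolding eliminant_def
proof (rule poly_coeff_fun_det_of)
  fix i j
  let ?M = "forms_dim (d - 1) + forms_dim (d - 1)"
  have "poly_coeff_fun n (\<lambda>v. [:Poly_Mapping.lookup (square_family d 0 (F v) (G v) e j) (nth_monomial (2 * d - 1) i):])"
    using poly_family_square_family[OF assms, of d 0 e j] by (intro poly_coeff_fun_pCons poly_coeff_fun_fixed) (simp add: poly_family_def)
  then show "poly_coeff_fun n (\<lambda>v. if j < ?M then [:Poly_Mapping.lookup (square_family d 0 (F v) (G v) e j) (nth_monomial (2 * d - 1) i):]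
     else [:Poly_Mapping.lookup (var 2 * e (j - ?M)) (nth_monomial (2 * d - 1) i),
        - Poly_Mapping.lookup (var 1 * e (j - ?M)) (nth_monomial (2 * d - 1) i):])"
    by (cases "j < ?M") (auto intro: poly_coeff_fun_fixed)
qed

text \<open>The size of the Sylvester matrix is fixed in \<open>resultant_sub\<close>, so its
  entries remain polynomial in v even where the degrees of p v and q v drop.\<close>

lemma poly_fun_resultant_sub:
  assumes "poly_coeff_fun n p" "poly_coeff_fun n q"
  shows "(\<lambda>v. resultant_sub k l (p v) (q v)) \<in> poly_fun n"
proof -
  have "resultant_sub k l (p v) (q v) = det_of (k + l) (\<lambda>i j.
     if i < l then if i \<le> j \<and> j - i \<le> k then coeff (p v) (k + i - j) else 0
     else if i - l \<le> j \<and> j \<le> i then coeff (q v) (i - j) else 0)" for v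
    by (simp add: resultant_sub_def sylvester_mat_sub_def det_of_def)
  moreover have "(\<lambda>v. det_of (k + l) (\<lambda>i j.
     if i < l then if i \<le> j \<and> j - i \<le> k then coeff (p v) (k + i - j) else 0
     else if i - l \<le> j \<and> j \<le> i then coeff (q v) (i - j) else 0)) \<in> poly_fun n"
  proof (rule poly_fun_det_of)
    fix i j
    show "(\<lambda>v. if i < l then if i \<le> j \<and> j - i \<le> k then coeff (p v) (k + i - j) else 0
      else if i - l \<le> j \<and> j \<le> i then coeff (q v) (i - j) else 0) \<in> poly_fun n"
      using assms unfolding poly_coeff_fun_def
      by (cases "i < l"; cases "i \<le> j \<and> j - i \<le> k"; cases "i - l \<le> j \<and> j \<le> i") (auto intro: poly_fun_const)
  qed
  ultimately show ?thesis by simp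
qed

text \<open>Over the complex numbers a nonconstant gcd has a root, and a common root with the
  derivative is a multiple root. This makes the distinctness of roots an open condition.\<close>

lemma resultant_pderiv_nonzero_iff:
  fixes p :: "complex poly"
  assumes "p \<noteq> 0"
  shows "resultant p (pderiv p) \<noteq> 0 \<longleftrightarrow> card {x. poly p x = 0} = degree p"
proof -
  have "resultant p (pderiv p) = 0 \<longleftrightarrow> (\<exists>z. poly p z = 0 \<and> poly (pderiv p) z = 0)"
    unfolding resultant_0_gcd
  proof
    assume "degree (gcd p (pderiv p)) \<noteq> 0"
    then have "\<not> constant (poly (gcd p (pderiv p)))" by (simp add: constant_degree)
    then obtain z where "poly (gcd p (pderiv p)) z = 0" using fundamental_theorem_of_algebra by blast
    then have "poly p z = 0 \<and> poly (pderiv p) z = 0"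
      by (meson dvd_trans gcd_dvd1 gcd_dvd2 poly_eq_0_iff_dvd)
    then show "\<exists>z. poly p z = 0 \<and> poly (pderiv p) z = 0" ..
  next
    assume "\<exists>z. poly p z = 0 \<and> poly (pderiv p) z = 0"
    then obtain z where "[:- z, 1:] dvd gcd p (pderiv p)" by (auto simp: poly_eq_0_iff_dvd)
    moreover have "gcd p (pderiv p) \<noteq> 0" using assms by simp
    ultimately have "degree [:- z, 1:] \<le> degree (gcd p (pderiv p))" by (rule dvd_imp_degree_le)
    then show "degree (gcd p (pderiv p)) \<noteq> 0" by simp
  qed
  also have "\<dots> \<longleftrightarrow> \<not> rsquarefree p" by (auto simp: rsquarefree_roots)
  finally show ?thesis using rsquarefree_card_degree[OF assms] by blast
qed

context plane_ci
begin

text \<open>After division by l the factor X restores the degree d - 1 which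
  \<open>indep_square_family_iff\<close> expects. For d = 1 the form a is constant, and divisibility
  by l forces it to be zero.\<close>

lemma divide_out_line:
  assumes a: "homogeneous (d - 1) a" and l: "homogeneous (Suc 0) l" and al: "a = l * a'"
  shows "\<exists>b. a = l * b \<and> homogeneous (d - 1) (var 1 * b)"
proof (cases "d - 1")
  case 0
  then have "a = 0" using hom0_factor[OF l _ al] a by simp
  then show ?thesis by (intro exI[of _ 0]) simp
next
  case (Suc k)
  then obtain b where b: "homogeneous k b" "a = l * b" using hom_factor[OF l _ al] a by auto
  have "homogeneous (Suc 0 + k) (var 1 * b)" by (intro homogeneous_mult homogeneous_var b)
  then show ?thesis using b(2) Suc by (intro exI[of _ b]) simp
qed

text \<open>A root of the eliminant yields a syzygy on a line through (0,0,1), hence a common zero there.\<close>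

lemma common_zero:
  assumes "poly (eliminant d F G e) s = 0"
  shows "\<exists>z. ev F (vector [1, s, z]) = 0 \<and> ev G (vector [1, s, z]) = 0"
proof (rule ccontr)
  assume no: "\<nexists>z. ev F (vector [1, s, z]) = 0 \<and> ev G (vector [1, s, z]) = 0"
  define l where "l = var 2 - const s * (var 1 :: 3 cpoly)"
  have homl: "homogeneous (Suc 0) l"
    unfolding l_def by (intro homogeneous_diff homogeneous_const_mult homogeneous_var)
  have evl: "ev l (vector [1, s, z]) = 0" for z by (simp add: l_def vector_3)
  have l0: "l \<noteq> 0"
  proof
    assume "l = 0"
    then have "ev l (vector [0, 1, 0]) = 0" by simp
    then show False by (simp add: l_def vector_3)
  qed
  have "coeff_det (2 * d - 1) (square_family d l F G e) = 0" using assms by (simp add: poly_eliminant l_def)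
  moreover have "homogeneous (2 * d - 1) (square_family d l F G e i)" if "i < forms_dim (2 * d - 1)" for i
    by (rule homogeneous_square_family[OF d_pos hom_F hom_G homl hom_e that])
  ultimately have "\<not> indep (forms_dim (2 * d - 1)) (square_family d l F G e)" using coeff_det_indep by blast
  then obtain a b c where ab: "homogeneous (d - 1) a" "homogeneous (d - 1) b"
    "a * F + b * G + l * lin_comb (d\<^sup>2) c e = 0" and nonzero_tuple: "\<not> (a = 0 \<and> b = 0 \<and> (\<forall>i<d\<^sup>2. c i = 0))"
    unfolding indep_square_family_iff[OF d_pos] by blast
  obtain p where p: "degree p \<le> d" "coeff p d = ev F (vector [0, 0, 1])" "\<And>z. poly p z = ev F (vector [1, s, z])"
    using on_line[OF hom_F, of 1 s] by blast
  obtain q where q: "\<And>z. poly q z = ev G (vector [1, s, z])"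
    using on_line[OF hom_G, of 1 s] by blast
  obtain u where u: "\<And>z. poly u z = ev a (vector [1, s, z])"
    using on_line[OF ab(1), of 1 s] by blast
  obtain w where w: "degree w \<le> d - 1" "\<And>z. poly w z = ev b (vector [1, s, z])"
    using on_line[OF ab(2), of 1 s] by blast
  have dp: "degree p = d" using p(1,2) F_monic le_degree[of p d] by simp
  have p0: "p \<noteq> 0" using p(2) F_monic by auto
  have cop: "coprime p q"
    by (rule coprime_if_no_common_root[OF p0]) (use no p(3) q in metis)
  have "poly (u * p + w * q) z = poly 0 z" for z
  proof -
    have "ev (a * F + b * G + l * lin_comb (d\<^sup>2) c e) (vector [1, s, z]) = 0" unfolding ab(3) by simp
    then show ?thesis by (simp add: u p q w evl)
  qed
  then have "poly (u * p + w * q) = poly 0" by blast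
  then have eq: "u * p + w * q = 0" by (simp only: poly_eq_poly_eq_iff)
  \<comment> \<open>On the line l vanishes and the relation becomes u * p + w * q = 0 with p and q
    coprime; as p has degree d and w degree at most d - 1, both cofactors vanish on the
    line.\<close>
  then have "p dvd w"
    using cop by (metis coprime_dvd_mult_left_iff dvd_add_right_iff dvd_0_right dvd_triv_right)
  then have w0: "w = 0" using w(1) dp d_pos dvd_imp_degree_le[of p w] by (cases "w = 0") auto
  then have "u = 0" using eq p0 by simp
  have "\<exists>a'. a = l * a'"
    unfolding l_def by (rule var2_diff_dvd[OF ab(1)]) (simp add: u[symmetric] \<open>u = 0\<close>)
  then obtain a' where a': "a = l * a'" "homogeneous (d - 1) (var 1 * a')"
    using divide_out_line[OF ab(1) homl] by blast
  have "\<exists>b'. b = l * b'"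
    unfolding l_def by (rule var2_diff_dvd[OF ab(2)]) (simp add: w(2)[symmetric] w0)
  then obtain b' where b': "b = l * b'" "homogeneous (d - 1) (var 1 * b')"
    using divide_out_line[OF ab(2) homl] by blast
  have "l * (a' * F + b' * G + lin_comb (d\<^sup>2) c e) = 0"
    using ab(3) unfolding a'(1) b'(1) by (simp only: distrib_left mult.assoc)
  then have 0: "a' * F + b' * G + lin_comb (d\<^sup>2) c e = 0" using l0 by (auto simp only: mult_eq_0_iff)
  \<comment> \<open>With l cancelled, multiplication by X gives a relation in the family for l = X,
    which \<open>indep_X\<close> excludes.\<close>
  have "var 1 * a' * F + var 1 * b' * G + var 1 * lin_comb (d\<^sup>2) c e = var 1 * (a' * F + b' * G + lin_comb (d\<^sup>2) c e)"
    by (simp only: distrib_left mult.assoc)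
  then have "var 1 * a' * F + var 1 * b' * G + var 1 * lin_comb (d\<^sup>2) c e = 0" unfolding 0 by simp
  then have X: "var 1 * a' = 0 \<and> var 1 * b' = 0 \<and> (\<forall>i<d\<^sup>2. c i = 0)"
    using indep_X a'(2) b'(2) unfolding indep_square_family_iff[OF d_pos] by blast
  then have "a' = 0 \<and> b' = 0" using var_nonzero[of 1] by (auto simp only: mult_eq_0_iff)
  then show False using nonzero_tuple X a'(1) b'(1) by simp
qed

text \<open>The common zero found for a root s has ratio s of its first two coordinates, so distinct
  roots give distinct points.\<close>

lemma ideal_is_radical:
  assumes "card {s. poly (eliminant d F G e) s = 0} = d\<^sup>2"
  shows "\<exists>W. finite W \<and> card W = d\<^sup>2 \<and> homogeneous_ideal W = ideal_gen {F, G}"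
proof -
  define S where "S = {s. poly (eliminant d F G e) s = 0}"
  have S: "finite S" "card S = d\<^sup>2" using assms d_pos by (auto simp: S_def intro: card_ge_0_finite)
  have "\<forall>s\<in>S. \<exists>z. ev F (vector [1, s, z]) = 0 \<and> ev G (vector [1, s, z]) = 0"
    using common_zero by (auto simp: S_def)
  then obtain z where z: "\<And>s. s \<in> S \<Longrightarrow> ev F (vector [1, s, z s]) = 0 \<and> ev G (vector [1, s, z s]) = 0"
    by metis
  define w where "w s = (vector [1, s, z s] :: complex ^ 3)" for s
  have w1: "w s $ 1 = 1" "w s $ 2 = s" for s by (simp_all add: w_def vector_3)
  have w0: "w s \<noteq> 0" for s using w1(1)[of s] by auto
  have "inj_on (\<lambda>s. pt (w s)) S"
  proof (rule inj_onI)
    fix s t assume "pt (w s) = pt (w t)"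
    then obtain c where c: "w t = c *s w s" using pt_eq_iff[OF w0 w0] by blast
    then have "w t $ 1 = c * w s $ 1" "w t $ 2 = c * w s $ 2" by simp_all
    then show "s = t" by (simp add: w1)
  qed
  then have "card ((\<lambda>s. pt (w s)) ` S) = d\<^sup>2" using S(2) by (simp add: card_image)
  moreover have "vanishes_at F P \<and> vanishes_at G P \<and> \<not> vanishes_at (var 1) P" if "P \<in> (\<lambda>s. pt (w s)) ` S" for P
  proof -
    obtain s where s: "s \<in> S" "P = pt (w s)" using \<open>P \<in> (\<lambda>s. pt (w s)) ` S\<close> by blast
    show ?thesis
      unfolding s(2) vanishes_hom[OF hom_F w0] vanishes_hom[OF hom_G w0] vanishes_hom[OF homogeneous_var w0]
      using z[OF s(1)] w1 by (simp add: w_def)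
  qed
  ultimately show ?thesis using ideal_of_zeros[of "(\<lambda>s. pt (w s)) ` S"] S(1) by blast
qed

end

section \<open>The square grid as a complete intersection\<close>

lemma grid_enumeration:
  fixes d :: nat
  shows "\<exists>b. bij_betw b {..<d\<^sup>2} ({..<d} \<times> {..<d})"
proof -
  have "card ({..<d} \<times> {..<d}) = d\<^sup>2" by (simp add: power2_eq_square)
  then show ?thesis using ex_bij_betw_nat_finite[of "{..<d} \<times> {..<d}"] by (simp add: lessThan_atLeast0)
qed

text \<open>At a grid point both products of lines vanish and only one grid form survives, so l
  being nonzero there kills its coefficient. What remains is a syzygy in degree d - 1, excluded by
  \<open>grid_syzygy\<close>.\<close>

lemma grid_indep:
  assumes d: "d > 0" and b: "bij_betw b {..<d\<^sup>2} ({..<d} \<times> {..<d})"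
    and l: "\<And>q. q \<in> {..<d} \<times> {..<d} \<Longrightarrow> ev l (node d q) \<noteq> 0"
  shows "indep (forms_dim (2 * d - 1)) (square_family d l (triangle_form d (d, 0)) (triangle_form d (0, d)) (\<lambda>i. grid_form d (b i)))"
  unfolding indep_square_family_iff[OF d]
proof (intro allI impI)
  fix a a' c assume a: "homogeneous (d - 1) a" "homogeneous (d - 1) a'"
    and eq: "a * triangle_form d (d, 0) + a' * triangle_form d (0, d) + l * lin_comb (d\<^sup>2) c (\<lambda>i. grid_form d (b i)) = 0"
  have bi: "b i \<in> {..<d} \<times> {..<d}" if "i < d\<^sup>2" for i using bij_betwE[OF b] that by blast
  have c: "c i = 0" if i: "i < d\<^sup>2" for i
  proof -
    have "ev (grid_form d (b j)) (node d (b i)) * c j = (if j = i then ev (grid_form d (b i)) (node d (b i)) * c i else 0)"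
      if "j < d\<^sup>2" for j
    proof (cases "j = i")
      case False
      then have "b j \<noteq> b i" using b that i by (auto simp: bij_betw_def inj_on_def)
      then show ?thesis using False ev_grid_form_off[OF bi[OF i]] by simp
    qed simp
    then have "ev (lin_comb (d\<^sup>2) c (\<lambda>i. grid_form d (b i))) (node d (b i)) =
        (\<Sum>j<d\<^sup>2. if j = i then ev (grid_form d (b i)) (node d (b i)) * c i else 0)"
      unfolding ev_lin_comb by (intro sum.cong) auto
    also have "\<dots> = ev (grid_form d (b i)) (node d (b i)) * c i" using i by simp
    finally have s: "ev (lin_comb (d\<^sup>2) c (\<lambda>i. grid_form d (b i))) (node d (b i)) = ev (grid_form d (b i)) (node d (b i)) * c i" .
    have "ev (a * triangle_form d (d, 0) + a' * triangle_form d (0, d) + l * lin_comb (d\<^sup>2) c (\<lambda>i. grid_form d (b i))) (node d (b i)) = 0"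
      unfolding eq by simp
    then have "ev l (node d (b i)) * (ev (grid_form d (b i)) (node d (b i)) * c i) = 0"
      using ev_corners_grid[OF bi[OF i]] s by simp
    then show ?thesis using l[OF bi[OF i]] ev_grid_form_diag[of d "b i"] by simp
  qed
  then have "lin_comb (d\<^sup>2) c (\<lambda>i. grid_form d (b i)) = 0" by (intro lin_comb_0)
  then have "a * triangle_form d (d, 0) + a' * triangle_form d (0, d) = 0" using eq by simp
  then have "a = 0 \<and> a' = 0" by (rule grid_syzygy[OF d a])
  then show "a = 0 \<and> a' = 0 \<and> (\<forall>i<d\<^sup>2. c i = 0)" using c by blast
qed

lemma corner_in_triangle_idx: "(d, 0) \<in> triangle_idx d" "(0, d) \<in> triangle_idx d" "(0, 0) \<in> triangle_idx d"
  by (auto simp: triangle_idx_def)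

lemma grid_ci:
  assumes d: "d > 0" and b: "bij_betw b {..<d\<^sup>2} ({..<d} \<times> {..<d})"
  shows "plane_ci d (triangle_form d (d, 0)) (triangle_form d (0, d)) (\<lambda>i. grid_form d (b i))"
proof
  show "homogeneous d (triangle_form d (d, 0))" "homogeneous d (triangle_form d (0, d))"
    by (intro homogeneous_triangle_form corner_in_triangle_idx)+
  show "homogeneous (2 * (d - 1)) (grid_form d (b i))" if "i < d\<^sup>2" for i
    by (rule homogeneous_grid_form) (use bij_betwE[OF b] that in blast)
  show "indep (forms_dim (2 * d - 1)) (square_family d (var 1) (triangle_form d (d, 0)) (triangle_form d (0, d)) (\<lambda>i. grid_form d (b i)))"
    by (rule grid_indep[OF d b]) simp
  show "ev (triangle_form d (d, 0)) (vector [0, 0, 1]) \<noteq> 0"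
    using d by (simp add: triangle_form_corners line_A_def ev_linear_form vector_3)
qed (rule d)

text \<open>The roots are the d^2 distinct second coordinates of the grid points; the degree bound
  leaves no room for others.\<close>

lemma grid_eliminant:
  assumes d: "d > 0" and b: "bij_betw b {..<d\<^sup>2} ({..<d} \<times> {..<d})"
  defines "p \<equiv> eliminant d (triangle_form d (d, 0)) (triangle_form d (0, d)) (\<lambda>i. grid_form d (b i))"
  shows "p \<noteq> 0" "degree p = d\<^sup>2" "card {x. poly p x = 0} = d\<^sup>2"
proof -
  interpret plane_ci d "triangle_form d (d, 0)" "triangle_form d (0, d)" "\<lambda>i. grid_form d (b i)"
    by (rule grid_ci[OF d b])
  define l where "l s = var 2 - const s * (var 1 :: 3 cpoly)" for s
  define R where "R = (\<lambda>q. node d q $ 2) ` ({..<d} \<times> {..<d})"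
  have homl: "homogeneous (Suc 0) (l s)" for s
    unfolding l_def by (intro homogeneous_diff homogeneous_const_mult homogeneous_var)
  have ind: "poly p s \<noteq> 0 \<longleftrightarrow> indep (forms_dim (2 * d - 1)) (square_family d (l s) (triangle_form d (d, 0)) (triangle_form d (0, d)) (\<lambda>i. grid_form d (b i)))" for s
    unfolding p_def poly_eliminant l_def[symmetric]
    by (rule coeff_det_indep) (rule homogeneous_square_family[OF d_pos hom_F hom_G homl hom_e])
  have inj: "inj_on (\<lambda>q. node d q $ 2) ({..<d} \<times> {..<d})"
    by (rule inj_onI) (rule second_coordinate_inj)
  have cR: "card R = d\<^sup>2" "finite R"
    unfolding R_def using card_image[OF inj] by (auto simp: power2_eq_square)
  have "\<exists>s. s \<notin> R" by (rule ex_new_if_finite[OF infinite_UNIV_char_0 cR(2)])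
  then obtain s where s: "s \<notin> R" ..
  have "indep (forms_dim (2 * d - 1)) (square_family d (l s) (triangle_form d (d, 0)) (triangle_form d (0, d)) (\<lambda>i. grid_form d (b i)))"
  proof (rule grid_indep[OF d b])
    fix q assume "q \<in> {..<d} \<times> {..<d}"
    then have "node d q $ 2 \<noteq> s" using s by (auto simp: R_def)
    then show "ev (l s) (node d q) \<noteq> 0" by (simp add: l_def)
  qed
  then show p0: "p \<noteq> 0" using ind by fastforce
  \<comment> \<open>If r is the second coordinate of a grid point, all members of the family vanish
    at that point, so they cannot span.\<close>
  have "poly p r = 0" if r: "r \<in> R" for r
  proof (rule ccontr)
    assume "poly p r \<noteq> 0"
    then have i: "indep (forms_dim (2 * d - 1)) (square_family d (l r) (triangle_form d (d, 0)) (triangle_form d (0, d)) (\<lambda>i. grid_form d (b i)))"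
      using ind by blast
    have "spans (2 * d - 1) (forms_dim (2 * d - 1)) (square_family d (l r) (triangle_form d (d, 0)) (triangle_form d (0, d)) (\<lambda>i. grid_form d (b i)))"
      by (rule indep_spans[OF _ i]) (rule homogeneous_square_family[OF d_pos hom_F hom_G homl hom_e])
    moreover have "homogeneous (2 * d - 1) (var 1 ^ (2 * d - 1))" by (rule hom_var_power)
    ultimately obtain c where c: "var 1 ^ (2 * d - 1) =
       lin_comb (forms_dim (2 * d - 1)) c (square_family d (l r) (triangle_form d (d, 0)) (triangle_form d (0, d)) (\<lambda>i. grid_form d (b i)))"
      unfolding spans_def by blast
    obtain q where q: "q \<in> {..<d} \<times> {..<d}" "r = node d q $ 2" using r by (auto simp: R_def)
    have "ev (var 1 ^ (2 * d - 1)) (node d q) = 0"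
      unfolding c lin_comb_square_family[OF d] using ev_corners_grid[OF q(1)] by (simp add: l_def q(2))
    then show False by simp
  qed
  then have sub: "R \<subseteq> {x. poly p x = 0}" by blast
  have fin: "finite {x. poly p x = 0}" by (rule poly_roots_finite[OF p0])
  have "d\<^sup>2 \<le> card {x. poly p x = 0}" using card_mono[OF fin sub] cR by simp
  moreover have "card {x. poly p x = 0} \<le> degree p" by (rule poly_roots_degree[OF p0])
  moreover have "degree p \<le> d\<^sup>2" unfolding p_def by (rule degree_eliminant[OF d])
  ultimately show "degree p = d\<^sup>2" "card {x. poly p x = 0} = d\<^sup>2" by auto
qed

section \<open>Openness of the conditions on a pencil\<close>

lemma poly_fun_ev_fixed:
  assumes "poly_family n F" "\<And>v. homogeneous k (F v)" shows "(\<lambda>v. ev (F v) w) \<in> poly_fun n"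
proof -
  have "ev (F v) w = (\<Sum>j<forms_dim k. Poly_Mapping.lookup (F v) (nth_monomial k j) * ev (monomial_form k j) w)" for v
  proof -
    have "ev (F v) w = ev (\<Sum>j<forms_dim k. const (Poly_Mapping.lookup (F v) (nth_monomial k j)) * monomial_form k j) w"
      by (subst hom_expand[OF assms(2)]) (rule refl)
    then show ?thesis by (simp only: poly_eval_sum poly_eval_mult poly_eval_const)
  qed
  moreover have "(\<lambda>v. \<Sum>j<forms_dim k. Poly_Mapping.lookup (F v) (nth_monomial k j) * ev (monomial_form k j) w) \<in> poly_fun n"
    using assms(1) by (intro poly_fun_sum poly_fun_mult poly_fun_const) (simp add: poly_family_def)
  ultimately show ?thesis by simp
qed

definition good_pencil :: "nat \<Rightarrow> nat \<Rightarrow> (nat \<Rightarrow> complex ^ 3) \<Rightarrow> bool" where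
  "good_pencil d n v \<longleftrightarrow> (\<exists>F e. vanishing_basis d n v 2 F \<and> plane_ci d (F 0) (F 1) e \<and>
     card {s. poly (eliminant d (F 0) (F 1) e) s = 0} = d\<^sup>2)"

text \<open>The two curves are deformed with the points, starting from the corner forms, while the
  grid forms stay fixed as the forms e.\<close>

lemma generic_good_pencil:
  assumes nr: "n + 2 = forms_dim d" and d: "d > 0"
  shows "generic n (good_pencil d n)"
proof -
  define s where "s l = (if l = 0 then (d, 0) else (0, d :: nat))" for l :: nat
  have s2: "s 0 = (d, 0)" "s 1 = (0, d)" by (simp_all add: s_def)
  have s: "inj_on s {..<2}" "s ` {..<2} \<subseteq> triangle_idx d"
    using d corner_in_triangle_idx by (auto simp: s_def inj_on_def)
  obtain p e where pe: "\<forall>j<n. homogeneous d (e j)" "\<forall>l<2. homogeneous d (triangle_form d (s l))"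
    "\<forall>i<n. \<forall>j<n. ev (e j) (node d (p i)) = (if i = j then 1 else 0)"
    "\<forall>i<n. \<forall>l<2. ev (triangle_form d (s l)) (node d (p i)) = 0" "indep 2 (\<lambda>l. triangle_form d (s l))"
    using triangle_example[OF s nr] by blast
  define v0 where "v0 i = node d (p i)" for i
  have "\<exists>F D. D \<in> poly_fun n \<and> D v0 \<noteq> 0 \<and>
     (\<forall>l<2. poly_family n (\<lambda>v. F v l) \<and> F v0 l = triangle_form d (s l) \<and> (\<forall>v. homogeneous d (F v l))) \<and>
     (\<forall>v. D v \<noteq> 0 \<longrightarrow> vanishing_basis d n v 2 (F v) \<and> interpolates d n v)"
    by (rule adapted_deformation[where ?v0.0 = v0 and e = e, OF nr]) (use pe in \<open>auto simp: v0_def\<close>)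
  then obtain F D where D: "D \<in> poly_fun n" "D v0 \<noteq> 0" "\<And>v. D v \<noteq> 0 \<Longrightarrow> vanishing_basis d n v 2 (F v)"
     and F: "\<And>l. l < 2 \<Longrightarrow> poly_family n (\<lambda>v. F v l) \<and> F v0 l = triangle_form d (s l) \<and> (\<forall>v. homogeneous d (F v l))"
    by blast
  have F0: "poly_family n (\<lambda>v. F v 0)" "F v0 0 = triangle_form d (d, 0)" "\<And>v. homogeneous d (F v 0)"
    and F1: "poly_family n (\<lambda>v. F v 1)" "F v0 1 = triangle_form d (0, d)" "\<And>v. homogeneous d (F v 1)"
    using F[of 0] F[of 1] s2 by auto
  obtain b where b: "bij_betw b {..<d\<^sup>2} ({..<d} \<times> {..<d})" using grid_enumeration by blast
  define g where "g i = grid_form d (b i)" for i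
  have homg: "homogeneous (2 * (d - 1)) (g i)" if "i < d\<^sup>2" for i
    unfolding g_def by (rule homogeneous_grid_form) (use bij_betwE[OF b] that in blast)
  define X where "X v = eliminant d (F v 0) (F v 1) g" for v
  \<comment> \<open>The open conditions: h1 gives \<open>indep_X\<close>, h2 gives
    \<open>F_monic\<close>, h3 says that the eliminant has full degree d^2, and under it h4 is the
    resultant with the derivative, so that the roots are distinct.\<close>
  define h1 where "h1 v = coeff_det (2 * d - 1) (square_family d (var 1) (F v 0) (F v 1) g)" for v
  define h2 where "h2 v = ev (F v 0) (vector [0, 0, 1])" for v
  define h3 where "h3 v = coeff (X v) (d\<^sup>2)" for v
  define h4 where "h4 v = resultant_sub (d\<^sup>2) (d\<^sup>2 - 1) (X v) (pderiv (X v))" for v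
  have PFPX: "poly_coeff_fun n X" unfolding X_def by (rule poly_coeff_fun_eliminant[OF F0(1) F1(1)])
  have "h1 \<in> poly_fun n" unfolding h1_def by (intro poly_fun_coeff_det poly_family_square_family F0 F1)
  moreover have "h2 \<in> poly_fun n" unfolding h2_def by (rule poly_fun_ev_fixed[OF F0(1,3)])
  moreover have "h3 \<in> poly_fun n" using PFPX unfolding h3_def poly_coeff_fun_def by blast
  moreover have "h4 \<in> poly_fun n" unfolding h4_def by (intro poly_fun_resultant_sub poly_coeff_fun_pderiv PFPX)
  ultimately have poly_fun: "(\<lambda>v. D v * (h1 v * (h2 v * (h3 v * h4 v)))) \<in> poly_fun n"
    using D(1) by (intro poly_fun_mult)
  have hsqf: "homogeneous (2 * d - 1) (square_family d (var 1) (F v 0) (F v 1) g i)" if "i < forms_dim (2 * d - 1)" for v i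
    by (rule homogeneous_square_family[OF d F0(3) F1(3) homogeneous_var homg that])
  have res: "resultant_sub (d\<^sup>2) (d\<^sup>2 - 1) q (pderiv q) = resultant q (pderiv q)" if "degree q = d\<^sup>2" for q :: "complex poly"
    unfolding resultant_sub degree_pderiv that ..
  interpret grid: plane_ci d "triangle_form d (d, 0)" "triangle_form d (0, d)" g
    using grid_ci[OF d b] unfolding g_def .
  have X0: "X v0 = eliminant d (triangle_form d (d, 0)) (triangle_form d (0, d)) g" by (simp only: X_def F0 F1)
  note el = grid_eliminant[OF d b, folded g_def, folded X0]
  have "h1 v0 \<noteq> 0" unfolding h1_def F0(2) F1(2)
    by (subst coeff_det_indep) (use grid.indep_X hsqf[of _ v0] in \<open>simp_all only: F0(2) F1(2)\<close>)
  moreover have "h2 v0 \<noteq> 0" unfolding h2_def F0(2) by (rule grid.F_monic)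
  moreover have "h3 v0 \<noteq> 0" unfolding h3_def using el(1,2) by (metis leading_coeff_0_iff)
  moreover have "h4 v0 \<noteq> 0"
    unfolding h4_def res[OF el(2)] resultant_pderiv_nonzero_iff[OF el(1)] using el by simp
  ultimately have nonzero: "D v0 * (h1 v0 * (h2 v0 * (h3 v0 * h4 v0))) \<noteq> 0" using D(2) by simp
  show ?thesis
  proof (rule genI[OF poly_fun _ nonzero])
    show "nonzero_tuple n v0" by (simp add: nonzero_tuple_def v0_def node_nonzero)
  next
    fix v assume "D v * (h1 v * (h2 v * (h3 v * h4 v))) \<noteq> 0"
    then have nonzero_tuple: "D v \<noteq> 0" "h1 v \<noteq> 0" "h2 v \<noteq> 0" "h3 v \<noteq> 0" "h4 v \<noteq> 0" by auto
    have "indep (forms_dim (2 * d - 1)) (square_family d (var 1) (F v 0) (F v 1) g)"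
      using nonzero_tuple(2) unfolding h1_def by (subst (asm) coeff_det_indep) (auto simp only: hsqf)
    then have ci: "plane_ci d (F v 0) (F v 1) g"
      using d F0(3) F1(3) homg nonzero_tuple(3) unfolding h2_def by unfold_locales auto
    have "d\<^sup>2 \<le> degree (X v)" using nonzero_tuple(4) unfolding h3_def by (rule le_degree)
    moreover have "degree (X v) \<le> d\<^sup>2" unfolding X_def by (rule degree_eliminant[OF d])
    ultimately have deg: "degree (X v) = d\<^sup>2" by simp
    have X: "X v \<noteq> 0" using nonzero_tuple(4) unfolding h3_def by auto
    have roots: "card {x. poly (X v) x = 0} = d\<^sup>2"
      using nonzero_tuple(5) unfolding h4_def res[OF deg] resultant_pderiv_nonzero_iff[OF X] deg .
    show "good_pencil d n v"
      unfolding good_pencil_def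
    proof (rule exI[of _ "F v"], rule exI[of _ g], intro conjI)
      show "card {s. poly (eliminant d (F v 0) (F v 1) g) s = 0} = d\<^sup>2" using roots unfolding X_def .
    qed (rule D(3)[OF nonzero_tuple(1)], rule ci)
  qed
qed

section \<open>Envelopes for a pencil\<close>

lemma vanishing_basis_ideal:
  assumes "nonzero_tuple n v" "vanishing_basis k n v r F"
  shows "ideal_gen (graded_piece (tideal n v) k) = ideal_gen (F ` {..<r})"
proof
  show "ideal_gen (graded_piece (tideal n v) k) \<subseteq> ideal_gen (F ` {..<r})"
  proof (rule ideal_gen_subset, rule subsetI)
    fix f assume "f \<in> graded_piece (tideal n v) k"
    then obtain c where f: "f = lin_comb r c F"
      using assms(2) unfolding vanishing_basis_def graded_tideal[OF assms(1)] by blast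
    show "f \<in> ideal_gen (F ` {..<r})"
      unfolding f by (intro lin_comb_in_ideal ideal_gen_base) auto
  qed
  show "ideal_gen (F ` {..<r}) \<subseteq> ideal_gen (graded_piece (tideal n v) k)"
    by (rule ideal_gen_subset)
      (use assms in \<open>auto simp: vanishing_basis_def graded_tideal intro!: ideal_gen_base\<close>)
qed

text \<open>The two curves generate the ideal of a finite set W. That ideal is saturated, so it is
  the ideal of the envelope itself.\<close>

lemma good_pencil_ci:
  assumes nonzero_tuple: "nonzero_tuple n v" and good: "good_pencil d n v"
  shows "\<exists>W. finite W \<and> card W = d\<^sup>2 \<and> tuple_points n v ` {..<n} \<subseteq> W \<and>
    envelope (tideal n v) d = homogeneous_ideal W \<and> complete_intersection d d (homogeneous_ideal W)"
proof -
  obtain F e where F: "vanishing_basis d n v 2 F" "plane_ci d (F 0) (F 1) e"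
     "card {s. poly (eliminant d (F 0) (F 1) e) s = 0} = d\<^sup>2"
    using good unfolding good_pencil_def by blast
  interpret plane_ci d "F 0" "F 1" e by (rule F(2))
  obtain W where W: "finite W" "card W = d\<^sup>2" "homogeneous_ideal W = ideal_gen {F 0, F 1}"
    using ideal_is_radical[OF F(3)] by blast
  have "{..<2 :: nat} = {0, 1}" by auto
  then have "ideal_gen (graded_piece (tideal n v) d) = homogeneous_ideal W"
    using vanishing_basis_ideal[OF nonzero_tuple F(1)] W(3) by simp
  then have env: "envelope (tideal n v) d = homogeneous_ideal W"
    unfolding envelope_def by (simp add: saturation_homogeneous_ideal)
  have "{F 0, F 1} \<subseteq> tideal n v"
    using F(1) tideal_hom_iff[OF nonzero_tuple hom_F] tideal_hom_iff[OF nonzero_tuple hom_G] by (auto simp: vanishing_basis_def)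
  then have sub: "homogeneous_ideal W \<subseteq> tideal n v"
    unfolding W(3) by (rule ideal_gen_homogeneous_ideal)
  have "tuple_points n v ` {..<n} \<subseteq> W" by (rule homogeneous_ideal_subsetD[OF W(1) sub])
  moreover have "complete_intersection d d (homogeneous_ideal W)"
    unfolding complete_intersection_def
  proof (rule exI[of _ "F 0"], rule exI[of _ "F 1"], intro conjI)
    show "homogeneous d (F 0)" "homogeneous d (F 1)" by (rule hom_F, rule hom_G)
    show "\<forall>h. F 0 * h = 0 \<longrightarrow> h = 0" using F_nonzero by (auto simp only: mult_eq_0_iff)
    show "\<forall>h. F 1 * h \<in> ideal_gen {F 0} \<longrightarrow> h \<in> ideal_gen {F 0}" using G_regular by blast
    have "W \<noteq> {}" using W(2) d_pos by auto
    then obtain P where P: "P \<in> W" by blast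
    obtain w where w: "w \<in> coords P" using ex_coords by blast
    show "1 \<notin> ideal_gen {F 0, F 1}"
    proof
      assume "1 \<in> ideal_gen {F 0, F 1}"
      then have "ev 1 w = 0" using P w unfolding W(3)[symmetric] homogeneous_ideal_eq vanishes_at_def by blast
      then show False by simp
    qed
  qed (rule W(3))
  ultimately show ?thesis using W env by blast
qed

section \<open>Generation in degree d for at least three forms\<close>

lemma ideal_gen_image:
  fixes r :: nat
  shows "ideal_gen (F ` {..<r}) = {\<Sum>l<r. A l * F l | A. True}"
proof
  show "ideal_gen (F ` {..<r}) \<subseteq> {\<Sum>l<r. A l * F l | A. True}"
  proof (rule ideal_gen_minimal)
    show "F ` {..<r} \<subseteq> {\<Sum>l<r. A l * F l | A. True}"
    proof
      fix f assume "f \<in> F ` {..<r}"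
      then obtain j where j: "j < r" "f = F j" by blast
      have "(\<Sum>l<r. (if l = j then 1 else 0) * F l) = (\<Sum>l<r. if l = j then F j else 0)"
        by (rule sum.cong) auto
      also have "\<dots> = f" using j by simp
      finally have "f = (\<Sum>l<r. (if l = j then 1 else 0) * F l)" ..
      then show "f \<in> {\<Sum>l<r. A l * F l | A. True}"
        by (intro CollectI exI[of _ "\<lambda>l. if l = j then 1 else 0"] conjI TrueI)
    qed
    show "0 \<in> {\<Sum>l<r. A l * F l | A. True}"
      by (rule CollectI, rule exI[of _ "\<lambda>l. 0"]) simp
  next
    fix f g assume "f \<in> {\<Sum>l<r. A l * F l | A. True}" "g \<in> {\<Sum>l<r. A l * F l | A. True}"
    then obtain A B where "f = (\<Sum>l<r. A l * F l)" "g = (\<Sum>l<r. B l * F l)" by blast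
    then have "f + g = (\<Sum>l<r. (A l + B l) * F l)" by (simp only: distrib_right sum.distrib)
    then show "f + g \<in> {\<Sum>l<r. A l * F l | A. True}" by (intro CollectI exI[of _ "\<lambda>l. A l + B l"]) simp
  next
    fix f g assume "f \<in> {\<Sum>l<r. A l * F l | A. True}"
    then obtain A where "f = (\<Sum>l<r. A l * F l)" by blast
    then have "g * f = (\<Sum>l<r. (g * A l) * F l)" by (simp only: sum_distrib_left mult.assoc)
    then show "g * f \<in> {\<Sum>l<r. A l * F l | A. True}" by (intro CollectI exI[of _ "\<lambda>l. g * A l"]) simp
  qed
next
  have "(\<Sum>l<r. A l * F l) \<in> ideal_gen (F ` {..<r})" for A
    by (intro ideal_gen_sum ideal_gen_mult ideal_gen_base) auto
  then show "{\<Sum>l<r. A l * F l | A. True} \<subseteq> ideal_gen (F ` {..<r})" by clarify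
qed

lemma hom_in_ideal_gen_image:
  fixes r :: nat
  assumes f: "f \<in> ideal_gen (F ` {..<r})" "homogeneous (j + k) f" and F: "\<And>l. l < r \<Longrightarrow> homogeneous k (F l)"
  shows "\<exists>A. (\<forall>l. homogeneous j (A l)) \<and> f = (\<Sum>l<r. A l * F l)"
proof -
  have "\<exists>A. f = (\<Sum>l<r. A l * F l)" using f(1) unfolding ideal_gen_image by simp
  then obtain A where A: "f = (\<Sum>l<r. A l * F l)" ..
  have "f = hom_part (j + k) f" using hom_part_homogeneous[OF f(2), of "j + k"] by simp
  also have "\<dots> = (\<Sum>l<r. hom_part (j + k) (F l * A l))"
    unfolding A hom_part_sum by (simp only: mult.commute)
  also have "\<dots> = (\<Sum>l<r. F l * hom_part j (A l))"
    by (rule sum.cong) (simp_all add: hom_part_mult[OF F])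
  also have "\<dots> = (\<Sum>l<r. hom_part j (A l) * F l)" by (simp only: mult.commute)
  finally show ?thesis by (intro exI[of _ "\<lambda>l. hom_part j (A l)"]) simp
qed

text \<open>The square grid minus the zeros of the third corner form is the triangle without its corners,
  so three corner forms cut out exactly these points.\<close>

lemma triangle_minus_corners:
  assumes d: "d > 0" and s: "s ` {..<r} \<subseteq> triangle_idx d" "{(d, 0), (0, d), (0, 0)} \<subseteq> s ` {..<r}"
    and f: "homogeneous (3 * d) f" "\<And>q. q \<in> triangle_idx d - s ` {..<r} \<Longrightarrow> ev f (node d q) = 0"
  shows "f \<in> ideal_gen ((\<lambda>l. triangle_form d (s l)) ` {..<r})" (is "f \<in> ideal_gen ?S")
proof -
  obtain b where b: "bij_betw b {..<d\<^sup>2} ({..<d} \<times> {..<d})" using grid_enumeration by blast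
  interpret plane_ci d "triangle_form d (d, 0)" "triangle_form d (0, d)" "\<lambda>i. grid_form d (b i)"
    by (rule grid_ci[OF d b])
  have D_in: "triangle_form d q \<in> ?S" if "q \<in> s ` {..<r}" for q
    using that by (metis (mono_tags, lifting) image_iff)
  define gr where "gr = {..<d} \<times> {..<d}"
  define W where "W = (\<lambda>q. pt (node d q)) ` gr"
  have inj: "inj_on (\<lambda>q. pt (node d q)) gr"
  proof (rule inj_onI)
    fix p q assume pq: "p \<in> gr" "q \<in> gr" "pt (node d p) = pt (node d q)"
    then obtain c where c: "node d q = c *s node d p" using pt_eq_iff[OF node_nonzero node_nonzero] by blast
    then have "node d q $ 1 = c * node d p $ 1" "node d q $ 2 = c * node d p $ 2" by simp_all
    then have "node d p $ 2 = node d q $ 2" by simp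
    then show "p = q" using second_coordinate_inj pq unfolding gr_def by blast
  qed
  have W: "finite W" "card W = d\<^sup>2"
    unfolding W_def using card_image[OF inj] by (auto simp: gr_def power2_eq_square)
  have IW: "homogeneous_ideal W = ideal_gen {triangle_form d (d, 0), triangle_form d (0, d)}"
  proof (rule ideal_of_zeros[OF W])
    fix P assume "P \<in> W"
    then obtain q where q: "q \<in> gr" "P = pt (node d q)" by (auto simp: W_def)
    show "vanishes_at (triangle_form d (d, 0)) P \<and> vanishes_at (triangle_form d (0, d)) P \<and> \<not> vanishes_at (var 1) P"
      unfolding q(2) vanishes_hom[OF hom_F node_nonzero] vanishes_hom[OF hom_G node_nonzero]
        vanishes_hom[OF homogeneous_var node_nonzero]
      using ev_corners_grid q(1) by (simp add: gr_def)
  qed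
  \<comment> \<open>A removed node of the triangle is not a zero of its own form. A grid point
    outside the triangle has i + j > d, so it lies on none of the diagonals making up the form of
    (0, 0).\<close>
  have "\<exists>H \<in> ?S. homogeneous d H \<and> ev H (node d q) \<noteq> 0" if q: "q \<in> gr - (triangle_idx d - s ` {..<r})" for q
  proof (cases "q \<in> triangle_idx d")
    case True
    then have "q \<in> s ` {..<r}" using q by blast
    then show ?thesis using D_in homogeneous_triangle_form[OF True] ev_triangle_form_diag by blast
  next
    case False
    then have "fst q + snd q > d" by (cases q) (auto simp: triangle_idx_def)
    then have "of_nat (fst q + snd q) - of_nat c \<noteq> (0 :: complex)" if "c \<in> {0<..d}" for c
      using that by (simp del: of_nat_add)
    then have "ev (triangle_form d (0, 0)) (node d q) \<noteq> 0"
      by (auto simp: triangle_form_corners ev_lABC simp del: of_nat_add)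
    then show ?thesis using D_in[of "(0, 0)"] s(2) homogeneous_triangle_form[OF corner_in_triangle_idx(3)] by blast
  qed
  then obtain H where H: "\<And>q. q \<in> gr - (triangle_idx d - s ` {..<r}) \<Longrightarrow> H q \<in> ?S \<and> homogeneous d (H q) \<and> ev (H q) (node d q) \<noteq> 0"
    by metis
  define B where "B = gr - (triangle_idx d - s ` {..<r})"
  define h where "h q = const (ev f (node d q) / (ev (grid_form d q) (node d q) * ev (H q) (node d q))) * (var 1 ^ 2 * grid_form d q * H q)" for q
  have finB: "finite B" by (simp add: B_def gr_def)
  have hh: "homogeneous (3 * d) (h q)" if "q \<in> B" for q
  proof -
    have "homogeneous (2 + 2 * (d - 1) + d) (var 1 ^ 2 * grid_form d q * H q)"
      using that H[of q] by (intro homogeneous_mult hom_var_power homogeneous_grid_form) (auto simp: B_def gr_def)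
    moreover have "2 + 2 * (d - 1) + d = 3 * d" using d by simp
    ultimately show ?thesis unfolding h_def by (intro homogeneous_const_mult) (simp only:)
  qed
  have hev: "ev (h q) (node d q') = (if q = q' then ev f (node d q') else 0)" if "q \<in> B" "q' \<in> gr" for q q'
  proof (cases "q = q'")
    case True
    have "ev (grid_form d q) (node d q) \<noteq> 0" "ev (H q) (node d q) \<noteq> 0"
      using ev_grid_form_diag H that(1) by (auto simp: B_def)
    then show ?thesis using True by (simp add: h_def)
  next
    case False
    then show ?thesis using ev_grid_form_off[of q' d q] that(2) by (simp add: h_def gr_def)
  qed
  define f' where "f' = f - (\<Sum>q\<in>B. h q)"
  have "ev f' (node d q') = 0" if q': "q' \<in> gr" for q'
  proof -
    have "(\<Sum>q\<in>B. ev (h q) (node d q')) = (\<Sum>q\<in>B. if q = q' then ev f (node d q') else 0)"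
      by (rule sum.cong) (use hev q' in auto)
    also have "\<dots> = (if q' \<in> B then ev f (node d q') else 0)" using finB by simp
    also have "\<dots> = ev f (node d q')"
    proof (cases "q' \<in> B")
      case False
      then have "q' \<in> triangle_idx d - s ` {..<r}" using q' by (simp add: B_def)
      then show ?thesis using f(2) False by simp
    qed simp
    finally show ?thesis by (simp add: f'_def)
  qed
  moreover have homf': "homogeneous (3 * d) f'"
    unfolding f'_def by (intro homogeneous_diff homogeneous_sum f hh)
  ultimately have "f' \<in> homogeneous_ideal W"
    using vanishes_hom[OF homf' node_nonzero] by (auto simp: homogeneous_ideal_eq W_def)
  then have "f' \<in> ideal_gen {triangle_form d (d, 0), triangle_form d (0, d)}" using IW by simp
  moreover have "ideal_gen {triangle_form d (d, 0), triangle_form d (0, d)} \<subseteq> ideal_gen ?S"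
    by (rule ideal_gen_subset) (use D_in s(2) in \<open>auto intro!: ideal_gen_base\<close>)
  ultimately have "f' \<in> ideal_gen ?S" by blast
  moreover have "(\<Sum>q\<in>B. h q) \<in> ideal_gen ?S"
    unfolding h_def by (intro ideal_gen_sum ideal_gen_mult ideal_gen_base) (use H in \<open>auto simp: B_def\<close>)
  ultimately have "f' + (\<Sum>q\<in>B. h q) \<in> ideal_gen ?S" by (rule ideal_gen_add)
  then show ?thesis by (simp add: f'_def)
qed

text \<open>One degree K above d suffices: higher degrees follow from regularity, and saturation
  ignores lower ones. In degree K the multiples of the curves and forms dual to the points together
  span all forms at the example, which is an open condition.\<close>

lemma generic_generated:
  assumes nr: "n + r = forms_dim d" and r: "r \<ge> 3" and d: "d > 0"
  shows "generic n (\<lambda>v. envelope (tideal n v) d = tideal n v)"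
proof -
  have "card {(d, 0), (0, d), (0, 0 :: nat)} = 3" using d by simp
  moreover have "r \<le> card (triangle_idx d)" using nr by (simp only: card_triangle_idx)
  moreover have "{(d, 0), (0, d), (0, 0)} \<subseteq> triangle_idx d" using corner_in_triangle_idx by simp
  ultimately have "\<exists>S. {(d, 0), (0, d), (0, 0)} \<subseteq> S \<and> S \<subseteq> triangle_idx d \<and> card S = r"
    using r by (intro exists_subset_between) simp_all
  then obtain S where S: "{(d, 0), (0, d), (0, 0)} \<subseteq> S" "S \<subseteq> triangle_idx d" "card S = r" by blast
  have "finite S" using S(2) finite_subset finite_triangle_idx by blast
  then obtain s where bs: "bij_betw s {..<r} S"
    using ex_bij_betw_nat_finite[of S] S(3) by (auto simp: lessThan_atLeast0)
  have sS: "s ` {..<r} = S" using bs by (simp add: bij_betw_def)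
  have s: "inj_on s {..<r}" "s ` {..<r} \<subseteq> triangle_idx d" using bs S(2) by (auto simp: bij_betw_def)
  obtain p e where pe: "bij_betw p {..<n} (triangle_idx d - s ` {..<r})"
    "\<forall>j<n. homogeneous d (e j)" "\<forall>l<r. homogeneous d (triangle_form d (s l))"
    "\<forall>i<n. \<forall>j<n. ev (e j) (node d (p i)) = (if i = j then 1 else 0)"
    "\<forall>i<n. \<forall>l<r. ev (triangle_form d (s l)) (node d (p i)) = 0" "indep r (\<lambda>l. triangle_form d (s l))"
    using triangle_example[OF s nr] by blast
  define v0 where "v0 i = node d (p i)" for i
  have "\<exists>F D. D \<in> poly_fun n \<and> D v0 \<noteq> 0 \<and>
     (\<forall>l<r. poly_family n (\<lambda>v. F v l) \<and> F v0 l = triangle_form d (s l) \<and> (\<forall>v. homogeneous d (F v l))) \<and>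
     (\<forall>v. D v \<noteq> 0 \<longrightarrow> vanishing_basis d n v r (F v) \<and> interpolates d n v)"
    by (rule adapted_deformation[where ?v0.0 = v0 and e = e, OF nr]) (use pe in \<open>auto simp: v0_def\<close>)
  then obtain F D where D: "D \<in> poly_fun n" "D v0 \<noteq> 0"
      "\<And>v. D v \<noteq> 0 \<Longrightarrow> vanishing_basis d n v r (F v) \<and> interpolates d n v"
    and F: "\<And>l. l < r \<Longrightarrow> poly_family n (\<lambda>v. F v l)" "\<And>l. l < r \<Longrightarrow> F v0 l = triangle_form d (s l)"
      "\<And>l v. l < r \<Longrightarrow> homogeneous d (F v l)"
    by blast
  define K where "K = 3 * d"
  \<comment> \<open>The forms dual to the points, lifted to degree K; since all nodes have first
    coordinate 1, their values at the nodes do not change.\<close>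
  define u where "u j = var 1 ^ (2 * d) * e j" for j
  have homu: "homogeneous K (u j)" if "j < n" for j
  proof -
    have "homogeneous (2 * d + d) (u j)" unfolding u_def by (intro homogeneous_mult hom_var_power) (use pe that in blast)
    moreover have "2 * d + d = K" by (simp add: K_def)
    ultimately show ?thesis by simp
  qed
  have uv: "ev (u j) (v0 i) = (if i = j then 1 else 0)" if "i < n" "j < n" for i j
    using pe(4) that by (simp add: u_def v0_def)
  have dec: "\<exists>A c. (\<forall>l. homogeneous (2 * d) (A l)) \<and> f = (\<Sum>l<r. A l * triangle_form d (s l)) + lin_comb n c u"
    if f: "homogeneous K f" for f
  proof -
    define c where "c j = ev f (v0 j)" for j
    have hl: "homogeneous K (f - lin_comb n c u)" by (intro homogeneous_diff f homogeneous_lin_comb homu)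
    have "f - lin_comb n c u \<in> ideal_gen ((\<lambda>l. triangle_form d (s l)) ` {..<r})"
    proof (rule triangle_minus_corners[OF d s(2)])
      show "{(d, 0), (0, d), (0, 0)} \<subseteq> s ` {..<r}" using S(1) sS by simp
      show "homogeneous (3 * d) (f - lin_comb n c u)" using hl by (simp only: K_def)
      fix q assume "q \<in> triangle_idx d - s ` {..<r}"
      then obtain i where i: "i < n" "q = p i" using bij_betw_imp_surj_on[OF pe(1)] by blast
      have "ev (lin_comb n c u) (v0 i) = (\<Sum>j<n. if j = i then c i else 0)"
        unfolding ev_lin_comb by (rule sum.cong) (use uv i in auto)
      then show "ev (f - lin_comb n c u) (node d q) = 0" using i by (simp add: c_def v0_def)
    qed
    then have "\<exists>A. (\<forall>l. homogeneous (2 * d) (A l)) \<and> f - lin_comb n c u = (\<Sum>l<r. A l * triangle_form d (s l))"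
    proof (rule hom_in_ideal_gen_image)
      show "homogeneous (2 * d + d) (f - lin_comb n c u)" using hl by (simp add: K_def)
    qed (use pe(3) in blast)
    then obtain A where A: "\<forall>l. homogeneous (2 * d) (A l)" "f - lin_comb n c u = (\<Sum>l<r. A l * triangle_form d (s l))" by blast
    have "f = (\<Sum>l<r. A l * triangle_form d (s l)) + lin_comb n c u" unfolding A(2)[symmetric] by simp
    then show ?thesis using A(1) by blast
  qed
  have "\<forall>j\<in>{..<forms_dim K}. \<exists>Ac. (\<forall>l. homogeneous (2 * d) (fst Ac l)) \<and>
      monomial_form K j = (\<Sum>l<r. fst Ac l * triangle_form d (s l)) + lin_comb n (snd Ac) u"
  proof
    fix j assume "j \<in> {..<forms_dim K}"
    then have "homogeneous K (monomial_form K j)" by simp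
    then obtain A c where "(\<forall>l. homogeneous (2 * d) (A l)) \<and>
      monomial_form K j = (\<Sum>l<r. A l * triangle_form d (s l)) + lin_comb n c u" using dec by blast
    then show "\<exists>Ac. (\<forall>l. homogeneous (2 * d) (fst Ac l)) \<and>
      monomial_form K j = (\<Sum>l<r. fst Ac l * triangle_form d (s l)) + lin_comb n (snd Ac) u"
      by (intro exI[of _ "(A, c)"]) simp
  qed
  then obtain Ac where Ac: "\<forall>j\<in>{..<forms_dim K}. (\<forall>l. homogeneous (2 * d) (fst (Ac j) l)) \<and>
      monomial_form K j = (\<Sum>l<r. fst (Ac j) l * triangle_form d (s l)) + lin_comb n (snd (Ac j)) u"
    unfolding bchoice_iff by blast
  define A c where "A j = fst (Ac j)" and "c j = snd (Ac j)" for j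
  have A: "(\<forall>l. homogeneous (2 * d) (A j l)) \<and>
      monomial_form K j = (\<Sum>l<r. A j l * triangle_form d (s l)) + lin_comb n (c j) u" if "j < forms_dim K" for j
    using Ac that by (simp add: A_def c_def)
  \<comment> \<open>The expressions of the monomials at the example, with multipliers and
    coefficients kept and only the curves deformed; at v0 the family is the monomial basis.\<close>
  define P where "P v j = (\<Sum>l<r. A j l * F v l) + lin_comb n (c j) u" for v j
  have "\<exists>g\<in>poly_fun n. g v0 \<noteq> 0 \<and> (\<forall>v. g v \<noteq> 0 \<longrightarrow> spans K (forms_dim K) (P v))"
  proof (rule open_spanning)
    fix j assume j: "j < forms_dim K"
    show "poly_family n (\<lambda>v. P v j)"
      unfolding P_def by (intro poly_family_add poly_family_sum poly_family_mult_fixed F poly_family_fixed) simp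
    show "homogeneous K (P v j)" for v
    proof -
      have "homogeneous (2 * d + d) (A j l * F v l)" if "l < r" for l
        by (intro homogeneous_mult F that) (use A j in blast)
      then have "homogeneous K (\<Sum>l<r. A j l * F v l)" by (intro homogeneous_sum) (simp add: K_def)
      then show ?thesis unfolding P_def by (intro homogeneous_add homogeneous_lin_comb homu)
    qed
    have "(\<Sum>l<r. A j l * F v0 l) = (\<Sum>l<r. A j l * triangle_form d (s l))" by (rule sum.cong) (use F(2) in auto)
    then show "P v0 j = monomial_form K j" using A[OF j] by (simp add: P_def)
  qed
  then obtain g where g: "g \<in> poly_fun n" "g v0 \<noteq> 0" "\<And>v. g v \<noteq> 0 \<Longrightarrow> spans K (forms_dim K) (P v)" by blast
  define E where "E v = det_of n (\<lambda>i j. ev (u j) (v i))" for v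
  have E: "E \<in> poly_fun n" unfolding E_def by (rule poly_fun_det_of) (rule poly_fun_ev)
  have "E v0 = 1" unfolding E_def by (rule det_of_identity) (rule uv)
  then have nonzero: "D v0 * (g v0 * E v0) \<noteq> 0" using D(2) g(2) by simp
  have poly_fun: "(\<lambda>v. D v * (g v * E v)) \<in> poly_fun n" by (intro poly_fun_mult D g E)
  show ?thesis
  proof (rule genI[OF poly_fun _ nonzero])
    show "nonzero_tuple n v0" by (simp add: nonzero_tuple_def v0_def node_nonzero)
  next
    fix v assume nonzero_tuple: "nonzero_tuple n v" and "D v * (g v * E v) \<noteq> 0"
    then have nonz: "D v \<noteq> 0" "g v \<noteq> 0" "E v \<noteq> 0" by auto
    note vb = D(3)[OF nonz(1), THEN conjunct1] and int = D(3)[OF nonz(1), THEN conjunct2]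
    have FI: "F v l \<in> graded_piece (tideal n v) d" if "l < r" for l
      using vb that unfolding vanishing_basis_def graded_tideal[OF nonzero_tuple] by blast
    have K: "f \<in> ideal_gen (graded_piece (tideal n v) d)" if f: "homogeneous K f" "f \<in> tideal n v" for f
    proof -
      obtain a where a: "f = lin_comb (forms_dim K) a (P v)" using g(3)[OF nonz(2)] f(1) unfolding spans_def by blast
      define q where "q = lin_comb (forms_dim K) a (\<lambda>j. \<Sum>l<r. A j l * F v l)"
      define c' where "c' i = (\<Sum>j<forms_dim K. a j * c j i)" for i
      have fq: "f = q + lin_comb n c' u"
      proof -
        have "f = q + lin_comb (forms_dim K) a (\<lambda>j. lin_comb n (c j) u)"
          unfolding a q_def P_def lin_comb_def[of "forms_dim K"] by (simp only: distrib_left sum.distrib)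
        then show ?thesis unfolding lin_comb_lin_comb c'_def .
      qed
      have qI: "q \<in> ideal_gen (graded_piece (tideal n v) d)"
        unfolding q_def by (intro lin_comb_in_ideal ideal_gen_sum ideal_gen_mult ideal_gen_base FI) simp
      \<comment> \<open>Both f and its part q in the ideal vanish at the points, so the combination
        of the u does too; the condition E v makes it zero.\<close>
      have "(\<Sum>j<n. ev (u j) (v i) * c' j) = 0" if i: "i < n" for i
      proof -
        have "graded_piece (tideal n v) d \<subseteq> tideal n v" by (auto simp: graded_piece_def)
        then have "q \<in> tideal n v" using qI ideal_gen_homogeneous_ideal by blast
        moreover have "v i \<in> coords (tuple_points n v i)" using nonzero_tuple i coords_self by (simp add: nonzero_tuple_def tuple_points_def)
        ultimately have "ev q (v i) = 0" using i by (auto simp: homogeneous_ideal_eq vanishes_at_def)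
        moreover have "ev f (v i) = 0" using f i tideal_hom_iff[OF nonzero_tuple f(1)] by blast
        ultimately have "ev (lin_comb n c' u) (v i) = 0" unfolding fq by simp
        then show ?thesis unfolding ev_lin_comb .
      qed
      then have "\<forall>j<n. c' j = 0" using nonz(3) unfolding E_def det_of_eq_0_iff by blast
      then have "lin_comb n c' u = 0" by (intro lin_comb_0) auto
      then show ?thesis using fq qI by simp
    qed
    have Kd: "K > d" using d by (simp add: K_def)
    show "envelope (tideal n v) d = tideal n v"
      unfolding envelope_def
    proof (rule saturation_eqI[of _ _ K])
      show "graded_piece (tideal n v) d \<subseteq> tideal n v" by (auto simp: graded_piece_def)
      fix j f assume j: "j \<ge> K" "homogeneous j f" "f \<in> tideal n v"
      have "f \<in> ideal_gen (graded_piece (tideal n v) K)"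
        by (rule regularity_ideal[OF nonzero_tuple int Kd j])
      moreover have "ideal_gen (graded_piece (tideal n v) K) \<subseteq> ideal_gen (graded_piece (tideal n v) d)"
        by (rule ideal_gen_subset) (use K in \<open>auto simp: graded_piece_def\<close>)
      ultimately show "f \<in> ideal_gen (graded_piece (tideal n v) d)" by blast
    qed
  qed
qed

section \<open>Independent points on a given curve\<close>

lemma not_spans:
  assumes "m < forms_dim k" shows "\<not> spans k m P"
proof
  assume sp: "spans k m P"
  have ind: "indep (forms_dim k) (monomial_form k)" unfolding indep_def using monomial_form_indep by blast
  have "monomial_form k ` {..<forms_dim k} \<subseteq> scale.span (P ` {..<m})"
  proof
    fix f assume "f \<in> monomial_form k ` {..<forms_dim k}"
    then have "homogeneous k f" by auto
    then obtain c where "f = lin_comb m c P" using sp unfolding spans_def by blast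
    then show "f \<in> scale.span (P ` {..<m})" using lin_comb_in_span by simp
  qed
  then have "card (monomial_form k ` {..<forms_dim k}) \<le> card (P ` {..<m})"
    using scale.independent_span_bound[of "P ` {..<m}" "monomial_form k ` {..<forms_dim k}"] indep_independent(2)[OF ind] by simp
  also have "\<dots> \<le> m" using card_image_le[of "{..<m}" P] by simp
  finally show False using indep_independent(1)[OF ind] assms by (simp add: card_image)
qed

text \<open>Points of S are added one at a time. While the e and f together do not span, a form
  outside their span, corrected to vanish at the chosen points, is not a multiple of f, so it is
  nonzero at some point of S.\<close>

lemma greedy_points:
  assumes f: "homogeneous k f"
    and S: "\<And>v. v \<in> S \<Longrightarrow> ev f v = 0"
    and unique: "\<And>g. homogeneous k g \<Longrightarrow> (\<And>v. v \<in> S \<Longrightarrow> ev g v = 0) \<Longrightarrow> \<exists>c. g = const c * f"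
    and m: "m + 1 \<le> forms_dim k"
  shows "\<exists>v e. (\<forall>i<m. v i \<in> S) \<and> (\<forall>j<m. homogeneous k (e j)) \<and>
    (\<forall>i<m. \<forall>j<m. ev (e j) (v i) = (if i = j then 1 else 0))"
  using m
proof (induction m)
  case (Suc m)
  have "m + 1 \<le> forms_dim k" using Suc.prems by simp
  then obtain v e where ve0: "(\<forall>i<m. v i \<in> S) \<and> (\<forall>j<m. homogeneous k (e j)) \<and>
    (\<forall>i<m. \<forall>j<m. ev (e j) (v i) = (if i = j then 1 else 0))" using Suc.IH by blast
  then have ve: "\<And>i. i < m \<Longrightarrow> v i \<in> S" "\<And>j. j < m \<Longrightarrow> homogeneous k (e j)"
    "\<And>i j. i < m \<Longrightarrow> j < m \<Longrightarrow> ev (e j) (v i) = (if i = j then 1 else 0)" by blast+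
  define P where "P i = (if i < m then e i else f)" for i
  have "\<not> spans k (Suc m) P" by (rule not_spans) (use Suc.prems in simp)
  then obtain g where g: "homogeneous k g" "\<And>c. g \<noteq> lin_comb (Suc m) c P" unfolding spans_def by blast
  define g' where "g' = g - lin_comb m (\<lambda>j. ev g (v j)) e"
  have homg': "homogeneous k g'" unfolding g'_def by (intro homogeneous_diff g homogeneous_lin_comb ve)
  have g'v: "ev g' (v i) = 0" if i: "i < m" for i
  proof -
    have "ev (lin_comb m (\<lambda>j. ev g (v j)) e) (v i) = (\<Sum>j<m. if j = i then ev g (v i) else 0)"
      unfolding ev_lin_comb by (rule sum.cong) (use ve(3) i in auto)
    then show ?thesis using i by (simp add: g'_def)
  qed
  have "\<exists>w\<in>S. ev g' w \<noteq> 0"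
  proof (rule ccontr)
    assume "\<not> (\<exists>w\<in>S. ev g' w \<noteq> 0)"
    then obtain c where c: "g' = const c * f" using unique[OF homg'] by blast
    define b where "b j = (if j < m then ev g (v j) else c)" for j
    have "lin_comb (Suc m) b P = lin_comb m (\<lambda>j. ev g (v j)) e + const c * f"
      unfolding lin_comb_def by (simp add: b_def P_def)
    also have "\<dots> = g" unfolding c[symmetric] g'_def by simp
    finally show False using g(2) by metis
  qed
  then obtain w where w: "w \<in> S" "ev g' w \<noteq> 0" by blast
  define e1 where "e1 = const (1 / ev g' w) * g'"
  define v' where "v' = v(m := w)"
  \<comment> \<open>The new form is dual to the new point w; subtracting multiples of it from the
    old ones makes these vanish at w without changing their values at the old points.\<close>
  define e' where "e' j = (if j < m then e j - const (ev (e j) w) * e1 else e1)" for j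
  have e1: "homogeneous k e1" "ev e1 w = 1" "\<And>i. i < m \<Longrightarrow> ev e1 (v i) = 0"
    using homg' w(2) g'v by (auto simp: e1_def)
  have "\<forall>i<Suc m. v' i \<in> S" using ve(1) w(1) by (auto simp: v'_def less_Suc_eq)
  moreover have "\<forall>j<Suc m. homogeneous k (e' j)"
    using ve(2) e1(1) by (auto simp: e'_def intro!: homogeneous_diff)
  moreover have "\<forall>i<Suc m. \<forall>j<Suc m. ev (e' j) (v' i) = (if i = j then 1 else 0)"
    using ve(3) e1(2,3) by (auto simp: e'_def v'_def less_Suc_eq)
  ultimately show ?case by blast
qed simp

subsection \<open>The Fermat curve\<close>

definition fermat :: "nat \<Rightarrow> 3 cpoly" where
  "fermat d = (\<Sum>i\<in>UNIV. var i ^ d)"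

lemma homogeneous_fermat: "homogeneous d (fermat d)"
  unfolding fermat_def by (intro homogeneous_sum hom_var_power)

lemma ev_fermat: "ev (fermat d) v = v $ 1 ^ d + v $ 2 ^ d + v $ 3 ^ d"
  by (simp add: fermat_def sum_3)

text \<open>On a line through (1, 0, 0) with w nonzero the Fermat curve has d distinct points. With
  c the value of f at (1, 0, 0), the restriction of f minus c times the Fermat form loses its top
  coefficient and has d roots, so it vanishes; c is the same for all these lines.\<close>

lemma fermat_unique:
  assumes d: "d > 0" and f: "homogeneous d f" and van: "\<And>v. v \<noteq> 0 \<Longrightarrow> ev (fermat d) v = 0 \<Longrightarrow> ev f v = 0"
  shows "\<exists>c. f = const c * fermat d"
proof -
  define c where "c = ev f (vector [1, 0, 0])"
  have "(f - const c * fermat d) * (var 2 ^ d + var 3 ^ d) = 0"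
  proof (rule ev_eq_0)
    fix v :: "complex ^ 3"
    define w where "w = v $ 2 ^ d + v $ 3 ^ d"
    show "ev ((f - const c * fermat d) * (var 2 ^ d + var 3 ^ d)) v = 0"
    proof (cases "w = 0")
      case False
      obtain P where P: "degree P \<le> d" "coeff P d = c"
        "\<And>t. poly P t = ev f (vector [0, v $ 2, v $ 3] + t *s vector [1, 0, 0])"
        using form_on_line[OF f, of "vector [1, 0, 0]" "vector [0, v $ 2, v $ 3]"] unfolding c_def by blast
      have line: "vector [0, v $ 2, v $ 3] + t *s vector [1, 0, 0] = (vector [t, v $ 2, v $ 3] :: complex ^ 3)" for t
        by (simp add: Finite_Cartesian_Product.vec_eq_iff forall_3 vector_3)
      define Q where "Q = P - Polynomial.smult c (monom 1 d + [:w:])"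
      have cQ: "coeff Q d = 0" using P(2) d by (simp add: Q_def coeff_pCons split: nat.splits)
      have "degree Q \<le> d" unfolding Q_def
        by (intro degree_diff_le P(1) order_trans[OF degree_smult_le] degree_add_le) (auto simp: degree_monom_le)
      then have dQ: "Q = 0 \<or> degree Q < d" using cQ by (metis le_neq_implies_less leading_coeff_0_iff)
      have root: "poly Q t = 0" if t: "t ^ d = - w" for t
      proof -
        have "w \<noteq> 0 \<Longrightarrow> t \<noteq> 0" using t d by (auto simp: power_0_left)
        then have "vector [t, v $ 2, v $ 3] \<noteq> (0 :: complex ^ 3)"
          using False by (metis vector_3(1) zero_index)
        moreover have "ev (fermat d) (vector [t, v $ 2, v $ 3]) = 0"
          using t by (simp add: ev_fermat vector_3 w_def)
        ultimately have "ev f (vector [t, v $ 2, v $ 3]) = 0" by (rule van)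
        then show ?thesis using t by (simp add: Q_def P(3) line poly_monom)
      qed
      have "Q = 0"
      proof (rule ccontr)
        assume Q: "Q \<noteq> 0"
        have "card {t. t ^ d = - w} = d" by (rule card_nth_roots) (use False d in auto)
        moreover have "card {t. t ^ d = - w} \<le> card {t. poly Q t = 0}"
          by (rule card_mono[OF poly_roots_finite[OF Q]]) (use root in auto)
        moreover have "card {t. poly Q t = 0} \<le> degree Q" by (rule poly_roots_degree[OF Q])
        ultimately show False using dQ Q by simp
      qed
      then have "P = Polynomial.smult c (monom 1 d + [:w:])" by (simp add: Q_def)
      then have "poly P (v $ 1) = c * (v $ 1 ^ d + w)" by (simp add: poly_monom)
      moreover have "vector [v $ 1, v $ 2, v $ 3] = v"
        by (simp add: Finite_Cartesian_Product.vec_eq_iff forall_3 vector_3)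
      ultimately have "ev f v = c * (v $ 1 ^ d + w)" using P(3)[of "v $ 1"] unfolding line by simp
      then show ?thesis by (simp add: ev_fermat w_def)
    qed (simp add: w_def)
  qed
  moreover have "var 2 ^ d + var 3 ^ d \<noteq> (0 :: 3 cpoly)"
  proof
    assume "var 2 ^ d + var 3 ^ d = (0 :: 3 cpoly)"
    then have "ev (var 2 ^ d + var 3 ^ d) (vector [0, 1, 0]) = 0" by (simp only: poly_eval_0)
    then show False using d by (simp add: vector_3 power_0_left)
  qed
  ultimately have "f - const c * fermat d = 0" by (auto simp only: mult_eq_0_iff)
  then show ?thesis by (intro exI[of _ c]) (simp only: right_minus_eq)
qed

lemma var_power_single: "var i ^ k = Poly_Mapping.single (Poly_Mapping.single i k) 1"
proof (induction k)
  case (Suc k)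
  have "var i ^ Suc k = var i * Poly_Mapping.single (Poly_Mapping.single i k) 1"
    unfolding power_Suc Suc ..
  also have "\<dots> = Poly_Mapping.single (Poly_Mapping.single i 1 + Poly_Mapping.single i k) 1"
    unfolding var_def mult_single by simp
  finally have "var i ^ Suc k = Poly_Mapping.single (Poly_Mapping.single i 1 + Poly_Mapping.single i k) 1" .
  then show ?case by (simp flip: single_add)
qed simp

lemma partial_deriv_fermat:
  assumes d: "d > 0"
  shows "partial_deriv i (fermat d) = const (of_nat d) * var i ^ (d - 1)"
proof (rule poly_mapping_eqI)
  fix m
  have eq: "Poly_Mapping.single j d = m + Poly_Mapping.single i 1 \<longleftrightarrow> j = i \<and> Poly_Mapping.single i (d - 1) = m" for j
  proof
    assume a: "Poly_Mapping.single j d = m + Poly_Mapping.single i 1"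
    then have l: "Poly_Mapping.lookup (Poly_Mapping.single j d) l = Poly_Mapping.lookup (m + Poly_Mapping.single i 1) l" for l
      by simp
    have ji: "j = i" using l[of i] by (auto simp: lookup_single lookup_add when_def split: if_splits)
    have "Poly_Mapping.single i (d - 1) = m"
    proof (rule poly_mapping_eqI)
      fix l' show "Poly_Mapping.lookup (Poly_Mapping.single i (d - 1)) l' = Poly_Mapping.lookup m l'"
        using l[of l'] ji by (auto simp: lookup_single lookup_add when_def split: if_splits)
    qed
    then show "j = i \<and> Poly_Mapping.single i (d - 1) = m" using ji by blast
  next
    assume "j = i \<and> Poly_Mapping.single i (d - 1) = m"
    then show "Poly_Mapping.single j d = m + Poly_Mapping.single i 1"
      using d by (auto simp flip: single_add)
  qed
  have "Poly_Mapping.lookup (fermat d) (m + Poly_Mapping.single i 1) =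
    (\<Sum>j\<in>UNIV. if j = i \<and> Poly_Mapping.single i (d - 1) = m then 1 else 0)"
    unfolding fermat_def lookup_sum var_power_single lookup_single when_def eq ..
  also have "\<dots> = (if Poly_Mapping.single i (d - 1) = m then 1 else 0)"
    by (cases "Poly_Mapping.single i (d - 1) = m") simp_all
  finally have fm: "Poly_Mapping.lookup (fermat d) (m + Poly_Mapping.single i 1) =
    (if Poly_Mapping.single i (d - 1) = m then 1 else 0)" .
  show "Poly_Mapping.lookup (partial_deriv i (fermat d)) m =
    Poly_Mapping.lookup (const (of_nat d) * var i ^ (d - 1)) m"
    unfolding lookup_partial_deriv fm lookup_const_mult var_power_single lookup_single when_def
    using d by (auto simp: lookup_single)
qed

subsection \<open>Smooth curves\<close>

definition smooth_form :: "3 cpoly \<Rightarrow> bool" where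
  "smooth_form F \<longleftrightarrow> (\<forall>P. vanishes_at F P \<longrightarrow> (\<exists>i. \<not> vanishes_at (partial_deriv i F) P))"

text \<open>Smoothness is replaced by the stronger open condition that multiples of the partial
  derivatives span all forms of degree K. A common zero of the derivatives would then annihilate the
  powers of all coordinates.\<close>

lemma generic_smooth:
  assumes nr: "n + 1 = forms_dim d" and d: "d > 0"
  shows "generic n (\<lambda>v. \<exists>F. vanishing_basis d n v 1 F \<and> smooth_form (F 0))"
proof -
  define S where "S = {v. v \<noteq> 0 \<and> ev (fermat d) v = 0}"
  have "\<exists>v e. (\<forall>i<n. v i \<in> S) \<and> (\<forall>j<n. homogeneous d (e j)) \<and>
    (\<forall>i<n. \<forall>j<n. ev (e j) (v i) = (if i = j then 1 else 0))"
  proof (rule greedy_points[OF homogeneous_fermat])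
    show "ev (fermat d) v = 0" if "v \<in> S" for v using that by (simp add: S_def)
    show "\<exists>c. g = const c * fermat d" if "homogeneous d g" "\<And>v. v \<in> S \<Longrightarrow> ev g v = 0" for g
      by (rule fermat_unique[OF d that(1)]) (use that(2) in \<open>simp add: S_def\<close>)
  qed (use nr in simp)
  then obtain v0 e where ve: "\<forall>i<n. v0 i \<in> S" "\<forall>j<n. homogeneous d (e j)"
    "\<forall>i<n. \<forall>j<n. ev (e j) (v0 i) = (if i = j then 1 else 0)" by blast
  have "ev (fermat d) (vector [1, 0, 0]) = 1" using d by (simp add: ev_fermat vector_3 power_0_left)
  then have f0: "fermat d \<noteq> 0" by auto
  have "indep 1 (\<lambda>l. fermat d)"
    unfolding indep_def
  proof (intro allI impI)
    fix c and l :: nat assume c: "lin_comb 1 c (\<lambda>l. fermat d) = 0" and l: "l < 1"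
    have "ev (lin_comb 1 c (\<lambda>l. fermat d)) (vector [1, 0, 0]) = 0" unfolding c by simp
    then show "c l = 0" using l \<open>ev (fermat d) (vector [1, 0, 0]) = 1\<close> by (simp add: ev_lin_comb)
  qed
  then have "\<exists>F D. D \<in> poly_fun n \<and> D v0 \<noteq> 0 \<and>
     (\<forall>l<1. poly_family n (\<lambda>v. F v l) \<and> F v0 l = fermat d \<and> (\<forall>v. homogeneous d (F v l))) \<and>
     (\<forall>v. D v \<noteq> 0 \<longrightarrow> vanishing_basis d n v 1 (F v) \<and> interpolates d n v)"
    by (intro adapted_deformation[where ?v0.0 = v0 and e = e, OF nr])
      (use ve homogeneous_fermat in \<open>auto simp: S_def\<close>)
  then obtain F D where D: "D \<in> poly_fun n" "D v0 \<noteq> 0" "\<And>v. D v \<noteq> 0 \<Longrightarrow> vanishing_basis d n v 1 (F v)"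
    and F: "poly_family n (\<lambda>v. F v 0)" "F v0 0 = fermat d" "\<And>v. homogeneous d (F v 0)"
    by fastforce
  \<comment> \<open>Three exponents with sum 3 * d cannot all be below d - 1, so each monomial is
    divisible by the power in some partial derivative of the Fermat form.\<close>
  define K where "K = 3 * d"
  have dec: "\<exists>i A. homogeneous (K - (d - 1)) A \<and> monomial_form K j = A * partial_deriv i (fermat d)" if j: "j < forms_dim K" for j
  proof -
    define m where "m = nth_monomial K j"
    have "weight UNIV m = K" using bij_betwE[OF bij_nth_monomial, of K] j by (auto simp: m_def monomials_def)
    then have total: "Poly_Mapping.lookup m 1 + Poly_Mapping.lookup m 2 + Poly_Mapping.lookup m 3 = 3 * d"
      by (simp add: weight_UNIV sum_3 K_def)
    have "\<exists>i. Poly_Mapping.lookup m i \<ge> d - 1" 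
    proof -
      have "d - 1 \<le> Poly_Mapping.lookup m 1 \<or> d - 1 \<le> Poly_Mapping.lookup m 2 \<or> d - 1 \<le> Poly_Mapping.lookup m 3"
        using total by linarith
      then show ?thesis by blast
    qed
    then obtain i where i: "Poly_Mapping.lookup m i \<ge> d - 1" ..
    define m' where "m' = m - Poly_Mapping.single i (d - 1)"
    have m: "m = m' + Poly_Mapping.single i (d - 1)"
      by (rule poly_mapping_eqI) (use i in \<open>auto simp: m'_def lookup_add lookup_minus lookup_single when_def\<close>)
    have "weight UNIV m' + (d - 1) = K"
      using \<open>weight UNIV m = K\<close> unfolding m by (simp add: weight_single)
    then have wm': "weight UNIV m' = K - (d - 1)" by simp
    define A where "A = Poly_Mapping.single m' (1 / of_nat d :: complex)"
    have "homogeneous (K - (d - 1)) A" unfolding A_def by (auto simp: homogeneous_weight wm')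
    moreover have "monomial_form K j = A * partial_deriv i (fermat d)"
      using d unfolding partial_deriv_fermat[OF d] monomial_form_def m_def[symmetric] A_def const_def var_power_single mult_single
      by (subst m) simp
    ultimately show ?thesis by blast
  qed
  have "\<forall>j\<in>{..<forms_dim K}. \<exists>q. homogeneous (K - (d - 1)) (snd q) \<and> monomial_form K j = snd q * partial_deriv (fst q) (fermat d)"
    using dec by fastforce
  then obtain q where q: "\<forall>j\<in>{..<forms_dim K}. homogeneous (K - (d - 1)) (snd (q j)) \<and>
      monomial_form K j = snd (q j) * partial_deriv (fst (q j)) (fermat d)"
    unfolding bchoice_iff by blast
  \<comment> \<open>The multipliers found for the Fermat curve are applied to the derivatives of the
    deformed curve.\<close>
  define P where "P v j = snd (q j) * partial_deriv (fst (q j)) (F v 0)" for v j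
  have "\<exists>g\<in>poly_fun n. g v0 \<noteq> 0 \<and> (\<forall>v. g v \<noteq> 0 \<longrightarrow> spans K (forms_dim K) (P v))"
  proof (rule open_spanning)
    fix j assume j: "j < forms_dim K"
    show "poly_family n (\<lambda>v. P v j)" unfolding P_def by (intro poly_family_mult_fixed poly_family_partial_deriv F)
    show "homogeneous K (P v j)" for v
    proof -
      have "homogeneous (d - 1) (partial_deriv (fst (q j)) (F v 0))"
        by (rule homogeneous_partial_deriv) (use d F(3) in simp)
      then have "homogeneous (K - (d - 1) + (d - 1)) (P v j)"
        unfolding P_def using q j by (intro homogeneous_mult) auto
      moreover have "K - (d - 1) + (d - 1) = K" by (simp add: K_def)
      ultimately show ?thesis by (simp only:)
    qed
    show "P v0 j = monomial_form K j" using q j by (simp add: P_def F(2))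
  qed
  then obtain g where g: "g \<in> poly_fun n" "g v0 \<noteq> 0" "\<And>v. g v \<noteq> 0 \<Longrightarrow> spans K (forms_dim K) (P v)" by blast
  show ?thesis
  proof (rule genI[of "\<lambda>v. D v * g v" n v0])
    show "(\<lambda>v. D v * g v) \<in> poly_fun n" by (intro poly_fun_mult D g)
    show "nonzero_tuple n v0" using ve(1) by (simp add: nonzero_tuple_def S_def)
    show "D v0 * g v0 \<noteq> 0" using D(2) g(2) by simp
    fix v assume "D v * g v \<noteq> 0"
    then have nonz: "D v \<noteq> 0" "g v \<noteq> 0" by auto
    have "smooth_form (F v 0)"
      unfolding smooth_form_def
    proof (intro allI impI, rule ccontr)
      fix Q assume "\<not> (\<exists>i. \<not> vanishes_at (partial_deriv i (F v 0)) Q)"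
      then have van: "vanishes_at (partial_deriv i (F v 0)) Q" for i by blast
      obtain w where w: "w \<in> coords Q" using ex_coords by blast
      have "w $ i = 0" for i
      proof -
        obtain c where c: "var i ^ K = lin_comb (forms_dim K) c (P v)"
          using g(3)[OF nonz(2)] hom_var_power unfolding spans_def by blast
        have "ev (P v j) w = 0" for j
          using van w unfolding P_def vanishes_at_def by simp
        then have "ev (var i ^ K) w = 0" unfolding c ev_lin_comb by simp
        then show ?thesis by simp
      qed
      then have "w = 0" by (simp add: Finite_Cartesian_Product.vec_eq_iff)
      then show False using pt_coords(1)[OF w] by simp
    qed
    then show "\<exists>F. vanishing_basis d n v 1 F \<and> smooth_form (F 0)" using D(3)[OF nonz(1)] by blast
  qed
qed

section \<open>Principal ideals and further points on a curve\<close>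

text \<open>X and Y are coprime: where X = 0 and Y is nonzero the relation forces a to vanish, so
  one factor X can be split off at a time.\<close>

lemma divide_var_powers:
  assumes "a * var 2 ^ j = b * (var 1 :: 3 cpoly) ^ k"
  shows "\<exists>c. a = var 1 ^ k * c"
  using assms
proof (induction k arbitrary: a)
  case (Suc k)
  have "\<exists>a'. a = (var 1 - 0) * a'"
  proof (rule var_diff_dvd[of _ _ 2])
    fix v :: "complex ^ 3" assume v: "v $ 1 = ev 0 v" "v $ 2 \<noteq> 0"
    have "v $ 1 = 0" using v(1) by (simp only: poly_eval_0)
    then have "ev (b * var 1 ^ Suc k) v = 0"
      by (simp only: poly_eval_mult poly_eval_power poly_eval_var power_Suc mult_zero_left mult_zero_right)
    then have "ev (a * var 2 ^ j) v = 0" unfolding Suc.prems .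
    then show "ev a v = 0" using v(2) by (auto simp only: poly_eval_mult poly_eval_power poly_eval_var mult_eq_0_iff power_eq_0_iff)
  qed auto
  then obtain a' where a': "a = var 1 * a'" by auto
  have "var 1 * (a' * var 2 ^ j) = var 1 * (b * var 1 ^ k)"
    using Suc.prems unfolding a' by (simp only: power_Suc mult.assoc mult.left_commute[of b])
  then have "a' * var 2 ^ j = b * var 1 ^ k" using var_nonzero[of 1] by (auto simp only: mult_cancel_left)
  then obtain c where "a' = var 1 ^ k * c" using Suc.IH by blast
  then show ?case unfolding a' by (intro exI[of _ c]) (simp only: power_Suc mult.assoc)
qed simp

text \<open>Testing with the powers of X and Y gives f * X^k = F * a and f * Y^k = F * b, hence a *
  Y^k = b * X^k. So X^k divides a and can be cancelled.\<close>

lemma saturation_principal: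
  assumes F: "F \<noteq> 0" shows "saturation (ideal_gen {F}) = ideal_gen {F}"
proof (rule equalityI[OF subsetI saturation_superset])
  fix f assume "f \<in> saturation (ideal_gen {F})"
  then obtain k where k: "\<And>g. homogeneous k g \<Longrightarrow> f * g \<in> ideal_gen {F}" by (auto simp: saturation_def)
  obtain a where a: "f * var 1 ^ k = F * a" using k[OF hom_var_power] by (auto simp: ideal_gen_single)
  obtain b where b: "f * var 2 ^ k = F * b" using k[OF hom_var_power] by (auto simp: ideal_gen_single)
  have "F * (a * var 2 ^ k) = f * var 1 ^ k * var 2 ^ k" unfolding a by (simp only: mult.assoc)
  also have "\<dots> = f * var 2 ^ k * var 1 ^ k" by (simp only: mult.assoc mult.commute[of "var 1 ^ k"])
  also have "\<dots> = F * (b * var 1 ^ k)" unfolding b by (simp only: mult.assoc)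
  finally have "F * (a * var 2 ^ k) = F * (b * var 1 ^ k)" .
  then have "a * var 2 ^ k = b * var 1 ^ k" using F by (auto simp only: mult_cancel_left)
  then obtain c where c: "a = var 1 ^ k * c" using divide_var_powers by blast
  have "var 1 ^ k * f = var 1 ^ k * (F * c)"
  proof -
    have "var 1 ^ k * f = F * (var 1 ^ k * c)" using a unfolding c by (simp only: mult.commute[of f])
    then show ?thesis by (simp only: mult.left_commute[of F])
  qed
  moreover have "var 1 ^ k \<noteq> (0 :: 3 cpoly)" using var_nonzero[of 1] by (auto simp only: power_eq_0_iff)
  ultimately have "f = F * c" by (auto simp only: mult_cancel_left)
  then show "f \<in> ideal_gen {F}" by (auto simp: ideal_gen_single)
qed

text \<open>A line that avoids W still meets the curve. The new point separates the curve from Z,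
  which shows for r = 1 that the d-envelope is larger than Z.\<close>

lemma curve_extra_point:
  assumes F: "homogeneous d F" and d: "d > 0" and W: "finite W"
  shows "\<exists>w. w \<noteq> 0 \<and> ev F w = 0 \<and> pt w \<notin> W"
proof -
  have "\<forall>P\<in>W. \<exists>v. v \<noteq> 0 \<and> P = pt v" using pt_cases by metis
  then obtain r where r: "\<And>P. P \<in> W \<Longrightarrow> r P \<noteq> 0 \<and> P = pt (r P)" by metis
  have "0 \<notin> r ` W" using r by force
  then obtain t where t: "\<forall>v\<in>r ` W. ev (linear_form (vector [1, t, t\<^sup>2])) v \<noteq> 0"
    using avoiding_line_explicit[of "r ` W"] W by blast
  define l where "l = linear_form (vector [1, t, t\<^sup>2])"
  \<comment> \<open>Two points spanning the line with coefficients 1, t, t^2. The restriction of F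
    to p + s * q has a root s, unless its degree drops, and then q itself lies on the curve.\<close>
  define p q :: "complex ^ 3" where "p = vector [- t, 1, 0]" and "q = vector [- (t\<^sup>2), 0, 1]"
  have notW: "pt w \<notin> W" if "w \<noteq> 0" "ev l w = 0" for w
  proof
    assume w: "pt w \<in> W"
    then have "vanishes_at l (pt (r (pt w)))"
      using r[OF w] that vanishes_hom[OF homogeneous_linear_form that(1)] unfolding l_def by metis
    then show False using t w r[OF w] vanishes_hom[OF homogeneous_linear_form] unfolding l_def by blast
  qed
  obtain P where P: "degree P \<le> d" "coeff P d = ev F q" "\<And>s. poly P s = ev F (p + s *s q)"
    using form_on_line[OF F, of q p] by blast
  show ?thesis
  proof (cases "ev F q = 0")
    case True
    have "q \<noteq> 0" by (metis q_def vector_3(3) zero_index zero_neq_one)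
    moreover have "ev l q = 0" by (simp add: l_def q_def ev_linear_form vector_3)
    ultimately show ?thesis using True notW by blast
  next
    case False
    then have "degree P = d" using P(1,2) le_degree[of P d] by simp
    then have "\<not> constant (poly P)" using d by (simp add: constant_degree)
    then obtain s where s: "poly P s = 0" using fundamental_theorem_of_algebra by blast
    have "(p + s *s q) $ 2 = 1" by (simp add: p_def q_def vector_3)
    then have "p + s *s q \<noteq> 0" by (metis zero_index zero_neq_one)
    moreover have "ev l (p + s *s q) = 0"
      by (simp add: l_def p_def q_def ev_linear_form vector_3 power2_eq_square)
    ultimately show ?thesis using s notW unfolding P(3) by blast
  qed
qed

section \<open>Assembly of the cases\<close>

lemma generic_true: "generic n (\<lambda>v. True)"
  by (rule genI[of "\<lambda>_. 1" n "\<lambda>_. vector [1, 0, 0]"])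
    (auto simp: poly_fun_const nonzero_tuple_def vector_3 Finite_Cartesian_Product.vec_eq_iff intro!: exI[of _ 1])

text \<open>The value of r does not depend on the tuple, so all cases can be combined into one
  generic condition.\<close>

lemma generic_imp: "(P \<Longrightarrow> generic n Q) \<Longrightarrow> generic n (\<lambda>v. P \<longrightarrow> Q v)"
  by (cases P) (auto intro: generic_mono[OF generic_true])

text \<open>For r = 2, where n = \<open>forms_dim d - 2\<close>, this is the count d^2 - n of the
  extra points.\<close>

lemma excess_points: "d > 0 \<Longrightarrow> forms_dim d + ((d - 1) choose 2) = d\<^sup>2 + 2"
proof (induction d)
  case (Suc d)
  show ?case
  proof (cases d)
    case 0
    then show ?thesis by (simp add: numeral_2_eq_2)
  next
    case (Suc k)
    have "forms_dim (Suc d) = forms_dim d + (d + 2)" by (simp add: numeral_2_eq_2)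
    moreover have "(d choose 2) = ((d - 1) choose 2) + (d - 1)" using Suc by (simp add: numeral_2_eq_2)
    moreover have "forms_dim d + ((d - 1) choose 2) = d\<^sup>2 + 2" using Suc.IH Suc by simp
    ultimately show ?thesis using Suc by (simp add: power2_eq_square)
  qed
qed simp

theorem corollary2p11:
  fixes n d r :: nat
  assumes "n > 1"
    and "(d + 1) choose 2 \<le> n"
    and "int n = int ((d + 2) choose 2) - int r"
    and "r > 0"
  shows "general_points n (\<lambda>Z. let I = homogeneous_ideal Z in
      (graded_piece I d \<noteq> {0} \<and> (\<forall>m<d. graded_piece I m = {0}) \<and>
        vector_space.dim poly_scale (graded_piece I d) = r) \<and>
      (r = 1 \<longrightarrow>
        geometric_generating_degrees I = {d, d + 1} \<and>
        smooth_plane_curve d (envelope I d)) \<and>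
      (r = 2 \<and> d > 2 \<longrightarrow>
        geometric_generating_degrees I = {d, d + 1} \<and>
        (\<exists>W. finite W \<and> card W = d\<^sup>2 \<and>
          envelope I d = homogeneous_ideal W \<and>
          complete_intersection d d (envelope I d) \<and>
          Z \<subseteq> W \<and>
          int (card (W - Z)) = int (d\<^sup>2) - int n \<and>
          int (d\<^sup>2) - int n = int ((d - 1) choose 2))) \<and>
      (r = 2 \<and> d = 2 \<longrightarrow> geometric_generating_degrees I = {2}) \<and>
      (r \<ge> 3 \<longrightarrow> geometric_generating_degrees I = {d}))"
proof (rule general_pointsI)
  have nr: "n + r = forms_dim d" using assms(3) by linarith
  have d: "d > 0"
  proof (rule ccontr)
    assume "\<not> d > 0"
    then have "n + r = 1" using nr by (simp add: numeral_2_eq_2)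
    then show False using assms(1) by simp
  qed
  define low where "low v \<longleftrightarrow> graded_piece (tideal n v) (d - 1) = {0}" for v
  define basis where "basis v \<longleftrightarrow> (\<exists>F. vanishing_basis d n v r F \<and> interpolates d n v)" for v
  define smooth where "smooth v \<longleftrightarrow> (\<exists>F. vanishing_basis d n v 1 F \<and> smooth_form (F 0))" for v
  define generated where "generated v \<longleftrightarrow> envelope (tideal n v) d = tideal n v" for v
  \<comment> \<open>Degree d - 1 is enough, since lower degrees follow by multiplication with X;
    \<open>forms_dim (d - 1)\<close> is (d + 1) choose 2, the lower bound on n.\<close>
  have "generic n low"
    unfolding low_def by (rule generic_no_forms) (use assms(2) d in simp)
  moreover have "generic n basis" unfolding basis_def by (rule generic_basis[OF nr]) simp
  moreover have "generic n (\<lambda>v. r = 1 \<longrightarrow> smooth v)"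
    unfolding smooth_def by (intro generic_imp generic_smooth d) (use nr in simp)
  moreover have "generic n (\<lambda>v. r = 2 \<longrightarrow> good_pencil d n v)"
    by (intro generic_imp generic_good_pencil d) (use nr in simp)
  moreover have "generic n (\<lambda>v. r \<ge> 3 \<longrightarrow> generated v)"
    unfolding generated_def by (intro generic_imp generic_generated[OF nr] d)
  ultimately have "generic n (\<lambda>v. low v \<and> basis v \<and> (r = 1 \<longrightarrow> smooth v) \<and>
      (r = 2 \<longrightarrow> good_pencil d n v) \<and> (r \<ge> 3 \<longrightarrow> generated v))"
    by (intro generic_conj)
  then show "generic n (\<lambda>v. inj_on (tuple_points n v) {..<n} \<longrightarrow> (let I = tideal n v in
      (graded_piece I d \<noteq> {0} \<and> (\<forall>m<d. graded_piece I m = {0}) \<and>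
        vector_space.dim poly_scale (graded_piece I d) = r) \<and>
      (r = 1 \<longrightarrow>
        geometric_generating_degrees I = {d, d + 1} \<and>
        smooth_plane_curve d (envelope I d)) \<and>
      (r = 2 \<and> d > 2 \<longrightarrow>
        geometric_generating_degrees I = {d, d + 1} \<and>
        (\<exists>W. finite W \<and> card W = d\<^sup>2 \<and>
          envelope I d = homogeneous_ideal W \<and>
          complete_intersection d d (envelope I d) \<and>
          tuple_points n v ` {..<n} \<subseteq> W \<and>
          int (card (W - tuple_points n v ` {..<n})) = int (d\<^sup>2) - int n \<and>
          int (d\<^sup>2) - int n = int ((d - 1) choose 2))) \<and>
      (r = 2 \<and> d = 2 \<longrightarrow> geometric_generating_degrees I = {2}) \<and>
      (r \<ge> 3 \<longrightarrow> geometric_generating_degrees I = {d})))"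
  proof (rule generic_mono, intro impI)
    fix v
    assume nonzero_tuple: "nonzero_tuple n v" and inj: "inj_on (tuple_points n v) {..<n}"
      and conds: "low v \<and> basis v \<and> (r = 1 \<longrightarrow> smooth v) \<and>
        (r = 2 \<longrightarrow> good_pencil d n v) \<and> (r \<ge> 3 \<longrightarrow> generated v)"
    define I where "I = tideal n v"
    define Z where "Z = tuple_points n v ` {..<n}"
    have Z: "finite Z" "card Z = n" using inj by (simp_all add: Z_def card_image)
    obtain F where F: "vanishing_basis d n v r F" and int: "interpolates d n v"
      using conds unfolding basis_def by blast
    have low: "graded_piece I m = {0}" if "m < d" for m
      using conds graded_piece_low[of "tuple_points n v ` {..<n}" "d - 1" m] that unfolding low_def I_def by simp
    have F0: "F 0 \<in> graded_piece I d"
      using F assms(4) unfolding vanishing_basis_def graded_tideal[OF nonzero_tuple] I_def by blast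
    have F00: "F 0 \<noteq> 0"
    proof
      assume "F 0 = 0"
      then have "lin_comb r (\<lambda>i. if i = 0 then 1 else 0) F = 0"
        unfolding lin_comb_def by (intro sum.neutral) auto
      then show False using F assms(4) unfolding vanishing_basis_def indep_def by fastforce
    qed
    have F0E: "F 0 \<in> envelope I d"
      unfolding envelope_def using F0 ideal_gen_base saturation_superset by blast
    have ggd: "geometric_generating_degrees I = (if envelope I d = I then {d} else {d, d + 1})"
    proof (rule generating_degrees[OF d])
      show "envelope I m = {0}" if "m < d" for m using low[OF that] by (rule envelope_0)
      show "envelope I d \<noteq> {0}" using F0E F00 by blast
      show "envelope I m = I" if "m > d" for m unfolding I_def by (rule regularity[OF nonzero_tuple int that])
    qed
    have r1: "geometric_generating_degrees I = {d, d + 1} \<and> smooth_plane_curve d (envelope I d)" if r: "r = 1"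
    proof -
      obtain G where G: "vanishing_basis d n v 1 G" "smooth_form (G 0)"
        using conds r unfolding smooth_def by blast
      have homG: "homogeneous d (G 0)" using G(1) by (simp add: vanishing_basis_def)
      have G0: "G 0 \<noteq> 0"
      proof
        assume "G 0 = 0"
        then have "lin_comb 1 (\<lambda>i. 1) G = 0" by (simp add: lin_comb_def)
        then show False using G(1) unfolding vanishing_basis_def indep_def by fastforce
      qed
      have "G ` {..<1} = {G 0}" by auto
      then have "ideal_gen (graded_piece I d) = ideal_gen {G 0}"
        using vanishing_basis_ideal[OF nonzero_tuple G(1)] by (simp only: I_def)
      then have env: "envelope I d = ideal_gen {G 0}"
        unfolding envelope_def by (simp only: saturation_principal[OF G0])
      obtain w where w: "w \<noteq> 0" "ev (G 0) w = 0" "pt w \<notin> Z"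
        using curve_extra_point[OF homG d Z(1)] by blast
      \<comment> \<open>A form through Z that misses the extra point w of the curve lies in I but is
        no multiple of G 0.\<close>
      obtain f where f: "homogeneous (card Z) f" "\<not> vanishes_at f (pt w)" "\<forall>Q\<in>Z. vanishes_at f Q"
        using interpolating_form[OF Z(1) w(3), of "card Z"] by auto
      have "f \<in> I" using f(3) unfolding I_def Z_def[symmetric] homogeneous_ideal_eq by blast
      moreover have "f \<notin> ideal_gen {G 0}"
      proof
        assume "f \<in> ideal_gen {G 0}"
        then obtain h where "f = G 0 * h" by (auto simp: ideal_gen_single)
        then have "ev f w = 0" using w(2) by simp
        then show False using f(2) vanishes_hom[OF f(1) w(1)] by blast
      qed
      ultimately have "envelope I d \<noteq> I" unfolding env by blast
      moreover have "smooth_plane_curve d (envelope I d)"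
        unfolding smooth_plane_curve_def
        using d G0 homG env G(2)[unfolded smooth_form_def] by blast
      ultimately show ?thesis using ggd by simp
    qed
    have r2: "\<exists>W. finite W \<and> card W = d\<^sup>2 \<and> envelope I d = homogeneous_ideal W \<and>
        complete_intersection d d (envelope I d) \<and> Z \<subseteq> W \<and>
        int (card (W - Z)) = int (d\<^sup>2) - int n \<and> int (d\<^sup>2) - int n = int ((d - 1) choose 2) \<and>
        (envelope I d = I \<longleftrightarrow> (d - 1) choose 2 = 0)" if r: "r = 2"
    proof -
      have "good_pencil d n v" using conds r by blast
      then obtain W where W: "finite W" "card W = d\<^sup>2" "Z \<subseteq> W" "envelope I d = homogeneous_ideal W"
          "complete_intersection d d (homogeneous_ideal W)"
        using good_pencil_ci[OF nonzero_tuple, of d] unfolding I_def Z_def by blast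
      have "d\<^sup>2 = n + ((d - 1) choose 2)" using excess_points[OF d] nr r by linarith
      then have e: "int (d\<^sup>2) - int n = int ((d - 1) choose 2)" by linarith
      have "card (W - Z) = card W - card Z" using Z(1) W(3) by (rule card_Diff_subset)
      moreover have "card Z \<le> card W" by (rule card_mono[OF W(1,3)])
      ultimately have c: "int (card (W - Z)) = int (d\<^sup>2) - int n" using W(2) Z(2) by linarith
      \<comment> \<open>W contains Z, so equality of the ideals means that there are no extra
        points; both d > 2 and d = 2 are read off from the binomial coefficient.\<close>
      have "envelope I d = I \<longleftrightarrow> (d - 1) choose 2 = 0"
      proof
        assume "envelope I d = I"
        then have "homogeneous_ideal W = I" using W(4) by simp
        then have "homogeneous_ideal Z \<subseteq> homogeneous_ideal W" unfolding I_def Z_def by simp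
        then have "W \<subseteq> Z" by (rule homogeneous_ideal_subsetD[OF Z(1)])
        then have "W = Z" using W(3) by blast
        then show "(d - 1) choose 2 = 0" using c e by simp
      next
        assume "(d - 1) choose 2 = 0"
        then have "card (W - Z) = 0" using c e by linarith
        then have "W = Z" using W(1,3) by auto
        then have "homogeneous_ideal W = I" by (simp add: I_def Z_def)
        then show "envelope I d = I" using W(4) by simp
      qed
      then show ?thesis using W c e by (intro exI[of _ W]) simp
    qed
    have r2_iff: "envelope I d = I \<longleftrightarrow> (d - 1) choose 2 = 0" if "r = 2"
      using r2[OF that] by (elim exE conjE)
    have r2_ci: "\<exists>W. finite W \<and> card W = d\<^sup>2 \<and> envelope I d = homogeneous_ideal W \<and>
        complete_intersection d d (envelope I d) \<and> Z \<subseteq> W \<and>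
        int (card (W - Z)) = int (d\<^sup>2) - int n \<and> int (d\<^sup>2) - int n = int ((d - 1) choose 2)" if "r = 2"
      using r2[OF that] by (elim exE conjE) (intro exI conjI)
    have r2_deg: "geometric_generating_degrees I = {d, d + 1}" if "r = 2" "d > 2"
    proof -
      have "(d - 1) choose 2 \<noteq> 0" using that(2) by (simp add: binomial_eq_0_iff)
      then have "envelope I d \<noteq> I" using r2_iff[OF that(1)] by simp
      then show ?thesis using ggd by simp
    qed
    have r2_deg_2: "geometric_generating_degrees I = {2}" if "r = 2" "d = 2"
    proof -
      have "(d - 1) choose 2 = 0" using that(2) by simp
      then have "envelope I d = I" using r2_iff[OF that(1)] by simp
      then show ?thesis using ggd that(2) by simp
    qed
    have r3_deg: "geometric_generating_degrees I = {d}" if "r \<ge> 3"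
      using conds that ggd unfolding generated_def I_def by simp
    have nonzero: "graded_piece I d \<noteq> {0}" using F0 F00 by blast
    have dim: "vector_space.dim poly_scale (graded_piece I d) = r"
      unfolding I_def by (rule dim_graded_piece[OF nonzero_tuple F])
    show "let I = tideal n v in
      (graded_piece I d \<noteq> {0} \<and> (\<forall>m<d. graded_piece I m = {0}) \<and>
        vector_space.dim poly_scale (graded_piece I d) = r) \<and>
      (r = 1 \<longrightarrow>
        geometric_generating_degrees I = {d, d + 1} \<and>
        smooth_plane_curve d (envelope I d)) \<and>
      (r = 2 \<and> d > 2 \<longrightarrow>
        geometric_generating_degrees I = {d, d + 1} \<and>
        (\<exists>W. finite W \<and> card W = d\<^sup>2 \<and>
          envelope I d = homogeneous_ideal W \<and>
          complete_intersection d d (envelope I d) \<and>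
          tuple_points n v ` {..<n} \<subseteq> W \<and>
          int (card (W - tuple_points n v ` {..<n})) = int (d\<^sup>2) - int n \<and>
          int (d\<^sup>2) - int n = int ((d - 1) choose 2))) \<and>
      (r = 2 \<and> d = 2 \<longrightarrow> geometric_generating_degrees I = {2}) \<and>
      (r \<ge> 3 \<longrightarrow> geometric_generating_degrees I = {d})"
      unfolding Let_def unfolding I_def[symmetric] unfolding Z_def[symmetric]
      by (intro conjI impI allI; (elim conjE)?; (rule nonzero dim low r1[THEN conjunct1]
        r1[THEN conjunct2] r2_deg r2_ci r2_deg_2 r3_deg; assumption))
  qed
qed

end
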